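(* The set of positive integers representable as $p+F_{2^k}+F_q$, where $p,q$ are primes and $k\ge 0$ is an integer, has positive lower asymptotic density.
   Context: $F_n$ denotes the $n$-th Fibonacci number: $F_0=0$, $F_1=1$, $F_{n+2}=F_{n+1}+F_n$ for $n\ge 0$. The lower asymptotic density of a set $A$ of positive integers is $\liminf_{x\to\infty}\frac{1}{x}\#\{n\in A: n\le x\}$. *)

theory Defs
  imports
    Complex_Main
    "HOL-Library.Extended_Real"
    "HOL-Computational_Algebra.Primes"
    "HOL-Number_Theory.Fib"
begin

(* The variable x ranges over the reals. The guard n > 0 makes the notion depend only on the
   positive elements of A. Values are extended reals because Liminf needs a complete lattice. *)
definition lower_density :: "nat set \<Rightarrow> ereal" where
  "lower_density A =
     Liminf at_top (\<lambda>x::real. ereal (real (card {n \<in> A. 0 < n \<and> real n \<le> x}) / x))"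

end

theory Submission
  imports Defs "HOL-Analysis.Analysis" "HOL-Number_Theory.Cong" "HOL-Real_Asymp.Real_Asymp"
begin

text \<open>
  This is Romanoff's method. With \<open>p \<le> 2 ^ L\<close>, \<open>2 ^ k \<le> L\<close> and \<open>q \<le> L\<close> there are about \<open>2 ^ L\<close> triples,
  so by the Cauchy--Schwarz inequality it suffices that only \<open>O(2 ^ L)\<close> pairs of triples have the same
  sum. For fixed \<open>(k, q)\<close> and \<open>(k', q')\<close> Selberg's sieve bounds the number of primes \<open>p, p'\<close> with
  difference \<open>h \<noteq> 0\<close> by \<open>2 ^ L / L\<^sup>2\<close> times a product over the primes dividing \<open>h\<close>, and it remains to
  see that this product is bounded on average over
  \<open>h = fib (2 ^ k) + fib q - fib (2 ^ k') - fib q'\<close>. A prime \<open>\<ell>\<close> divides \<open>h\<close> only if \<open>q\<close> lies in one of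
  four residue classes modulo the Fibonacci period of \<open>\<ell>\<close>. If the period is at least \<open>\<ell> powr (1/4)\<close>,
  the sieve bound for primes in residue classes saves a power of \<open>\<ell>\<close>; the remaining primes are so sparse
  that the trivial bound is enough.
\<close>

section \<open>Selberg's sieve\<close>

text \<open>The ranges make the logarithms cancel: about 2^L / L primes \<open>p\<close>, log L
  exponents \<open>k\<close> and L / log L primes \<open>q\<close>. Since \<open>q\<close> is prime,
  a bound for the \<open>q\<close> in a residue class must keep the factor 1 / log L; counting all
  integers of the class would lose it, so a sieve is needed there too.

  The exponents come from one balance. Expanding the product over the primes dividing h along its
  largest prime \<ell> gives \<ell> the weight 1 / \<ell> times an Euler product over smaller
  primes. The latter is at most a constant times \<ell>^(1/16), which leaves \<ell>^(-15/16). A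
  period of at least \<ell>^(1/4) saves the square root of the period, hence \<ell>^(-1/8), and
  15/16 + 1/8 = 17/16 exceeds 1, so the sum over \<ell> converges. A prime of period t divides fib t
  < 2^t, so there are at most t of them; if they exceed t^4, their weights add up to at most t *
  t^(-15/4), which is summable as well. With this much room, a bound C + \<epsilon> log y for the
  sum of 1 / \<ell> over \<ell> up to y can replace Mertens' theorem.\<close>

lemma alternating_sum_interval:
  assumes "finite E" "F \<subseteq> E"
  shows "(\<Sum>D | F \<subseteq> D \<and> D \<subseteq> E. (- 1) ^ card D) = (if E = F then (- 1) ^ card F else (0::real))"
proof -
  \<comment> \<open>In the expanded product only the sets \<open>D\<close> containing
    \<open>F\<close> survive, each with its sign; unexpanded, a factor with \<open>p\<close> outside
    \<open>F\<close> is zero.\<close>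
  have "(\<Prod>p\<in>E. - 1 + (if p \<in> F then 0 else 1::real))
      = (\<Sum>D\<in>Pow E. (\<Prod>p\<in>D. - 1) * (\<Prod>p\<in>E - D. if p \<in> F then 0 else 1))"
    by (rule prod_add [OF assms(1)])
  also have "\<dots> = (\<Sum>D\<in>Pow E. if F \<subseteq> D then (- 1) ^ card D else 0)"
  proof (rule sum.cong [OF refl])
    fix D assume D: "D \<in> Pow E"
    show "(\<Prod>p\<in>D. - 1) * (\<Prod>p\<in>E - D. if p \<in> F then 0 else 1::real) = (if F \<subseteq> D then (- 1) ^ card D else 0)"
    proof (cases "F \<subseteq> D")
      case True
      then have "(\<Prod>p\<in>E - D. if p \<in> F then 0 else 1::real) = 1"
        by (intro prod.neutral) auto
      with True show ?thesis by simp
    next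
      case False
      then obtain p where "p \<in> F" "p \<notin> D" by blast
      then have "(\<Prod>p\<in>E - D. if p \<in> F then 0 else 1::real) = 0"
        using assms by (intro prod_zero) auto
      with False show ?thesis by simp
    qed
  qed
  also have "\<dots> = (\<Sum>D | F \<subseteq> D \<and> D \<subseteq> E. (- 1) ^ card D)"
    using assms(1) by (intro sum.mono_neutral_cong_right) auto
  finally have *: "(\<Sum>D | F \<subseteq> D \<and> D \<subseteq> E. (- 1) ^ card D) = (\<Prod>p\<in>E. - 1 + (if p \<in> F then 0 else 1::real))"
    by simp
  show ?thesis
  proof (cases "E = F")
    case True
    have "(\<Prod>p\<in>E. - 1 + (if p \<in> F then 0 else 1::real)) = (\<Prod>p\<in>E. - 1)"
      by (rule prod.cong) (use True in auto)
    with * True show ?thesis by simp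
  next
    case False
    then obtain p where "p \<in> E" "p \<notin> F" using assms by blast
    then have "(\<Prod>p\<in>E. - 1 + (if p \<in> F then 0 else 1::real)) = 0"
      using assms by (intro prod_zero) auto
    with * False show ?thesis by simp
  qed
qed

text \<open>
  A set \<open>D\<close> of primes stands for the squarefree number \<open>\<Prod>D\<close>, so that unions are least common
  multiples and \<open>(- 1) ^ card D\<close> is the Moebius function. The weights \<open>lam\<close> are the minimisers of the
  quadratic form in the main term. The trivial bound \<open>\<bar>lam D\<bar> \<le> 1 / prod g D\<close> costs only a power of the
  sieving level, which is harmless here.
\<close>

lemma selberg_sieve:
  fixes g :: "'p \<Rightarrow> real" and B :: "'p \<Rightarrow> 'a set" and X :: real
  assumes A: "finite A" and P: "finite P"
    and sub: "\<D> \<subseteq> Pow P" and emp: "{} \<in> \<D>"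
    and down: "\<And>D E. D \<in> \<D> \<Longrightarrow> E \<subseteq> D \<Longrightarrow> E \<in> \<D>"
    and g: "\<And>p. p \<in> P \<Longrightarrow> 0 < g p \<and> g p < 1"
    and err: "\<And>D. D \<subseteq> P \<Longrightarrow> \<bar>real (card {n\<in>A. \<forall>p\<in>D. n \<in> B p}) - X * prod g D\<bar> \<le> R D"
  defines "G \<equiv> \<Sum>D\<in>\<D>. \<Prod>p\<in>D. g p / (1 - g p)"
  shows "real (card {n\<in>A. \<forall>p\<in>P. n \<notin> B p})
           \<le> X / G + (\<Sum>D\<in>\<D>. \<Sum>E\<in>\<D>. R (D \<union> E) / (prod g D * prod g E))"
proof -
  define H where "H D = (\<Prod>p\<in>D. g p / (1 - g p))" for D
  define lam where "lam D = (- 1) ^ card D / prod g D / G * (\<Sum>F | F \<in> \<D> \<and> D \<subseteq> F. H F)" for D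
  have fin\<D>: "finite \<D>" using finite_subset [OF sub] P by simp
  have finD: "finite D" if "D \<in> \<D>" for D using that sub P finite_subset by blast
  have DP: "D \<subseteq> P" if "D \<in> \<D>" for D using that sub by blast
  have Hpos: "H D > 0" if "D \<subseteq> P" for D
    unfolding H_def using that g by (intro prod_pos) (auto simp: subset_iff)
  have gpos: "prod g D > 0" if "D \<subseteq> P" for D
    using that g by (intro prod_pos) (auto simp: subset_iff)
  have G_H: "G = sum H \<D>" by (simp add: G_def H_def)
  have "H {} \<le> G" unfolding G_H
    by (rule member_le_sum [OF emp]) (use Hpos DP fin\<D> in \<open>auto intro: less_imp_le\<close>)
  then have Gpos: "G > 0" by (simp add: H_def)
  have lam_bound: "\<bar>lam D\<bar> \<le> 1 / prod g D" if "D \<in> \<D>" for D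
  proof -
    have "(\<Sum>F | F \<in> \<D> \<and> D \<subseteq> F. H F) \<le> G" unfolding G_H
      by (rule sum_mono2 [OF fin\<D>]) (use Hpos DP in \<open>auto intro: less_imp_le\<close>)
    moreover have "(\<Sum>F | F \<in> \<D> \<and> D \<subseteq> F. H F) \<ge> 0"
      by (rule sum_nonneg) (use Hpos DP in \<open>auto intro: less_imp_le\<close>)
    ultimately show ?thesis
      using gpos [OF DP [OF that]] Gpos
      by (simp add: lam_def abs_mult power_abs field_simps)
  qed
  have lam1: "lam {} = 1"
    using Gpos by (simp add: lam_def G_H)
  \<comment> \<open>\<open>T n\<close> is empty exactly for the sifted elements among
    \<open>A\<close>, and there \<open>w n = lam {} = 1\<close>. As squares are nonnegative,
    \<open>(w n)^2\<close> majorises the indicator of the sifted set.\<close>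
  define T where "T n = {p\<in>P. n \<in> B p}" for n
  define w where "w n = (\<Sum>D\<in>\<D>. if D \<subseteq> T n then lam D else 0)" for n
  have "real (card {n\<in>A. \<forall>p\<in>P. n \<notin> B p}) = (\<Sum>n\<in>{n\<in>A. \<forall>p\<in>P. n \<notin> B p}. (w n)\<^sup>2)"
  proof -
    have "w n = 1" if "\<forall>p\<in>P. n \<notin> B p" for n
    proof -
      have "T n = {}" using that by (auto simp: T_def)
      then have "w n = (\<Sum>D\<in>\<D>. if D = {} then lam D else 0)" by (simp add: w_def)
      also have "\<dots> = lam {}" using emp fin\<D> by (simp add: sum.delta)
      finally show ?thesis using lam1 by simp
    qed
    then show ?thesis by simp
  qed
  also have "\<dots> \<le> (\<Sum>n\<in>A. (w n)\<^sup>2)"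
    by (rule sum_mono2 [OF A]) auto
  also have "\<dots> = (\<Sum>n\<in>A. \<Sum>D\<in>\<D>. \<Sum>E\<in>\<D>. if D \<union> E \<subseteq> T n then lam D * lam E else 0)"
    unfolding w_def power2_eq_square sum_product
    by (intro sum.cong refl) auto
  also have "\<dots> = (\<Sum>D\<in>\<D>. \<Sum>E\<in>\<D>. \<Sum>n\<in>A. if D \<union> E \<subseteq> T n then lam D * lam E else 0)"
    by (subst sum.swap, rule sum.cong [OF refl], rule sum.swap)
  also have "\<dots> = (\<Sum>D\<in>\<D>. \<Sum>E\<in>\<D>. lam D * lam E * real (card {n\<in>A. \<forall>p\<in>D\<union>E. n \<in> B p}))"
  proof (intro sum.cong refl)
    fix D E assume "D \<in> \<D>" "E \<in> \<D>"
    then have *: "D \<union> E \<subseteq> T n \<longleftrightarrow> (\<forall>p\<in>D\<union>E. n \<in> B p)" for n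
      using DP by (auto simp: T_def)
    show "(\<Sum>n\<in>A. if D \<union> E \<subseteq> T n then lam D * lam E else 0) = lam D * lam E * real (card {n\<in>A. \<forall>p\<in>D\<union>E. n \<in> B p})"
      unfolding * sum.inter_filter [OF A, symmetric] by simp
  qed
  also have "\<dots> \<le> (\<Sum>D\<in>\<D>. \<Sum>E\<in>\<D>. X * (lam D * lam E * prod g (D \<union> E)) + R (D \<union> E) / (prod g D * prod g E))"
  proof (intro sum_mono)
    fix D E assume DE: "D \<in> \<D>" "E \<in> \<D>"
    define c where "c = real (card {n\<in>A. \<forall>p\<in>D\<union>E. n \<in> B p})"
    have e: "\<bar>c - X * prod g (D \<union> E)\<bar> \<le> R (D \<union> E)"
      unfolding c_def by (rule err) (use DE DP in auto)
    have "lam D * lam E * c - X * (lam D * lam E * prod g (D \<union> E)) = lam D * lam E * (c - X * prod g (D \<union> E))"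
      by (simp add: algebra_simps)
    also have "\<dots> \<le> \<bar>lam D\<bar> * \<bar>lam E\<bar> * \<bar>c - X * prod g (D \<union> E)\<bar>"
      by (metis abs_ge_self abs_mult)
    also have "\<dots> \<le> (1 / prod g D) * (1 / prod g E) * R (D \<union> E)"
      using lam_bound DE e gpos DP by (intro mult_mono) (auto intro: less_imp_le)
    finally show "lam D * lam E * c \<le> X * (lam D * lam E * prod g (D \<union> E)) + R (D \<union> E) / (prod g D * prod g E)"
      by simp
  qed
  also have "\<dots> = X * (\<Sum>D\<in>\<D>. \<Sum>E\<in>\<D>. lam D * lam E * prod g (D \<union> E)) + (\<Sum>D\<in>\<D>. \<Sum>E\<in>\<D>. R (D \<union> E) / (prod g D * prod g E))"
    by (simp add: sum.distrib sum_distrib_left)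
  also have "(\<Sum>D\<in>\<D>. \<Sum>E\<in>\<D>. lam D * lam E * prod g (D \<union> E)) = 1 / G"
  proof -
    \<comment> \<open>Since \<open>1 / g p = (1 - g p) / g p + 1\<close>, the factor
      \<open>1 / prod g (D \<inter> E)\<close> is a sum of \<open>1 / H F\<close> over the common
      subsets \<open>F\<close>. This separates \<open>D\<close> from \<open>E\<close>.\<close>
    have gg: "prod g (D \<union> E) = prod g D * prod g E * (\<Sum>F\<in>\<D>. if F \<subseteq> D \<and> F \<subseteq> E then 1 / H F else 0)"
      if DE: "D \<in> \<D>" "E \<in> \<D>" for D E
    proof -
      have fI: "finite (D \<inter> E)" using finD DE by auto
      have "1 / prod g (D \<inter> E) = (\<Prod>p\<in>D\<inter>E. (1 - g p) / g p + 1)"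
      proof -
        have "(1 - g p) / g p + 1 = 1 / g p" if "p \<in> P" for p
          using g [OF that] by (simp add: field_simps)
        then have "(\<Prod>p\<in>D\<inter>E. (1 - g p) / g p + 1) = (\<Prod>p\<in>D\<inter>E. 1 / g p)"
          using DP [OF DE(1)] by (intro prod.cong) auto
        then show ?thesis by (simp add: prod_dividef)
      qed
      also have "\<dots> = (\<Sum>F\<in>Pow (D \<inter> E). (\<Prod>p\<in>F. (1 - g p) / g p))"
        by (subst prod_add [OF fI]) simp
      also have "\<dots> = (\<Sum>F\<in>Pow (D \<inter> E). 1 / H F)"
        by (simp add: H_def prod_dividef)
      also have "\<dots> = (\<Sum>F\<in>\<D>. if F \<subseteq> D \<and> F \<subseteq> E then 1 / H F else 0)"
        using fin\<D> down DE by (intro sum.mono_neutral_cong_left) auto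
      finally have 1: "1 / prod g (D \<inter> E) = (\<Sum>F\<in>\<D>. if F \<subseteq> D \<and> F \<subseteq> E then 1 / H F else 0)" .
      have "prod g (D \<union> E) * prod g (D \<inter> E) = prod g D * prod g E"
        using finD DE by (simp add: prod.union_inter)
      moreover have "prod g (D \<inter> E) > 0" using gpos DP DE by blast
      ultimately show ?thesis unfolding 1 [symmetric] by (simp add: field_simps)
    qed
    \<comment> \<open>The quadratic form is diagonal in these variables, namely the sum of
      \<open>(y F)^2 / H F\<close>. On the hyperplane \<open>lam {} = 1\<close> its minimum is at
      \<open>y F = (- 1) ^ card F * H F / G\<close>, and \<open>lam\<close> is the Moebius inverse
      of this point.\<close>
    define y where "y F = (\<Sum>D\<in>\<D>. if F \<subseteq> D then prod g D * lam D else 0)" for F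
    have y: "y F = (- 1) ^ card F * H F / G" if F: "F \<in> \<D>" for F
    proof -
      have "y F = (\<Sum>D\<in>\<D>. \<Sum>E\<in>\<D>. if F \<subseteq> D \<and> D \<subseteq> E then (- 1) ^ card D / G * H E else 0)"
        unfolding y_def
      proof (rule sum.cong [OF refl])
        fix D assume D: "D \<in> \<D>"
        have "prod g D \<noteq> 0" using gpos [OF DP [OF D]] by simp
        then have "prod g D * lam D = (- 1) ^ card D / G * (\<Sum>E | E \<in> \<D> \<and> D \<subseteq> E. H E)"
          by (simp add: lam_def)
        also have "(\<Sum>E | E \<in> \<D> \<and> D \<subseteq> E. H E) = (\<Sum>E\<in>\<D>. if D \<subseteq> E then H E else 0)"
          by (rule sum.inter_filter [OF fin\<D>])
        finally show "(if F \<subseteq> D then prod g D * lam D else 0) = (\<Sum>E\<in>\<D>. if F \<subseteq> D \<and> D \<subseteq> E then (- 1) ^ card D / G * H E else 0)"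
          by (simp add: sum_distrib_left if_distrib cong: if_cong)
      qed
      also have "\<dots> = (\<Sum>E\<in>\<D>. \<Sum>D\<in>\<D>. if F \<subseteq> D \<and> D \<subseteq> E then (- 1) ^ card D / G * H E else 0)"
        by (rule sum.swap)
      also have "\<dots> = (\<Sum>E\<in>\<D>. if E = F then (- 1) ^ card F / G * H F else 0)"
      proof (rule sum.cong [OF refl])
        fix E assume E: "E \<in> \<D>"
        have "(\<Sum>D\<in>\<D>. if F \<subseteq> D \<and> D \<subseteq> E then (- 1) ^ card D / G * H E else 0)
            = (\<Sum>D | F \<subseteq> D \<and> D \<subseteq> E. (- 1) ^ card D / G * H E)"
          using fin\<D> down E by (intro sum.mono_neutral_cong_right) auto
        also have "\<dots> = (\<Sum>D | F \<subseteq> D \<and> D \<subseteq> E. (- 1) ^ card D) * (H E / G)"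
          unfolding sum_distrib_right by (intro sum.cong refl) simp
        also have "\<dots> = (if E = F then (- 1) ^ card F / G * H F else 0)"
        proof (cases "F \<subseteq> E")
          case True
          then show ?thesis by (subst alternating_sum_interval) (use finD E in auto)
        next
          case False
          then have e: "{D. F \<subseteq> D \<and> D \<subseteq> E} = {}" by blast
          show ?thesis unfolding e using False by (cases "E = F") simp_all
        qed
        finally show "(\<Sum>D\<in>\<D>. if F \<subseteq> D \<and> D \<subseteq> E then (- 1) ^ card D / G * H E else 0) = (if E = F then (- 1) ^ card F / G * H F else 0)" .
      qed
      also have "\<dots> = (- 1) ^ card F * H F / G" using F fin\<D> by simp
      finally show ?thesis .
    qed
    have "(\<Sum>D\<in>\<D>. \<Sum>E\<in>\<D>. lam D * lam E * prod g (D \<union> E))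
        = (\<Sum>D\<in>\<D>. \<Sum>E\<in>\<D>. \<Sum>F\<in>\<D>. 1 / H F * ((if F \<subseteq> D then prod g D * lam D else 0) * (if F \<subseteq> E then prod g E * lam E else 0)))"
      by (intro sum.cong refl) (auto simp: gg sum_distrib_left intro!: sum.cong)
    also have "\<dots> = (\<Sum>D\<in>\<D>. \<Sum>F\<in>\<D>. \<Sum>E\<in>\<D>. 1 / H F * ((if F \<subseteq> D then prod g D * lam D else 0) * (if F \<subseteq> E then prod g E * lam E else 0)))"
      by (rule sum.cong [OF refl], rule sum.swap)
    also have "\<dots> = (\<Sum>F\<in>\<D>. \<Sum>D\<in>\<D>. \<Sum>E\<in>\<D>. 1 / H F * ((if F \<subseteq> D then prod g D * lam D else 0) * (if F \<subseteq> E then prod g E * lam E else 0)))"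
      by (rule sum.swap)
    also have "\<dots> = (\<Sum>F\<in>\<D>. 1 / H F * (y F * y F))"
      unfolding y_def sum_product by (simp add: sum_distrib_left)
    also have "\<dots> = (\<Sum>F\<in>\<D>. H F / G\<^sup>2)"
    proof (rule sum.cong [OF refl])
      fix F assume F: "F \<in> \<D>"
      have "H F > 0" using Hpos DP F by blast
      then show "1 / H F * (y F * y F) = H F / G\<^sup>2"
        using Gpos by (simp add: y [OF F] field_simps power2_eq_square flip: power_add)
    qed
    also have "\<dots> = 1 / G"
      using Gpos by (simp add: G_H [symmetric] power2_eq_square flip: sum_divide_distrib)
    finally show ?thesis .
  qed
  finally show ?thesis by simp
qed

section \<open>Sieving residue classes modulo primes\<close>

lemma card_residue_class:
  fixes d r M :: nat
  assumes "r < d"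
  shows "\<bar>real (card {n\<in>{..<M}. n mod d = r}) - real M / real d\<bar> \<le> 1"
proof -
  \<comment> \<open>The ceiling of (M - r) / d, or 0 if \<open>M \<le> r\<close>, written so that no
    subtraction is truncated.\<close>
  define K where "K = (M + (d - 1 - r)) div d"
  have less_iff: "k < K \<longleftrightarrow> r + k * d < M" for k
  proof -
    have "k < K \<longleftrightarrow> Suc k \<le> K" by auto
    also have "\<dots> \<longleftrightarrow> Suc k * d \<le> M + (d - 1 - r)"
      unfolding K_def using assms by (intro less_eq_div_iff_mult_less_eq) auto
    also have "\<dots> \<longleftrightarrow> r + k * d < M" using assms by auto
    finally show ?thesis .
  qed
  have "{n\<in>{..<M}. n mod d = r} = (\<lambda>k. r + k * d) ` {..<K}"
  proof (intro equalityI subsetI)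
    fix n assume n: "n \<in> {n\<in>{..<M}. n mod d = r}"
    then have "n = r + (n div d) * d" by (metis (mono_tags) add.commute div_mult_mod_eq mem_Collect_eq)
    then show "n \<in> (\<lambda>k. r + k * d) ` {..<K}" using n less_iff by (metis (no_types, lifting) image_iff lessThan_iff mem_Collect_eq)
  next
    fix n assume "n \<in> (\<lambda>k. r + k * d) ` {..<K}"
    then obtain k where "k < K" "n = r + k * d" by blast
    then show "n \<in> {n\<in>{..<M}. n mod d = r}" using less_iff [of k] assms by simp
  qed
  moreover have "inj_on (\<lambda>k. r + k * d) {..<K}" using assms by (auto simp: inj_on_def)
  ultimately have card: "card {n\<in>{..<M}. n mod d = r} = K" by (simp add: card_image)
  have "K * d \<le> M + (d - 1 - r)" "M + (d - 1 - r) < d + K * d"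
    unfolding K_def using assms dividend_less_div_times [of d "M + (d - 1 - r)"] by simp_all
  then have "K * d \<le> M + d" "M \<le> K * d + d" using assms by linarith+
  then have "real (K * d) \<le> real (M + d)" "real M \<le> real (K * d + d)" by (simp_all only: of_nat_le_iff)
  then have "real K * real d \<le> real M + real d" "real M \<le> real K * real d + real d" by simp_all
  then have "real K \<le> real M / real d + 1" "real M / real d \<le> real K + 1"
    using assms by (simp_all add: field_simps)
  then show ?thesis unfolding card by linarith
qed

lemma residues_mod_prime_set:
  fixes D :: "nat set"
  assumes D: "finite D" "\<And>p. p \<in> D \<Longrightarrow> prime p" and u: "\<And>p. p \<in> D \<Longrightarrow> u p < p"
  obtains x where "x < \<Prod>D" "\<And>n. (\<forall>p\<in>D. n mod p = u p) \<longleftrightarrow> n mod \<Prod>D = x"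
proof -
  have "\<exists>!x. x < (\<Prod>p\<in>D. p) \<and> (\<forall>p\<in>D. [x = u p] (mod p))"
    by (rule chinese_remainder_unique_nat) (use D in \<open>auto simp: primes_coprime dest: prime_gt_0_nat\<close>)
  then obtain x where x: "x < \<Prod>D" "\<forall>p\<in>D. [x = u p] (mod p)"
    and uniq: "\<And>y. y < \<Prod>D \<Longrightarrow> \<forall>p\<in>D. [y = u p] (mod p) \<Longrightarrow> y = x"
    by (auto simp: Ex1_def)
  have pos: "\<Prod>D > 0" using x(1) by auto
  have "(\<forall>p\<in>D. n mod p = u p) \<longleftrightarrow> n mod \<Prod>D = x" for n
  proof -
    have "n mod \<Prod>D mod p = n mod p" if "p \<in> D" for p
      using that D(1) by (intro mod_mod_cancel dvd_prodI) auto
    then have "(\<forall>p\<in>D. n mod p = u p) \<longleftrightarrow> (\<forall>p\<in>D. [n mod \<Prod>D = u p] (mod p))"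
      using u by (auto simp: cong_def)
    also have "\<dots> \<longleftrightarrow> n mod \<Prod>D = x"
      using x uniq [of "n mod \<Prod>D"] pos by auto
    finally show ?thesis .
  qed
  with x(1) that show thesis by blast
qed

text \<open>By the Chinese remainder theorem the conditions select \<open>\<kappa> ^ card D\<close>
  residue classes modulo \<open>\<Prod>D\<close>, and counting each class costs an error of at most
  1.\<close>

lemma card_residue_sets:
  fixes D :: "nat set"
  assumes D: "finite D" "\<And>p. p \<in> D \<Longrightarrow> prime p"
    and \<Omega>: "\<And>p. p \<in> D \<Longrightarrow> \<Omega> p \<subseteq> {..<p} \<and> card (\<Omega> p) = \<kappa>"
  shows "\<bar>real (card {n\<in>{..<M}. \<forall>p\<in>D. n mod p \<in> \<Omega> p}) - real M * (\<Prod>p\<in>D. real \<kappa> / real p)\<bar> \<le> real \<kappa> ^ card D"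
proof -
  define S where "S u = {n\<in>{..<M}. \<forall>p\<in>D. n mod p = u p}" for u
  have fin\<Omega>: "finite (\<Omega> p)" if "p \<in> D" for p
    using \<Omega> [OF that] finite_subset by blast
  then have fin: "finite (PiE D \<Omega>)" using D(1) by (intro finite_PiE)
  have U: "{n\<in>{..<M}. \<forall>p\<in>D. n mod p \<in> \<Omega> p} = (\<Union>u\<in>PiE D \<Omega>. S u)"
  proof (intro equalityI subsetI)
    fix n assume n: "n \<in> {n\<in>{..<M}. \<forall>p\<in>D. n mod p \<in> \<Omega> p}"
    then have "(\<lambda>p\<in>D. n mod p) \<in> PiE D \<Omega>" "n \<in> S (\<lambda>p\<in>D. n mod p)" by (auto simp: S_def)
    then show "n \<in> (\<Union>u\<in>PiE D \<Omega>. S u)" by blast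
  qed (auto simp: S_def PiE_def Pi_def)
  have disj: "S u \<inter> S v = {}" if "u \<in> PiE D \<Omega>" "v \<in> PiE D \<Omega>" "u \<noteq> v" for u v
  proof (rule ccontr)
    assume "S u \<inter> S v \<noteq> {}"
    then obtain n where "\<forall>p\<in>D. n mod p = u p" "\<forall>p\<in>D. n mod p = v p" by (auto simp: S_def)
    then have "u = v" using that(1,2) by (intro PiE_ext) auto
    with that show False by simp
  qed
  have cardS: "\<bar>real (card (S u)) - real M / real (\<Prod>D)\<bar> \<le> 1" if u: "u \<in> PiE D \<Omega>" for u
  proof -
    have "u p < p" if "p \<in> D" for p using PiE_mem [OF u that] \<Omega> [OF that] by blast
    then obtain x where x: "x < \<Prod>D" "\<And>n. (\<forall>p\<in>D. n mod p = u p) \<longleftrightarrow> n mod \<Prod>D = x"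
      using residues_mod_prime_set [OF D, of u] by metis
    show ?thesis unfolding S_def x(2) by (rule card_residue_class [OF x(1)])
  qed
  have cP: "card (PiE D \<Omega>) = \<kappa> ^ card D"
    using D \<Omega> by (simp add: card_PiE)
  have "real (card {n\<in>{..<M}. \<forall>p\<in>D. n mod p \<in> \<Omega> p}) = (\<Sum>u\<in>PiE D \<Omega>. real (card (S u)))"
    unfolding U using fin disj by (subst card_UN_disjoint) (auto simp: S_def)
  moreover have "real M * (\<Prod>p\<in>D. real \<kappa> / real p) = (\<Sum>u\<in>PiE D \<Omega>. real M / real (\<Prod>D))"
    by (simp add: cP prod_dividef)
  ultimately have "\<bar>real (card {n\<in>{..<M}. \<forall>p\<in>D. n mod p \<in> \<Omega> p}) - real M * (\<Prod>p\<in>D. real \<kappa> / real p)\<bar>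
     = \<bar>\<Sum>u\<in>PiE D \<Omega>. real (card (S u)) - real M / real (\<Prod>D)\<bar>"
    by (simp add: sum_subtractf)
  also have "\<dots> \<le> (\<Sum>u\<in>PiE D \<Omega>. 1)"
    by (rule order_trans [OF sum_abs sum_mono]) (use cardS in auto)
  finally show ?thesis by (simp add: cP)
qed

lemma prod_primes_pos:
  fixes D :: "nat set"
  assumes "\<And>p. p \<in> D \<Longrightarrow> prime p"
  shows "\<Prod>D > 0"
  by (rule prod_pos) (simp add: assms prime_gt_0_nat)

lemma prime_factors_prod_primes:
  fixes D :: "nat set"
  assumes "finite D" "\<And>p. p \<in> D \<Longrightarrow> prime p"
  shows "prime_factors (\<Prod>D) = D"
  using assms
proof (induction D rule: finite_induct)
  case (insert p D)
  have "\<Prod>D \<noteq> 0" using insert.hyps(1) insert.prems [of 0] by (auto simp: prod_zero_iff)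
  moreover have "p \<noteq> 0" using insert.prems[of p] by auto
  ultimately show ?case
    using insert by (simp add: prime_factors_product prime_prime_factors)
qed simp

text \<open>The denominator \<open>G\<close> of Selberg's bound when \<open>\<kappa>\<close> classes
  are removed modulo each prime: for g = \<kappa> / p one has g / (1 - g) = \<kappa> / (p -
  \<kappa>).\<close>

definition sieve_sum :: "nat \<Rightarrow> nat set \<Rightarrow> nat \<Rightarrow> real" where
  "sieve_sum \<kappa> P z = (\<Sum>D | D \<subseteq> P \<and> \<Prod>D \<le> z. \<Prod>p\<in>D. real \<kappa> / (real p - real \<kappa>))"

lemma card_prime_sets_le:
  assumes P: "finite P" "\<And>p. p \<in> P \<Longrightarrow> prime p"
  shows "card {D. D \<subseteq> P \<and> \<Prod>D \<le> z} \<le> (z::nat)"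
proof -
  have "inj_on (\<lambda>D. \<Prod>D) {D. D \<subseteq> P \<and> \<Prod>D \<le> z}"
  proof (rule inj_onI)
    fix D E assume "D \<in> {D. D \<subseteq> P \<and> \<Prod>D \<le> z}" "E \<in> {D. D \<subseteq> P \<and> \<Prod>D \<le> z}" and eq: "\<Prod>D = \<Prod>E"
    then have sub: "D \<subseteq> P" "E \<subseteq> P" by auto
    have "prime_factors (\<Prod>F) = F" if "F \<subseteq> P" for F
      using finite_subset [OF that P(1)] that P(2) by (intro prime_factors_prod_primes) auto
    then have "prime_factors (\<Prod>D) = D" "prime_factors (\<Prod>E) = E"
      using sub by blast+
    with eq show "D = E" by metis
  qed
  moreover have "(\<lambda>D. \<Prod>D) ` {D. D \<subseteq> P \<and> \<Prod>D \<le> z} \<subseteq> {1..z}"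
  proof
    fix x assume "x \<in> (\<lambda>D. \<Prod>D) ` {D. D \<subseteq> P \<and> \<Prod>D \<le> z}"
    then obtain D where D: "D \<subseteq> P" "\<Prod>D \<le> z" "x = \<Prod>D" by blast
    have "\<Prod>D > 0" using D(1) P(2) by (intro prod_primes_pos) blast
    with D show "x \<in> {1..z}" by auto
  qed
  ultimately have "card {D. D \<subseteq> P \<and> \<Prod>D \<le> z} \<le> card {1..z}" by (intro card_inj_on_le) auto
  then show ?thesis by simp
qed

text \<open>The error of a pair \<open>D\<close>, \<open>E\<close> is at most \<open>\<kappa> ^
  (card D + card E) / (prod g D * prod g E) = \<Prod>D * \<Prod>E\<close>, hence at most z^2. By
  unique factorisation there are at most z^2 pairs, whence z^4.\<close>

theorem sieve_residue_classes:
  fixes P :: "nat set" and z M \<kappa> :: nat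
  assumes P: "finite P" "\<And>p. p \<in> P \<Longrightarrow> prime p" and \<kappa>: "\<kappa> \<ge> 1" "\<And>p. p \<in> P \<Longrightarrow> \<kappa> < p"
    and \<Omega>: "\<And>p. p \<in> P \<Longrightarrow> \<Omega> p \<subseteq> {..<p} \<and> card (\<Omega> p) = \<kappa>" and z: "z \<ge> 1"
  shows "real (card {n\<in>{..<M}. \<forall>p\<in>P. n mod p \<notin> \<Omega> p}) \<le> real M / sieve_sum \<kappa> P z + real z ^ 4"
proof -
  define \<D> where "\<D> = {D. D \<subseteq> P \<and> \<Prod>D \<le> z}"
  define g where "g p = real \<kappa> / real p" for p
  have fin: "finite D" if "D \<subseteq> P" for D using that P finite_subset by blast
  have fin\<D>: "finite \<D>" unfolding \<D>_def using P by simp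
  have down: "E \<in> \<D>" if "D \<in> \<D>" "E \<subseteq> D" for D E
  proof -
    have D: "D \<subseteq> P" "\<Prod>D \<le> z" using that by (auto simp: \<D>_def)
    have pos: "\<Prod>D > 0" using D(1) P(2) by (intro prod_primes_pos) blast
    have "\<Prod>E dvd \<Prod>D" by (rule prod_dvd_prod_subset) (use fin D that in auto)
    then have "\<Prod>E \<le> \<Prod>D" using pos by (rule dvd_imp_le)
    with D that show ?thesis by (auto simp: \<D>_def)
  qed
  have G: "(\<Sum>D\<in>\<D>. \<Prod>p\<in>D. g p / (1 - g p)) = sieve_sum \<kappa> P z"
    unfolding sieve_sum_def \<D>_def [symmetric]
  proof (intro sum.cong prod.cong refl)
    fix D p assume "D \<in> \<D>" "p \<in> D"
    then have "\<kappa> < p" using \<kappa>(2) by (auto simp: \<D>_def)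
    then show "g p / (1 - g p) = real \<kappa> / (real p - real \<kappa>)" by (simp add: g_def field_simps)
  qed
  have "real (card {n\<in>{..<M}. \<forall>p\<in>P. n \<notin> {n. n mod p \<in> \<Omega> p}})
      \<le> real M / (\<Sum>D\<in>\<D>. \<Prod>p\<in>D. g p / (1 - g p))
        + (\<Sum>D\<in>\<D>. \<Sum>E\<in>\<D>. real \<kappa> ^ card (D \<union> E) / (prod g D * prod g E))"
  proof (rule selberg_sieve)
    show "finite {..<M}" "finite P" using P by auto
    show "\<D> \<subseteq> Pow P" "{} \<in> \<D>" using z by (auto simp: \<D>_def)
    show "0 < g p \<and> g p < 1" if "p \<in> P" for p
      using \<kappa>(1) \<kappa>(2) [OF that] by (simp add: g_def)
    show "\<bar>real (card {n \<in> {..<M}. \<forall>p\<in>D. n \<in> {n. n mod p \<in> \<Omega> p}}) - real M * prod g D\<bar> \<le> real \<kappa> ^ card D"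
      if "D \<subseteq> P" for D
      using card_residue_sets [of D \<Omega> \<kappa> M] fin P \<Omega> that by (auto simp: g_def subset_iff)
  qed (use down in blast)
  also have "(\<Sum>D\<in>\<D>. \<Sum>E\<in>\<D>. real \<kappa> ^ card (D \<union> E) / (prod g D * prod g E)) \<le> (\<Sum>D\<in>\<D>. \<Sum>E\<in>\<D>. real z * real z)"
  proof (intro sum_mono)
    fix D E assume DE: "D \<in> \<D>" "E \<in> \<D>"
    have prod_g: "real \<kappa> ^ card F / prod g F = real (\<Prod>F)" if "F \<in> \<D>" for F
    proof -
      have "p \<noteq> 0" if "p \<in> F" for p using that \<open>F \<in> \<D>\<close> P(2)[of p] by (auto simp: \<D>_def subset_iff)
      then have "\<Prod>F \<noteq> 0" using fin that by (auto simp: \<D>_def)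
      then show ?thesis using \<kappa>(1) by (simp add: g_def prod_dividef field_simps)
    qed
    have "g p > 0" if "p \<in> P" for p using \<kappa>(1) \<kappa>(2) [OF that] by (simp add: g_def)
    then have pos: "prod g F > 0" if "F \<in> \<D>" for F
      using that by (intro prod_pos) (auto simp: \<D>_def)
    have "real \<kappa> ^ card (D \<union> E) \<le> real \<kappa> ^ (card D + card E)"
      using \<kappa>(1) card_Un_le by (intro power_increasing) auto
    then have "real \<kappa> ^ card (D \<union> E) / (prod g D * prod g E) \<le> real \<kappa> ^ (card D + card E) / (prod g D * prod g E)"
      using pos DE by (intro divide_right_mono) (auto intro: less_imp_le)
    also have "\<dots> = real (\<Prod>D) * real (\<Prod>E)"
      unfolding prod_g [OF DE(1), symmetric] prod_g [OF DE(2), symmetric] by (simp add: power_add)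
    also have "\<dots> \<le> real z * real z"
    proof -
      have "\<Prod>D \<le> z" "\<Prod>E \<le> z" using DE by (simp_all add: \<D>_def)
      then have "real (\<Prod>D) \<le> real z" "real (\<Prod>E) \<le> real z" by (simp_all only: of_nat_le_iff)
      then show ?thesis by (intro mult_mono) (simp_all only: of_nat_0_le_iff)
    qed
    finally show "real \<kappa> ^ card (D \<union> E) / (prod g D * prod g E) \<le> real z * real z" .
  qed
  also have "\<dots> = (real (card \<D>))\<^sup>2 * (real z)\<^sup>2" by (simp add: power2_eq_square)
  also have "\<dots> \<le> (real z)\<^sup>2 * (real z)\<^sup>2"
    using card_prime_sets_le [OF P, of z] by (intro mult_right_mono power_mono) (auto simp: \<D>_def)
  finally show ?thesis unfolding G by (simp flip: power_add)
qed

section \<open>Lower bounds for the sieve sums\<close>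

text \<open>For positive \<open>m\<close> this is \<open>m\<close> divided by Euler's totient of
  \<open>m\<close>.\<close>

definition euler_ratio :: "nat \<Rightarrow> real" where
  "euler_ratio m = (\<Prod>p\<in>prime_factors m. real p / (real p - 1))"

lemma real_prime_ge_2: "prime p \<Longrightarrow> real p \<ge> 2" for p :: nat
  using prime_ge_2_nat [of p] by simp

text \<open>A finite form of the Euler product. Writing n = p^a * r with r prime to p splits off,
  for each prime of \<open>D\<close>, a geometric series with sum p / (p - 1).\<close>

lemma sum_inverse_smooth_le:
  fixes D N :: "nat set"
  assumes "finite D" "\<And>p. p \<in> D \<Longrightarrow> prime p" "finite N" "\<And>n. n \<in> N \<Longrightarrow> n > 0 \<and> prime_factors n \<subseteq> D"
  shows "(\<Sum>n\<in>N. 1 / real n) \<le> (\<Prod>p\<in>D. real p / (real p - 1))"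
  using assms
proof (induction D arbitrary: N rule: finite_induct)
  case empty
  have "N \<subseteq> {1}"
  proof
    fix n assume "n \<in> N"
    then have "n > 0" "prime_factors n = {}" using empty.prems(3) [of n] by auto
    then show "n \<in> {1}" using prod_prime_factors [of n] by simp
  qed
  then have "(\<Sum>n\<in>N. 1 / real n) \<le> (\<Sum>n\<in>{1::nat}. 1 / real n)"
    by (intro sum_mono2) auto
  then show ?case by simp
next
  case (insert p D)
  have p: "prime p" using insert.prems(1) by blast
  then have p2: "real p \<ge> 2" by (rule real_prime_ge_2)
  define v where "v n = multiplicity p n" for n
  define r where "r n = n div p ^ v n" for n
  have decomp: "n = p ^ v n * r n" for n
    unfolding v_def r_def using multiplicity_dvd [of p n] by simp
  have r: "r n > 0 \<and> prime_factors (r n) \<subseteq> D" if "n \<in> N" for n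
  proof -
    have n: "n > 0" "prime_factors n \<subseteq> insert p D" using insert.prems(3) [OF that] by auto
    have "r n \<noteq> 0" using decomp [of n] n(1) by (metis mult_0_right less_numeral_extra(3))
    moreover have "r n dvd n" using decomp [of n] by (metis dvd_triv_right)
    ultimately have "prime_factors (r n) \<subseteq> prime_factors n" using n(1) by (intro dvd_prime_factors) auto
    moreover have "\<not> p dvd r n"
      unfolding r_def v_def by (rule multiplicity_decompose) (use n(1) p not_prime_unit in auto)
    then have "p \<notin> prime_factors (r n)" by blast
    ultimately show ?thesis using n(2) \<open>r n \<noteq> 0\<close> by blast
  qed
  have inj: "inj_on (\<lambda>n. (v n, r n)) N"
    by (rule inj_onI) (metis decomp prod.inject)
  have "(\<Sum>n\<in>N. 1 / real n) = (\<Sum>n\<in>N. (\<lambda>(a, m). (1 / real p) ^ a * (1 / real m)) (v n, r n))"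
  proof (rule sum.cong [OF refl])
    fix n
    have "real n = real p ^ v n * real (r n)" using decomp [of n] by (metis of_nat_mult of_nat_power)
    then show "1 / real n = (\<lambda>(a, m). (1 / real p) ^ a * (1 / real m)) (v n, r n)"
      by (simp add: power_one_over)
  qed
  also have "\<dots> = (\<Sum>(a, m)\<in>(\<lambda>n. (v n, r n)) ` N. (1 / real p) ^ a * (1 / real m))"
    by (subst sum.reindex [OF inj]) (simp add: o_def)
  also have "\<dots> \<le> (\<Sum>(a, m)\<in>v ` N \<times> r ` N. (1 / real p) ^ a * (1 / real m))"
    using insert.prems(2) by (intro sum_mono2) auto
  also have "\<dots> = (\<Sum>a\<in>v ` N. (1 / real p) ^ a) * (\<Sum>m\<in>r ` N. 1 / real m)"
    by (simp add: sum_product sum.cartesian_product)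
  also have "\<dots> \<le> (real p / (real p - 1)) * (\<Prod>p\<in>D. real p / (real p - 1))"
  proof (rule mult_mono)
    have "(\<Sum>a\<in>v ` N. (1 / real p) ^ a) \<le> (\<Sum>a. (1 / real p) ^ a)"
      using insert.prems(2) p2 by (intro sum_le_suminf summable_geometric) auto
    also have "\<dots> = 1 / (1 - 1 / real p)" using p2 by (intro suminf_geometric) auto
    also have "\<dots> = real p / (real p - 1)" using p2 by (simp add: field_simps)
    finally show "(\<Sum>a\<in>v ` N. (1 / real p) ^ a) \<le> real p / (real p - 1)" .
    show "(\<Sum>m\<in>r ` N. 1 / real m) \<le> (\<Prod>p\<in>D. real p / (real p - 1))"
      by (rule insert.IH) (use insert.prems r in auto)
    show "0 \<le> real p / (real p - 1)" using p2 by simp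
    show "0 \<le> (\<Sum>m\<in>r ` N. 1 / real m)" by (rule sum_nonneg) simp
  qed
  finally show ?case using insert.hyps by simp
qed

lemma prod_prime_factors_dvd: "n > 0 \<Longrightarrow> \<Prod>(prime_factors n) dvd n" for n :: nat
proof -
  assume "n > 0"
  then have n: "n = (\<Prod>p\<in>prime_factors n. p ^ multiplicity p n)"
    by (simp add: prod_prime_factors)
  have "\<Prod>(prime_factors n) dvd (\<Prod>p\<in>prime_factors n. p ^ multiplicity p n)"
  proof (rule prod_dvd_prod)
    fix p assume "p \<in> prime_factors n"
    then have "multiplicity p n > 0" by (simp add: prime_factors_multiplicity)
    then show "p dvd p ^ multiplicity p n" by (simp add: dvd_power)
  qed
  with n show ?thesis by simp
qed

text \<open>A number with prime factors exactly \<open>D\<close> is \<open>\<Prod>D\<close> times a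
  number composed of primes of \<open>D\<close>, and (1 / p) * (p / (p - 1)) = 1 / (p - 1).\<close>

lemma sum_inverse_radical_le:
  fixes D N :: "nat set"
  assumes D: "finite D" "\<And>p. p \<in> D \<Longrightarrow> prime p"
    and N: "finite N" "\<And>n. n \<in> N \<Longrightarrow> n > 0 \<and> prime_factors n = D"
  shows "(\<Sum>n\<in>N. 1 / real n) \<le> (\<Prod>p\<in>D. 1 / (real p - 1))"
proof -
  define r where "r n = n div \<Prod>D" for n
  have Dpos: "\<Prod>D > 0" using D(2) by (rule prod_primes_pos)
  have dec: "n = \<Prod>D * r n" if "n \<in> N" for n
    using prod_prime_factors_dvd [of n] N(2) [OF that] by (auto simp: r_def)
  have r: "r n > 0 \<and> prime_factors (r n) \<subseteq> D" if "n \<in> N" for n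
  proof -
    have n: "n > 0" "prime_factors n = D" using N(2) [OF that] by auto
    have "r n \<noteq> 0" using dec [OF that] n(1) by (metis mult_0_right less_numeral_extra(3))
    moreover have "r n dvd n" using dec [OF that] by (metis dvd_triv_right)
    ultimately have "prime_factors (r n) \<subseteq> prime_factors n" using n(1) by (intro dvd_prime_factors) auto
    with n(2) \<open>r n \<noteq> 0\<close> show ?thesis by simp
  qed
  have inj: "inj_on r N" by (rule inj_onI) (metis dec)
  have "(\<Sum>n\<in>N. 1 / real n) = (\<Sum>n\<in>N. 1 / real (\<Prod>D) * (1 / real (r n)))"
  proof (rule sum.cong [OF refl])
    fix n assume "n \<in> N"
    then have "real n = real (\<Prod>D) * real (r n)" using dec by (metis of_nat_mult)
    then show "1 / real n = 1 / real (\<Prod>D) * (1 / real (r n))" by simp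
  qed
  also have "\<dots> = 1 / real (\<Prod>D) * (\<Sum>m\<in>r ` N. 1 / real m)"
    unfolding sum.reindex [OF inj] o_def sum_distrib_left ..
  also have "\<dots> \<le> 1 / real (\<Prod>D) * (\<Prod>p\<in>D. real p / (real p - 1))"
    by (intro mult_left_mono sum_inverse_smooth_le) (use D N r in \<open>auto intro: prod_nonneg\<close>)
  also have "1 / real (\<Prod>D) = (\<Prod>p\<in>D. 1 / real p)" by (simp add: prod_dividef)
  also have "\<dots> * (\<Prod>p\<in>D. real p / (real p - 1)) = (\<Prod>p\<in>D. 1 / real p * (real p / (real p - 1)))"
    by (rule prod.distrib [symmetric])
  also have "\<dots> = (\<Prod>p\<in>D. 1 / (real p - 1))"
  proof (rule prod.cong [OF refl])
    fix p assume "p \<in> D"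
    then have "p \<noteq> 0" using D(2) [of p] by auto
    then show "1 / real p * (real p / (real p - 1)) = 1 / (real p - 1)" by simp
  qed
  finally show ?thesis .
qed

lemma finite_primes_le: "finite {p::nat. prime p \<and> p \<le> z \<and> Q p}"
  by (rule finite_subset [of _ "{..z}"]) auto

lemma finite_primes_upto: "finite {p::nat. prime p \<and> p \<le> z}"
  by (rule finite_subset [of _ "{..z}"]) auto

text \<open>The harmonic sum up to \<open>z\<close> is grouped by the set of prime factors. The
  radical of n does not exceed n, so every group occurs in the sieve sum, whose term dominates the
  group.\<close>

lemma ln_le_sieve_sum_all:
  assumes "z \<ge> 1"
  shows "ln (real z) \<le> sieve_sum 1 {p. prime p \<and> p \<le> z} z"
proof -
  define P where "P = {p::nat. prime p \<and> p \<le> z}"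
  define \<D> where "\<D> = {D. D \<subseteq> P \<and> \<Prod>D \<le> z}"
  have finP: "finite P" using finite_primes_upto [of z] by (simp add: P_def)
  then have fin: "finite \<D>" by (simp add: \<D>_def)
  have "ln (real z) \<le> ln (real z + 1)" using assms by simp
  also have "\<dots> \<le> harm z" by (rule ln_le_harm)
  also have "\<dots> = (\<Sum>n\<in>{1..z}. 1 / real n)" by (simp add: harm_def inverse_eq_divide)
  also have "\<dots> = (\<Sum>D\<in>\<D>. \<Sum>n\<in>{n\<in>{1..z}. prime_factors n = D}. 1 / real n)"
  proof (rule sum.group [symmetric])
    show "finite {1..z}" "finite \<D>" using fin by auto
    show "prime_factors ` {1..z} \<subseteq> \<D>"
    proof
      fix D assume "D \<in> prime_factors ` {1..z}"
      then obtain n where n: "n \<in> {1..z}" "D = prime_factors n" by blast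
      have "p \<le> z" if "p \<in> prime_factors n" for p
        using that n(1) dvd_imp_le [of p n] by fastforce
      then have "D \<subseteq> P" using n(2) by (auto simp: P_def)
      moreover have "\<Prod>D \<le> n" using n prod_prime_factors_dvd [of n] by (intro dvd_imp_le) auto
      ultimately show "D \<in> \<D>" using n(1) by (auto simp: \<D>_def)
    qed
  qed
  also have "\<dots> \<le> (\<Sum>D\<in>\<D>. \<Prod>p\<in>D. 1 / (real p - 1))"
  proof (rule sum_mono)
    fix D assume "D \<in> \<D>"
    then have D: "D \<subseteq> P" by (simp add: \<D>_def)
    show "(\<Sum>n\<in>{n\<in>{1..z}. prime_factors n = D}. 1 / real n) \<le> (\<Prod>p\<in>D. 1 / (real p - 1))"
    proof (rule sum_inverse_radical_le)
      show "finite D" using D finP finite_subset by blast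
      show "prime p" if "p \<in> D" for p using that D by (auto simp: P_def)
    qed auto
  qed
  finally show ?thesis by (simp add: sieve_sum_def P_def \<D>_def)
qed

lemma prod_prime_set_mono:
  fixes D E :: "nat set"
  assumes "finite D" "\<And>p. p \<in> D \<Longrightarrow> prime p" "E \<subseteq> D"
  shows "\<Prod>E \<le> \<Prod>D"
  by (rule dvd_imp_le [OF prod_dvd_prod_subset [OF assms(1,3)] prod_primes_pos]) (rule assms(2))

text \<open>Leaving out the primes dividing \<open>m\<close> costs at most the factor
  \<open>euler_ratio m\<close>: each \<open>D\<close> splits into its parts inside and outside
  \<open>Q\<close>, and the sum over all subsets of \<open>Q\<close> is the product of 1 + 1 / (p -
  1) = p / (p - 1).\<close>

lemma ln_le_sieve_sum:
  assumes m: "m > 0" and z: "z \<ge> 1" and P: "finite P" "\<And>p. p \<in> P \<Longrightarrow> prime p"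
    and sub: "\<And>p. prime p \<Longrightarrow> p \<le> z \<Longrightarrow> \<not> p dvd m \<Longrightarrow> p \<in> P"
  shows "ln (real z) \<le> euler_ratio m * sieve_sum 1 P z"
proof -
  define P1 where "P1 = {p::nat. prime p \<and> p \<le> z}"
  define \<D>1 where "\<D>1 = {D. D \<subseteq> P1 \<and> \<Prod>D \<le> z}"
  define \<D> where "\<D> = {D. D \<subseteq> P \<and> \<Prod>D \<le> z}"
  define Q where "Q = prime_factors m"
  define w where "w D = (\<Prod>p\<in>D. 1 / (real p - 1))" for D :: "nat set"
  have finP1: "finite P1" using finite_primes_upto [of z] by (simp add: P1_def)
  have fin: "finite \<D>" "finite \<D>1" using P(1) finP1 by (simp_all add: \<D>_def \<D>1_def)
  have finQ: "finite Q" by (simp add: Q_def)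
  have wpos: "w D \<ge> 0" if "\<And>p. p \<in> D \<Longrightarrow> prime p" for D
  proof -
    have "real p \<ge> 2" if "p \<in> D" for p using that \<open>\<And>p. p \<in> D \<Longrightarrow> prime p\<close> real_prime_ge_2 by blast
    then show ?thesis unfolding w_def by (intro prod_nonneg) fastforce
  qed
  have inj: "inj_on (\<lambda>D. (D \<inter> Q, D - Q)) \<D>1" by (rule inj_onI) blast
  have "ln (real z) \<le> sum w \<D>1"
    using ln_le_sieve_sum_all [OF z] by (simp add: sieve_sum_def \<D>1_def P1_def w_def)
  also have "\<dots> = (\<Sum>D\<in>\<D>1. (\<lambda>(D, E). w D * w E) (D \<inter> Q, D - Q))"
  proof (rule sum.cong [OF refl])
    fix D assume "D \<in> \<D>1"
    then have "finite D" using finP1 finite_subset by (auto simp: \<D>1_def)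
    then show "w D = (\<lambda>(D, E). w D * w E) (D \<inter> Q, D - Q)"
      unfolding w_def by (simp add: prod.Int_Diff [of D _ Q])
  qed
  also have "\<dots> = (\<Sum>(D, E)\<in>(\<lambda>D. (D \<inter> Q, D - Q)) ` \<D>1. w D * w E)"
    by (subst sum.reindex [OF inj]) (simp add: o_def)
  also have "\<dots> \<le> (\<Sum>(D, E)\<in>Pow Q \<times> \<D>. w D * w E)"
  proof (rule sum_mono2)
    show "finite (Pow Q \<times> \<D>)" using fin finQ by simp
    show "(\<lambda>D. (D \<inter> Q, D - Q)) ` \<D>1 \<subseteq> Pow Q \<times> \<D>"
    proof
      fix x assume "x \<in> (\<lambda>D. (D \<inter> Q, D - Q)) ` \<D>1"
      then obtain D where D: "D \<subseteq> P1" "\<Prod>D \<le> z" "x = (D \<inter> Q, D - Q)" by (auto simp: \<D>1_def)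
      have "finite D" using D finP1 finite_subset by blast
      moreover have prD: "prime p" if "p \<in> D" for p using that D(1) by (auto simp: P1_def)
      ultimately have "\<Prod>(D - Q) \<le> \<Prod>D" by (intro prod_prime_set_mono) auto
      moreover have "D - Q \<subseteq> P"
      proof
        fix p assume "p \<in> D - Q"
        then have "prime p" "p \<le> z" "\<not> p dvd m"
          using D(1) m by (auto simp: P1_def Q_def in_prime_factors_iff)
        then show "p \<in> P" by (rule sub)
      qed
      ultimately show "x \<in> Pow Q \<times> \<D>" using D by (simp add: \<D>_def)
    qed
    fix b assume b: "b \<in> Pow Q \<times> \<D> - (\<lambda>D. (D \<inter> Q, D - Q)) ` \<D>1"
    obtain D E where DE: "b = (D, E)" by (cases b)
    have "D \<subseteq> Q" "E \<subseteq> P" using b DE by (auto simp: \<D>_def)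
    then have "w D \<ge> 0" "w E \<ge> 0" using P(2) by (auto intro!: wpos simp: Q_def)
    then show "0 \<le> (case b of (D, E) \<Rightarrow> w D * w E)" using DE by simp
  qed
  also have "\<dots> = sum w (Pow Q) * sum w \<D>"
    by (simp add: sum_product sum.cartesian_product)
  also have "sum w (Pow Q) = (\<Prod>p\<in>Q. 1 / (real p - 1) + 1)"
    unfolding w_def by (subst prod_add [OF finQ]) simp
  also have "\<dots> = euler_ratio m"
    unfolding euler_ratio_def Q_def
  proof (rule prod.cong [OF refl])
    fix p assume "p \<in> prime_factors m"
    then have "real p \<ge> 2" using real_prime_ge_2 by blast
    then show "1 / (real p - 1) + 1 = real p / (real p - 1)" by (simp add: field_simps)
  qed
  also have "sum w \<D> = sieve_sum 1 P z" by (simp add: sieve_sum_def \<D>_def w_def)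
  finally show ?thesis .
qed

text \<open>Reduces the two-class sieve sum to the one-class sum. The pairs in the square are
  grouped by their union: a prime of the union lies in the first set only, the second only, or both,
  which gives 2 f + f^2 with f = 1 / (p - 1), and this is at most 2 / (p - 2). The union has product
  at most z^2, hence the level \<open>z * z\<close>.\<close>

lemma sieve_sum_square_le:
  assumes P: "finite P" "\<And>p. p \<in> P \<Longrightarrow> prime p \<and> 2 < p"
  shows "(sieve_sum 1 P z)\<^sup>2 \<le> sieve_sum 2 P (z * z)"
proof -
  define \<D> where "\<D> = {D. D \<subseteq> P \<and> \<Prod>D \<le> z}"
  define \<U> where "\<U> = {D. D \<subseteq> P \<and> \<Prod>D \<le> z * z}"
  define f where "f p = 1 / (real p - 1)" for p :: nat
  have fin: "finite \<D>" "finite \<U>" using P(1) by (simp_all add: \<D>_def \<U>_def)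
  have finD: "finite D" if "D \<subseteq> P" for D using that P(1) finite_subset by blast
  have f0: "f p \<ge> 0" if "p \<in> P" for p using P(2) [OF that] by (simp add: f_def)
  have F0: "prod f D \<ge> 0" if "D \<subseteq> P" for D using that f0 by (intro prod_nonneg) auto
  have U: "D \<union> E \<in> \<U>" if "D \<in> \<D>" "E \<in> \<D>" for D E
  proof -
    have D: "D \<subseteq> P" "\<Prod>D \<le> z" and E: "E \<subseteq> P" "\<Prod>E \<le> z" using that by (auto simp: \<D>_def)
    have "\<Prod>(D \<inter> E) > 0" using D(1) P(2) by (intro prod_primes_pos) auto
    then have "\<Prod>(D \<union> E) \<le> \<Prod>(D \<union> E) * \<Prod>(D \<inter> E)" by simp
    also have "\<dots> = \<Prod>D * \<Prod>E" using finD D E by (intro prod.union_inter) auto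
    also have "\<dots> \<le> z * z" using D E by (intro mult_mono) auto
    finally show ?thesis using D E by (simp add: \<U>_def)
  qed
  have "(sieve_sum 1 P z)\<^sup>2 = (\<Sum>x\<in>\<D>\<times>\<D>. prod f (fst x) * prod f (snd x))"
    by (simp add: sieve_sum_def \<D>_def f_def power2_eq_square sum_product sum.cartesian_product split_def)
  also have "\<dots> = (\<Sum>U\<in>\<U>. \<Sum>x\<in>{x\<in>\<D>\<times>\<D>. fst x \<union> snd x = U}. prod f (fst x) * prod f (snd x))"
    by (rule sum.group [symmetric]) (use fin U in auto)
  also have "\<dots> \<le> (\<Sum>U\<in>\<U>. \<Prod>p\<in>U. 2 / (real p - 2))"
  proof (rule sum_mono)
    fix V assume "V \<in> \<U>"
    then have V: "V \<subseteq> P" "finite V" using finD by (auto simp: \<U>_def)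
    define S where "S = {x\<in>\<D>\<times>\<D>. fst x \<union> snd x = V}"
    \<comment> \<open>For a fixed union \<open>V\<close>, a pair (D, E) is determined by
      \<open>D\<close> and X = D \<inter> E, because E is the disjoint union of V - D and X.\<close>
    have inj: "inj_on (\<lambda>x. (fst x, fst x \<inter> snd x)) S"
    proof (rule inj_onI)
      fix x y assume "x \<in> S" "y \<in> S" and eq: "(fst x, fst x \<inter> snd x) = (fst y, fst y \<inter> snd y)"
      then have "fst x \<union> snd x = fst y \<union> snd y" by (simp add: S_def)
      with eq have "fst x = fst y" "snd x = snd y" by blast+
      then show "x = y" by (rule prod_eqI)
    qed
    have "(\<Sum>x\<in>S. prod f (fst x) * prod f (snd x))
        = (\<Sum>x\<in>S. (\<lambda>(D, X). prod f D * (prod f (V - D) * prod f X)) (fst x, fst x \<inter> snd x))"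
    proof (rule sum.cong [OF refl])
      fix x assume x: "x \<in> S"
      then have "snd x = (V - fst x) \<union> (fst x \<inter> snd x)" "finite (snd x)" "finite (fst x)"
        using finD by (auto simp: S_def \<D>_def)
      then have "prod f (snd x) = prod f (V - fst x) * prod f (fst x \<inter> snd x)"
        using V(2) by (metis Diff_disjoint Int_Diff Int_commute finite_Diff finite_Int inf_bot_right inf_left_commute prod.union_disjoint)
      then show "prod f (fst x) * prod f (snd x) = (\<lambda>(D, X). prod f D * (prod f (V - D) * prod f X)) (fst x, fst x \<inter> snd x)"
        by simp
    qed
    also have "\<dots> = (\<Sum>(D, X)\<in>(\<lambda>x. (fst x, fst x \<inter> snd x)) ` S. prod f D * (prod f (V - D) * prod f X))"
      by (subst sum.reindex [OF inj]) (simp add: o_def)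
    also have "\<dots> \<le> (\<Sum>(D, X)\<in>Sigma (Pow V) Pow. prod f D * (prod f (V - D) * prod f X))"
    proof (rule sum_mono2)
      show "finite (Sigma (Pow V) Pow)" using V(2) finite_subset by (intro finite_SigmaI) auto
      show "(\<lambda>x. (fst x, fst x \<inter> snd x)) ` S \<subseteq> Sigma (Pow V) Pow" by (auto simp: S_def)
      fix b assume b: "b \<in> Sigma (Pow V) Pow - (\<lambda>x. (fst x, fst x \<inter> snd x)) ` S"
      obtain D X where b': "b = (D, X)" by (cases b)
      then have "D \<subseteq> P" "V - D \<subseteq> P" "X \<subseteq> P" using b V by auto
      then show "0 \<le> (case b of (D, X) \<Rightarrow> prod f D * (prod f (V - D) * prod f X))"
        using F0 b' by simp
    qed
    also have "\<dots> = (\<Sum>D\<in>Pow V. \<Sum>X\<in>Pow D. prod f D * (prod f (V - D) * prod f X))"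
      by (rule sum.Sigma [symmetric]) (use V(2) finite_subset in auto)
    also have "\<dots> = (\<Sum>D\<in>Pow V. (\<Prod>p\<in>D. f p * (f p + 1)) * prod f (V - D))"
    proof (rule sum.cong [OF refl])
      fix D assume "D \<in> Pow V"
      then have "finite D" using V(2) finite_subset by auto
      then have "(\<Sum>X\<in>Pow D. prod f X) = (\<Prod>p\<in>D. f p + 1)" by (subst prod_add) auto
      then show "(\<Sum>X\<in>Pow D. prod f D * (prod f (V - D) * prod f X)) = (\<Prod>p\<in>D. f p * (f p + 1)) * prod f (V - D)"
        by (simp add: prod.distrib flip: sum_distrib_left)
    qed
    also have "\<dots> = (\<Prod>p\<in>V. f p * (f p + 1) + f p)" by (rule prod_add [OF V(2), symmetric])
    also have "\<dots> \<le> (\<Prod>p\<in>V. 2 / (real p - 2))"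
    proof (rule prod_mono, rule conjI)
      fix p assume "p \<in> V"
      then have p: "p \<in> P" "real p \<ge> 3" using V P(2) by force+
      show "0 \<le> f p * (f p + 1) + f p" using f0 [OF p(1)] by simp
      define x where "x = real p - 1"
      have "x > 0" using p(2) by (simp add: x_def)
      then have "1 / x * (1 / x + 1) + 1 / x = (2 * x + 1) / x\<^sup>2"
        by (simp add: field_simps power2_eq_square)
      then have "f p * (f p + 1) + f p = (2 * real p - 1) / (real p - 1)\<^sup>2"
        by (simp add: f_def x_def)
      also have "\<dots> \<le> 2 / (real p - 2)"
      proof -
        have "(2 * real p - 1) * (real p - 2) \<le> 2 * (real p - 1)\<^sup>2" 
          using p(2) by (simp add: power2_eq_square algebra_simps)
        then show ?thesis using p(2) by (simp add: divide_simps)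
      qed
      finally show "f p * (f p + 1) + f p \<le> 2 / (real p - 2)" .
    qed
    finally show "(\<Sum>x\<in>{x\<in>\<D>\<times>\<D>. fst x \<union> snd x = V}. prod f (fst x) * prod f (snd x)) \<le> (\<Prod>p\<in>V. 2 / (real p - 2))"
      by (simp add: S_def)
  qed
  also have "\<dots> = sieve_sum 2 P (z * z)" by (simp add: sieve_sum_def \<U>_def)
  finally show ?thesis .
qed

text \<open>For p >= 3 one has p / (p - 1) <= sqrt p; the factor 2 pays for p = 2, where this fails.
  Applied to a period T, the crude bound still leaves a saving of sqrt T in a class modulo
  T.\<close>

lemma euler_ratio_le_sqrt:
  assumes "T > 0"
  shows "euler_ratio T \<le> 2 * sqrt (real T)"
proof -
  define Q where "Q = prime_factors T"
  have "euler_ratio T \<le> (\<Prod>p\<in>Q. (if p = 2 then 2 else 1) * sqrt (real p))"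
    unfolding euler_ratio_def Q_def
  proof (rule prod_mono, rule conjI)
    fix p assume "p \<in> prime_factors T"
    then have p: "prime p" by blast
    have p2: "real p \<ge> 2" by (rule real_prime_ge_2 [OF p])
    then show "0 \<le> real p / (real p - 1)" by simp
    show "real p / (real p - 1) \<le> (if p = 2 then 2 else 1) * sqrt (real p)"
    proof (cases "p = 2")
      case True
      have "1 \<le> sqrt (2::real)" by simp
      then show ?thesis using True by simp
    next
      case False
      then have p3: "real p \<ge> 3" using prime_ge_2_nat [OF p] by linarith
      have "3 * real p \<le> real p * real p" using p3 by (intro mult_right_mono) auto
      moreover have "(real p - 1)\<^sup>2 = real p * real p - 2 * real p + 1"
        by (simp add: power2_eq_square algebra_simps)
      ultimately have "real p \<le> (real p - 1)\<^sup>2" by linarith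
      then have "real p * real p \<le> real p * (real p - 1)\<^sup>2"
        by (intro mult_left_mono) simp_all
      then have "(real p / (real p - 1))\<^sup>2 \<le> real p"
        using p3 by (simp add: power_divide power2_eq_square divide_simps)
      then have "real p / (real p - 1) \<le> sqrt (real p)" by (rule real_le_rsqrt)
      then show ?thesis using False by simp
    qed
  qed
  also have "\<dots> = (\<Prod>p\<in>Q. if p = 2 then 2 else 1) * (\<Prod>p\<in>Q. sqrt (real p))"
    by (rule prod.distrib)
  also have "(\<Prod>p\<in>Q. if p = 2 then 2 else 1::real) = (if 2 \<in> Q then 2 else 1)"
    by (rule prod.delta) (simp add: Q_def)
  also have "(\<Prod>p\<in>Q. sqrt (real p)) = sqrt (real (\<Prod>Q))"
    by (induction Q rule: infinite_finite_induct) (simp_all add: real_sqrt_mult)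
  also have "(if 2 \<in> Q then 2 else 1) * sqrt (real (\<Prod>Q)) \<le> 2 * sqrt (real T)"
  proof (rule mult_mono)
    have "\<Prod>Q \<le> T" unfolding Q_def using assms by (intro dvd_imp_le prod_prime_factors_dvd)
    then have "real (\<Prod>Q) \<le> real T" by (simp only: of_nat_le_iff)
    then show "sqrt (real (\<Prod>Q)) \<le> sqrt (real T)" by (rule real_sqrt_le_mono)
  qed (auto intro: prod_nonneg)
  finally show ?thesis .
qed

section \<open>Primes in residue classes and prime pairs\<close>

lemma dvd_mod_linear:
  fixes p r T n :: nat
  shows "p dvd r + T * (n mod p) \<longleftrightarrow> p dvd r + T * n"
proof -
  have "(r + T * (n mod p)) mod p = (r + T * n) mod p" by (metis mod_add_right_eq mod_mult_right_eq)
  then show ?thesis by (simp only: dvd_eq_mod_eq_0)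
qed

lemma card_linear_root:
  fixes p T r :: nat
  assumes "prime p" "\<not> p dvd T"
  shows "card {j\<in>{..<p}. p dvd r + T * j} = 1"
proof -
  have p0: "p > 0" using assms(1) by (rule prime_gt_0_nat)
  have cop: "coprime T p" using assms by (metis coprime_commute prime_imp_coprime)
  obtain x where x: "[T * x = 1] (mod p)" using cong_solve_coprime_nat [OF cop] by auto
  define j where "j = (x * (p - r mod p)) mod p"
  have "[T * j = T * (x * (p - r mod p))] (mod p)"
    unfolding j_def by (intro cong_mult cong_refl) simp
  also have "T * (x * (p - r mod p)) = T * x * (p - r mod p)" by simp
  also have "[T * x * (p - r mod p) = 1 * (p - r mod p)] (mod p)"
    using x by (intro cong_mult cong_refl)
  finally have "[r + T * j = r mod p + 1 * (p - r mod p)] (mod p)"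
    by (intro cong_add) simp_all
  also have "r mod p + 1 * (p - r mod p) = p" using p0 by (simp add: less_imp_le)
  finally have "(r + T * j) mod p = 0" by (simp add: cong_def)
  then have j: "p dvd r + T * j" by (rule mod_0_imp_dvd)
  have jp: "j < p" using p0 by (simp add: j_def)
  have "i = j" if i: "i < p" "p dvd r + T * i" for i
  proof -
    have "[r + T * i = r + T * j] (mod p)" using i(2) j by (simp add: cong_def dvd_eq_mod_eq_0)
    then have "[T * i = T * j] (mod p)" by (simp add: cong_add_lcancel_nat)
    then have "[i = j] (mod p)" using cop by (simp add: cong_mult_lcancel_nat)
    then show "i = j" using i(1) jp by (simp add: cong_def)
  qed
  with j jp have "{i\<in>{..<p}. p dvd r + T * i} = {j}" by blast
  then show ?thesis by simp
qed

lemma euler_ratio_pos: "euler_ratio m > 0"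
  unfolding euler_ratio_def
proof (rule prod_pos)
  fix p assume "p \<in> prime_factors m"
  then have "real p \<ge> 2" using real_prime_ge_2 by blast
  then show "real p / (real p - 1) > 0" by simp
qed

text \<open>Writing q = r + T n, a prime q > z forces n to avoid the root of r + T n modulo every
  prime p <= z not dividing T. The primes q <= z account for the first summand.\<close>

lemma card_primes_residue_class_sieve:
  assumes T: "T > 0" and z: "z \<ge> 2"
  shows "real (card {q. prime q \<and> q \<le> L \<and> q mod T = r})
     \<le> real z + (real L / real T + 1) * euler_ratio T / ln (real z) + real z ^ 4"
proof -
  define P where "P = {p::nat. prime p \<and> p \<le> z \<and> \<not> p dvd T}"
  define \<Omega> where "\<Omega> p = {j\<in>{..<p}. p dvd r + T * j}" for p
  define M where "M = L div T + 1"
  define S where "S = {n\<in>{..<M}. \<forall>p\<in>P. n mod p \<notin> \<Omega> p}"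
  have finP: "finite P" unfolding P_def by (rule finite_primes_le)
  have sieve: "real (card S) \<le> real M / sieve_sum 1 P z + real z ^ 4"
    unfolding S_def
  proof (rule sieve_residue_classes)
    show "prime p" if "p \<in> P" for p using that by (simp add: P_def)
    show "1 < p" if "p \<in> P" for p using that prime_gt_1_nat [of p] by (simp add: P_def)
    show "\<Omega> p \<subseteq> {..<p} \<and> card (\<Omega> p) = 1" if "p \<in> P" for p
      using that card_linear_root [of p T r] by (auto simp: P_def \<Omega>_def)
  qed (use finP z in auto)
  have low: "ln (real z) \<le> euler_ratio T * sieve_sum 1 P z"
    by (rule ln_le_sieve_sum) (use T z finP in \<open>auto simp: P_def\<close>)
  moreover have lnz: "ln (real z) > 0" using z by simp
  moreover note euler_ratio_pos [of T]
  ultimately have spos: "sieve_sum 1 P z > 0"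
    using less_le_trans zero_less_mult_pos by blast
  have "1 / sieve_sum 1 P z \<le> euler_ratio T / ln (real z)"
    using low lnz spos by (simp add: divide_le_eq le_divide_eq mult.commute)
  then have "real M * (1 / sieve_sum 1 P z) \<le> real M * (euler_ratio T / ln (real z))"
    by (rule mult_left_mono) simp
  also have "\<dots> \<le> (real L / real T + 1) * (euler_ratio T / ln (real z))"
  proof (rule mult_right_mono)
    show "real M \<le> real L / real T + 1"
    proof -
      have "L div T * T \<le> L" by simp
      then have "real (L div T) * real T \<le> real L" by (simp only: of_nat_mult [symmetric] of_nat_le_iff)
      then show ?thesis using T by (simp add: M_def pos_le_divide_eq)
    qed
    show "0 \<le> euler_ratio T / ln (real z)" using lnz euler_ratio_pos [of T] by simp
  qed
  finally have M: "real M / sieve_sum 1 P z \<le> (real L / real T + 1) * euler_ratio T / ln (real z)" by simp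
  define A where "A = {q. prime q \<and> q \<le> L \<and> q mod T = r}"
  have "A \<subseteq> {1..z} \<union> (A \<inter> {z<..})"
  proof
    fix q assume "q \<in> A"
    moreover from this have "q > 0" by (auto simp: A_def prime_gt_0_nat)
    ultimately show "q \<in> {1..z} \<union> (A \<inter> {z<..})" by auto
  qed
  moreover have finA: "finite A" unfolding A_def by (rule finite_subset [of _ "{..L}"]) auto
  ultimately have "card A \<le> card ({1..z} \<union> (A \<inter> {z<..}))" by (intro card_mono) auto
  also have "\<dots> \<le> card {1..z} + card (A \<inter> {z<..})" by (rule card_Un_le)
  also have "card (A \<inter> {z<..}) \<le> card S"
  proof (rule card_inj_on_le)
    show "inj_on (\<lambda>q. q div T) (A \<inter> {z<..})"
    proof (rule inj_onI)
      fix x y assume "x \<in> A \<inter> {z<..}" "y \<in> A \<inter> {z<..}" "x div T = y div T"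
      then show "x = y" unfolding A_def by (metis (mono_tags) IntD1 div_mult_mod_eq mem_Collect_eq)
    qed
    show "finite S" by (simp add: S_def)
    show "(\<lambda>q. q div T) ` (A \<inter> {z<..}) \<subseteq> S"
    proof
      fix n assume "n \<in> (\<lambda>q. q div T) ` (A \<inter> {z<..})"
      then obtain q where q: "prime q" "q \<le> L" "q mod T = r" "q > z" "n = q div T"
        by (auto simp: A_def)
      have n: "q = r + T * n" using q(3,5) by (metis mod_mult_div_eq)
      have "n < M" using q(2,5) by (simp add: M_def div_le_mono le_imp_less_Suc)
      moreover have "n mod p \<notin> \<Omega> p" if "p \<in> P" for p
      proof
        assume "n mod p \<in> \<Omega> p"
        then have "p dvd q" unfolding \<Omega>_def n by (simp add: dvd_mod_linear)
        then have "p = q" using q(1) that by (simp add: P_def primes_dvd_imp_eq)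
        with q(4) that show False by (simp add: P_def)
      qed
      ultimately show "n \<in> S" by (simp add: S_def)
    qed
  qed
  finally have "card A \<le> z + card S" by simp
  then have "real (card A) \<le> real z + real (card S)" by (simp only: of_nat_add [symmetric] of_nat_le_iff)
  also have "\<dots> \<le> real z + ((real L / real T + 1) * euler_ratio T / ln (real z) + real z ^ 4)"
    using sieve M by linarith
  finally show ?thesis by (simp add: A_def)
qed

text \<open>Here n avoids 0 and -h modulo p. The two classes coincide if p divides h, and for p = 2
  they would leave nothing, so the primes dividing 2 h are left out at the cost of
  \<open>euler_ratio (2 * h)\<close>. The level is z^2 because of
  \<open>sieve_sum_square_le\<close>, so the error is (z^2)^4.\<close>

lemma card_prime_pairs_sieve:
  assumes h: "h > 0" and z: "z \<ge> 2"
  shows "real (card {n. n \<le> N \<and> prime n \<and> prime (n + h)})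
     \<le> real z ^ 2 + (real N + 1) * (euler_ratio (2 * h) / ln (real z))\<^sup>2 + real z ^ 8"
proof -
  define P where "P = {p::nat. prime p \<and> p \<le> z * z \<and> \<not> p dvd 2 * h}"
  define \<Omega> where "\<Omega> p = {j\<in>{..<p}. p dvd j \<or> p dvd j + h}" for p
  define M where "M = N + 1"
  define S where "S = {n\<in>{..<M}. \<forall>p\<in>P. n mod p \<notin> \<Omega> p}"
  have finP: "finite P" unfolding P_def by (rule finite_primes_le)
  have P3: "2 < p" if "p \<in> P" for p
  proof -
    have "p \<ge> 2" "p \<noteq> 2" using that prime_ge_2_nat by (auto simp: P_def)
    then show ?thesis by simp
  qed
  have card\<Omega>: "card (\<Omega> p) = 2" if "p \<in> P" for p
  proof -
    have p: "prime p" "\<not> p dvd h" using that by (auto simp: P_def)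
    have p0: "p > 0" using p(1) by (rule prime_gt_0_nat)
    have hm: "h mod p > 0" "h mod p < p" using p(2) p0 by (auto simp: dvd_eq_mod_eq_0)
    have "\<Omega> p = {0, p - h mod p}"
    proof (intro equalityI subsetI)
      fix j assume j: "j \<in> \<Omega> p"
      then have jp: "j < p" by (simp add: \<Omega>_def)
      show "j \<in> {0, p - h mod p}"
      proof (cases "j = 0")
        case False
        then have "\<not> p dvd j" using jp by (auto dest: dvd_imp_le)
        then have "p dvd j + h" using j by (simp add: \<Omega>_def)
        then have "p dvd j + h mod p" by (simp add: dvd_eq_mod_eq_0 mod_simps)
        then obtain k where k: "j + h mod p = p * k" by blast
        have "p * k < p * 2" "p * k > 0" using jp hm k by linarith+
        then have "k = 1" by auto
        then have "j + h mod p = p" using k by simp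
        then have "j = p - h mod p" by arith
        then show ?thesis by simp
      qed simp
    next
      fix j assume "j \<in> {0, p - h mod p}"
      moreover have "p dvd (p - h mod p) + h"
      proof -
        have "p - h mod p + h = p + (h - h mod p)" using hm(2) by simp
        then show ?thesis by (metis dvd_add dvd_minus_mod dvd_refl)
      qed
      ultimately show "j \<in> \<Omega> p" using hm p0 by (auto simp: \<Omega>_def)
    qed
    then show ?thesis using hm by simp
  qed
  have sieve: "real (card S) \<le> real M / sieve_sum 2 P (z * z) + real (z * z) ^ 4"
    unfolding S_def
  proof (rule sieve_residue_classes)
    show "prime p" if "p \<in> P" for p using that by (simp add: P_def)
    show "2 < p" if "p \<in> P" for p using that by (rule P3)
    show "\<Omega> p \<subseteq> {..<p} \<and> card (\<Omega> p) = 2" if "p \<in> P" for p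
      using that card\<Omega> by (auto simp: \<Omega>_def)
  qed (use finP z in auto)
  have "z \<le> z * z" using z by simp
  then have "ln (real z) \<le> euler_ratio (2 * h) * sieve_sum 1 P z"
    by (intro ln_le_sieve_sum) (use h z finP in \<open>auto simp: P_def intro: order_trans\<close>)
  moreover have lnz: "ln (real z) > 0" using z by simp
  moreover have epos: "euler_ratio (2 * h) > 0" by (rule euler_ratio_pos)
  ultimately have low: "ln (real z) / euler_ratio (2 * h) \<le> sieve_sum 1 P z" "ln (real z) / euler_ratio (2 * h) > 0"
    by (simp_all add: pos_divide_le_eq mult.commute)
  have "(ln (real z) / euler_ratio (2 * h))\<^sup>2 \<le> (sieve_sum 1 P z)\<^sup>2"
    using low by (intro power_mono) auto
  also have "\<dots> \<le> sieve_sum 2 P (z * z)"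
    by (rule sieve_sum_square_le) (use finP P3 in \<open>auto simp: P_def\<close>)
  finally have "real M / sieve_sum 2 P (z * z) \<le> real M / (ln (real z) / euler_ratio (2 * h))\<^sup>2"
    using low by (intro divide_left_mono mult_pos_pos) (auto intro: less_le_trans [rotated] zero_less_power)
  then have M: "real M / sieve_sum 2 P (z * z) \<le> (real N + 1) * (euler_ratio (2 * h) / ln (real z))\<^sup>2"
    by (simp add: M_def power_divide add.commute)
  define A where "A = {n. n \<le> N \<and> prime n \<and> prime (n + h)}"
  have "A \<subseteq> {1..z*z} \<union> S"
  proof
    fix n assume n: "n \<in> A"
    show "n \<in> {1..z*z} \<union> S"
    proof (cases "n \<le> z * z")
      case True
      with n show ?thesis using prime_gt_0_nat [of n] by (simp add: A_def)
    next
      case False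
      have "n mod p \<notin> \<Omega> p" if "p \<in> P" for p
      proof
        assume "n mod p \<in> \<Omega> p"
        then have "p dvd n mod p \<or> p dvd n mod p + h" by (simp add: \<Omega>_def)
        then have "p dvd n \<or> p dvd n + h" by (simp add: dvd_eq_mod_eq_0 mod_simps)
        then have "p = n \<or> p = n + h" using n that by (auto simp: A_def P_def primes_dvd_imp_eq)
        with False that show False by (auto simp: P_def)
      qed
      then show ?thesis using n by (simp add: S_def A_def M_def)
    qed
  qed
  then have "card A \<le> card ({1..z*z} \<union> S)" by (intro card_mono) (auto simp: S_def)
  also have "\<dots> \<le> card {1..z*z} + card S" by (rule card_Un_le)
  finally have "card A \<le> z * z + card S" by simp
  then have "real (card A) \<le> real (z * z) + real (card S)" by (simp only: of_nat_add [symmetric] of_nat_le_iff)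
  also have "\<dots> \<le> real (z * z) + ((real N + 1) * (euler_ratio (2 * h) / ln (real z))\<^sup>2 + real (z * z) ^ 4)"
    using sieve M by linarith
  also have "real (z * z) ^ 4 = real z ^ 8" by (simp flip: power_add add: power_mult_distrib)
  also have "real (z * z) = real z ^ 2" by (simp add: power2_eq_square)
  finally show ?thesis by (simp add: A_def)
qed

section \<open>Chebyshev's lower bound\<close>

text \<open>
  The numbers \<open>1 / (m * (n choose m))\<close> form Leibniz's harmonic triangle, in which every entry is a
  difference of two neighbours.
\<close>

lemma Leibniz_triangle_integral:
  fixes Q :: nat
  assumes "1 \<le> m" "m \<le> n" "\<And>k. 1 \<le> k \<Longrightarrow> k \<le> n \<Longrightarrow> k dvd Q"
  shows "real Q / (real m * real (n choose m)) \<in> \<int>"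
  using assms
proof (induction m arbitrary: n rule: nat_induct_at_least)
  case base
  then obtain c where "Q = n * c" using dvdE by (metis order_refl)
  then show ?case using base by simp
next
  case (Suc m)
  then obtain N where n: "n = Suc N" by (cases n) auto
  have m: "m \<ge> 1" "m \<le> N" using Suc n by auto
  have 1: "real Q / (real m * real (n choose m)) \<in> \<int>" using Suc n by (intro Suc.IH) auto
  have 2: "real Q / (real m * real (N choose m)) \<in> \<int>" using Suc n m by (intro Suc.IH) auto
  define c where "c = real (N choose m)"
  have c: "c > 0" using m by (simp add: c_def)
  have "real (Suc N * (N choose m)) = real ((Suc N choose Suc m) * Suc m)"
    by (simp only: Suc_times_binomial_eq)
  then have a: "real (Suc m) * real (n choose Suc m) = real n * c"
    by (simp only: of_nat_mult n c_def mult.commute)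
  have "real ((n - m) * (n choose m)) = real (n * ((n - 1) choose m))"
    by (simp only: binomial_absorb_comp)
  then have b: "(real n - real m) * real (n choose m) = real n * c"
    using m n by (simp add: c_def of_nat_diff) (simp add: algebra_simps)
  have pos: "real n - real m > 0" using m n by simp
  have "real (n choose m) = real n * c / (real n - real m)" using b pos by (simp add: field_simps)
  then have "1 / (real m * real (n choose m)) = (real n - real m) / (real m * real n * c)" by simp
  moreover have "1 / (real m * c) - (real n - real m) / (real m * real n * c) = 1 / (real n * c)"
    using m n c by (simp add: divide_simps)
  ultimately have "1 / (real (Suc m) * real (n choose Suc m)) = 1 / (real m * c) - 1 / (real m * real (n choose m))"
    unfolding a by simp
  then have "real Q * (1 / (real (Suc m) * real (n choose Suc m))) = real Q * (1 / (real m * c) - 1 / (real m * real (n choose m)))"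
    by simp
  then have "real Q / (real (Suc m) * real (n choose Suc m)) = real Q / (real m * c) - real Q / (real m * real (n choose m))"
    by (simp add: right_diff_distrib)
  also have "\<dots> \<in> \<int>" using 1 2 by (intro Ints_diff) (simp_all add: c_def)
  finally show ?case .
qed

text \<open>The witness is the least common multiple of 1, ..., n: for each prime p <= n it contains
  the largest power of p not exceeding n, so it is at most n to the number of these primes.\<close>

lemma exists_common_multiple_le_power:
  assumes n: "n \<ge> 1"
  obtains Q :: nat where "Q > 0" "\<And>k. 1 \<le> k \<Longrightarrow> k \<le> n \<Longrightarrow> k dvd Q"
    "Q \<le> n ^ card {p. prime p \<and> p \<le> n}"
proof -
  define P where "P = {p::nat. prime p \<and> p \<le> n}"
  define e where "e p = Max {a. p ^ a \<le> n}" for p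
  define Q where "Q = (\<Prod>p\<in>P. p ^ e p)"
  have finP: "finite P" using finite_primes_upto [of n] by (simp add: P_def)
  have fin: "finite {a. p ^ a \<le> n}" if "p \<in> P" for p
  proof (rule finite_subset)
    have "p \<ge> 2" using that prime_ge_2_nat by (simp add: P_def)
    show "{a. p ^ a \<le> n} \<subseteq> {..n}"
    proof
      fix a assume "a \<in> {a. p ^ a \<le> n}"
      moreover have "a < (2::nat) ^ a" by (rule less_exp)
      moreover have "(2::nat) ^ a \<le> p ^ a" using \<open>p \<ge> 2\<close> by (rule power_mono) simp
      ultimately have "a \<le> n" unfolding mem_Collect_eq by linarith
      then show "a \<in> {..n}" by simp
    qed
  qed simp
  have e: "p ^ e p \<le> n" if "p \<in> P" for p
  proof -
    have "0 \<in> {a. p ^ a \<le> n}" using n by simp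
    then have "Max {a. p ^ a \<le> n} \<in> {a. p ^ a \<le> n}" using fin [OF that] by (intro Max_in) blast+
    then show ?thesis by (simp add: e_def)
  qed
  have "Q > 0" unfolding Q_def by (rule prod_pos) (simp add: P_def prime_gt_0_nat)
  moreover have "k dvd Q" if k: "1 \<le> k" "k \<le> n" for k
  proof -
    have "k = (\<Prod>p\<in>prime_factors k. p ^ multiplicity p k)" using k by (simp add: prod_prime_factors)
    also have "\<dots> dvd (\<Prod>p\<in>prime_factors k. p ^ e p)"
    proof (intro prod_dvd_prod le_imp_power_dvd)
      fix p assume p: "p \<in> prime_factors k"
      then have "p dvd k" by blast
      then have "p \<le> k" using k by (intro dvd_imp_le) auto
      then have "p \<in> P" using p k by (auto simp: P_def)
      moreover have "p ^ multiplicity p k \<le> k" using k by (intro dvd_imp_le multiplicity_dvd) simp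
      ultimately show "multiplicity p k \<le> e p"
        unfolding e_def using fin k by (intro Max_ge) auto
    qed
    also have "\<dots> dvd Q" unfolding Q_def
    proof (rule prod_dvd_prod_subset [OF finP], rule subsetI)
      fix p assume p: "p \<in> prime_factors k"
      then have "p dvd k" by blast
      then have "p \<le> k" using k by (intro dvd_imp_le) auto
      then show "p \<in> P" using p k by (auto simp: P_def)
    qed
    finally show ?thesis .
  qed
  moreover have "Q \<le> (\<Prod>p\<in>P. n)" unfolding Q_def by (rule prod_mono) (use e in auto)
  then have "Q \<le> n ^ card {p. prime p \<and> p \<le> n}" by (simp add: P_def)
  ultimately show thesis by (rule that)
qed

text \<open>For n = M div 2, the number n * (2 n choose n) divides every common multiple of 1, ...,
  2 n, and it is at least 4^n / 2. Comparing with (2 n)^c and taking logarithms gives the bound; M -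
  2 <= 2 n - 1 covers odd \<open>M\<close>.\<close>

lemma card_primes_lower_bound:
  assumes "M \<ge> 2"
  shows "(real M - 2) * ln 2 \<le> real (card {p. prime p \<and> p \<le> M}) * ln (real M)"
proof -
  define n where "n = M div 2"
  define c where "c = card {p. prime p \<and> p \<le> 2 * n}"
  have n: "n \<ge> 1" using assms by (simp add: n_def)
  obtain Q :: nat where Q: "Q > 0" "\<And>k. 1 \<le> k \<Longrightarrow> k \<le> 2 * n \<Longrightarrow> k dvd Q" "Q \<le> (2 * n) ^ c"
    using exists_common_multiple_le_power [of "2 * n"] n unfolding c_def by auto
  define b where "b = real n * real (2 * n choose n)"
  have bpos: "b > 0" using n by (simp add: b_def)
  have "real Q / b \<in> \<int>" unfolding b_def by (rule Leibniz_triangle_integral) (use n Q in auto)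
  moreover have "real Q / b > 0" using bpos Q(1) by simp
  ultimately have "real Q / b \<ge> 1"
    by (metis Ints_cases int_one_le_iff_zero_less of_int_0_less_iff of_int_1_le_iff)
  then have "b \<le> real Q" using bpos by simp
  moreover have "4 ^ n / 2 \<le> b"
    using central_binomial_lower_bound [of n] n by (simp add: b_def field_simps)
  moreover have "real Q \<le> real ((2 * n) ^ c)" using Q(3) by (simp only: of_nat_le_iff)
  ultimately have "4 ^ n / 2 \<le> real (2 * n) ^ c" by simp
  then have "ln (4 ^ n / 2) \<le> ln (real (2 * n) ^ c)" using n by (subst ln_le_cancel_iff) auto
  moreover have "ln (4 ^ n / 2 :: real) = (2 * real n - 1) * ln 2"
  proof -
    have "ln (4::real) = 2 * ln 2" using ln_realpow [of 2 2] by simp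
    then show ?thesis by (simp add: ln_div ln_realpow algebra_simps)
  qed
  ultimately have *: "(2 * real n - 1) * ln 2 \<le> real c * ln (real (2 * n))"
    using n ln_realpow [of "real (2 * n)" c] by linarith
  have "real M \<le> 2 * real n + 1" using of_nat_mono [of M "2 * n + 1", where ?'a = real] by (simp add: n_def)
  then have "(real M - 2) * ln 2 \<le> (2 * real n - 1) * ln 2" by (intro mult_right_mono) auto
  also note *
  also have "real c * ln (real (2 * n)) \<le> real (card {p. prime p \<and> p \<le> M}) * ln (real M)"
  proof (rule mult_mono)
    have "2 * n \<le> M" by (simp add: n_def)
    then show "ln (real (2 * n)) \<le> ln (real M)" using n by (subst ln_le_cancel_iff) auto
    have "finite {p. prime p \<and> p \<le> M}" using finite_primes_upto [of M] by simp
    then have "c \<le> card {p. prime p \<and> p \<le> M}"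
      unfolding c_def using \<open>2 * n \<le> M\<close> by (intro card_mono) auto
    then show "real c \<le> real (card {p. prime p \<and> p \<le> M})" by simp
  qed (use n in auto)
  finally show ?thesis .
qed

section \<open>Fibonacci numbers and their residues\<close>

lemma fib_less_power2: "fib n < 2 ^ n"
  by (induction n rule: fib.induct) auto

lemma fib_strict_mono_ge_2:
  assumes "2 \<le> m" "m < n"
  shows "fib m < fib n"
proof -
  obtain k where k: "m = Suc k" "k > 0" using assms(1) by (cases m) auto
  have "fib m < fib (Suc m)" using fib_neq_0_nat [OF k(2)] by (simp add: k(1))
  also have "\<dots> \<le> fib n" using assms by (intro fib_mono) auto
  finally show ?thesis .
qed

lemma fib_eq_iff_ge_2: "2 \<le> m \<Longrightarrow> 2 \<le> n \<Longrightarrow> fib m = fib n \<longleftrightarrow> m = n"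
  using fib_strict_mono_ge_2 by (metis less_irrefl linorder_neqE_nat)

text \<open>The larger index m satisfies fib m <= n < fib (m + 2), since n <= 2 fib m < fib m + fib
  (m + 1). This leaves two consecutive values of m; a Boolean tells which of the two indices is the
  larger, and the other follows by injectivity from index 2 on.\<close>

lemma card_fib_sum_representations:
  "finite {(a, b). 2 \<le> a \<and> 2 \<le> b \<and> fib a + fib b = n} \<and>
   card {(a, b). 2 \<le> a \<and> 2 \<le> b \<and> fib a + fib b = n} \<le> 4"
proof -
  define S where "S = {(a, b). 2 \<le> a \<and> 2 \<le> b \<and> fib a + fib b = n}"
  define Z where "Z = {m. 2 \<le> m \<and> fib m \<le> n \<and> n < fib (m + 2)}"
  \<comment> \<open>If \<open>Z\<close> is empty, the \<open>LEAST\<close> is unspecified and the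
    inclusion of \<open>Z\<close> in \<open>Z0\<close> is trivial.\<close>
  define Z0 where "Z0 = {LEAST m. m \<in> Z, (LEAST m. m \<in> Z) + 1}"
  have "Z \<subseteq> Z0"
  proof
    fix m assume m: "m \<in> Z"
    define l where "l = (LEAST m. m \<in> Z)"
    have l: "l \<in> Z" "l \<le> m" unfolding l_def using m by (auto intro: LeastI Least_le)
    have "m < l + 2"
    proof (rule ccontr)
      assume "\<not> m < l + 2"
      then have "fib (l + 2) \<le> fib m" by (intro fib_mono) auto
      with m l show False by (simp add: Z_def)
    qed
    with l show "m \<in> Z0" by (auto simp: Z0_def l_def)
  qed
  have mem: "m \<in> Z" if "2 \<le> m" "2 \<le> k" "k \<le> m" "fib m + fib k = n" for m k
  proof -
    have "fib k \<le> fib m" "fib m < fib (m + 1)"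
      using that fib_mono fib_strict_mono_ge_2 [of m "m + 1"] by auto
    then show ?thesis using that by (simp add: Z_def fib_plus_2)
  qed
  have sub: "(\<lambda>(a, b). (max a b, b \<le> a)) ` S \<subseteq> Z0 \<times> (UNIV :: bool set)"
  proof
    fix x assume "x \<in> (\<lambda>(a, b). (max a b, b \<le> a)) ` S"
    then obtain a b where ab: "(a, b) \<in> S" "x = (max a b, b \<le> a)" by auto
    have "max a b \<in> Z"
      using ab(1) mem [of a b] mem [of b a] by (cases "b \<le> a") (auto simp: S_def max_def add.commute)
    with \<open>Z \<subseteq> Z0\<close> ab(2) show "x \<in> Z0 \<times> UNIV" by auto
  qed
  have inj: "inj_on (\<lambda>(a, b). (max a b, b \<le> a)) S"
  proof (rule inj_onI, clarify)
    fix a b c d assume ab: "(a, b) \<in> S" and cd: "(c, d) \<in> S" and m: "max a b = max c d" "b \<le> a \<longleftrightarrow> d \<le> c"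
    show "a = c \<and> b = d"
    proof (cases "b \<le> a")
      case True
      then have "a = c" using m by (simp add: max_def)
      moreover from this have "fib b = fib d" using ab cd by (simp add: S_def)
      ultimately show ?thesis using ab cd by (simp add: S_def fib_eq_iff_ge_2)
    next
      case False
      then have "b = d" using m by (simp add: max_def)
      moreover from this have "fib a = fib c" using ab cd by (simp add: S_def)
      ultimately show ?thesis using ab cd by (simp add: S_def fib_eq_iff_ge_2)
    qed
  qed
  have fin: "finite (Z0 \<times> (UNIV :: bool set))" by (simp add: Z0_def)
  have "card S \<le> card (Z0 \<times> (UNIV :: bool set))" by (rule card_inj_on_le [OF inj sub fin])
  also have "\<dots> \<le> 4" unfolding card_cartesian_product Z0_def by (simp add: card_insert_if)
  finally have "card S \<le> 4" .
  moreover have "finite S" using inj_on_finite [OF inj sub fin] .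
  ultimately show ?thesis by (simp add: S_def)
qed

section \<open>Periods of the Fibonacci sequence\<close>

text \<open>Compares two states of the recurrence modulo \<open>m\<close>. The recurrence is
  reversible, so a state determines the sequence in both directions and shifting both indices
  preserves the relation.\<close>

definition fib_pair_cong :: "nat \<Rightarrow> nat \<Rightarrow> nat \<Rightarrow> bool" where
  "fib_pair_cong m i j \<longleftrightarrow> [fib i = fib j] (mod m) \<and> [fib (Suc i) = fib (Suc j)] (mod m)"

lemma fib_pair_cong_sym: "fib_pair_cong m i j \<Longrightarrow> fib_pair_cong m j i"
  by (simp add: fib_pair_cong_def cong_sym)

lemma fib_pair_cong_trans: "fib_pair_cong m i j \<Longrightarrow> fib_pair_cong m j k \<Longrightarrow> fib_pair_cong m i k"
  unfolding fib_pair_cong_def by (meson cong_trans)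

lemma fib_pair_cong_Suc_iff: "fib_pair_cong m (Suc i) (Suc j) \<longleftrightarrow> fib_pair_cong m i j"
proof
  assume "fib_pair_cong m (Suc i) (Suc j)"
  then have 1: "[fib (Suc i) = fib (Suc j)] (mod m)" and 2: "[fib (Suc i) + fib i = fib (Suc j) + fib j] (mod m)"
    by (simp_all add: fib_pair_cong_def)
  have "[fib (Suc j) + fib i = fib (Suc i) + fib i] (mod m)" using 1 by (intro cong_add cong_refl) (rule cong_sym)
  then have "[fib (Suc j) + fib i = fib (Suc j) + fib j] (mod m)" using 2 by (rule cong_trans)
  then have "[fib i = fib j] (mod m)" by (simp add: cong_add_lcancel_nat)
  with 1 show "fib_pair_cong m i j" by (simp add: fib_pair_cong_def)
next
  assume "fib_pair_cong m i j"
  then show "fib_pair_cong m (Suc i) (Suc j)" by (simp add: fib_pair_cong_def cong_add)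
qed

lemma fib_pair_cong_add_iff: "fib_pair_cong m n (n + d) \<longleftrightarrow> fib_pair_cong m 0 d"
  by (induction n) (simp_all add: fib_pair_cong_Suc_iff)

text \<open>The Pisano period.\<close>

definition fib_period :: "nat \<Rightarrow> nat" where
  "fib_period m = (LEAST T. T > 0 \<and> fib_pair_cong m 0 T)"

text \<open>Two of the states must agree by the pigeonhole principle, and reversibility shifts the
  agreement back to index 0.\<close>

lemma fib_period:
  assumes "m > 0"
  shows "fib_period m > 0" "fib_pair_cong m 0 (fib_period m)"
proof -
  define f where "f i = (fib i mod m, fib (Suc i) mod m)" for i
  have "range f \<subseteq> {..<m} \<times> {..<m}" using assms by (auto simp: f_def)
  then have "finite (range f)" by (rule finite_subset) simp
  then have "\<not> inj f" using finite_imageD by blast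
  then obtain i j where ij: "i < j" "f i = f j" by (metis injI linorder_neqE_nat)
  then have "fib_pair_cong m i (i + (j - i))" by (simp add: f_def fib_pair_cong_def cong_def)
  then have "fib_pair_cong m 0 (j - i)" by (simp only: fib_pair_cong_add_iff)
  with ij(1) have "j - i > 0 \<and> fib_pair_cong m 0 (j - i)" by simp
  then have "fib_period m > 0 \<and> fib_pair_cong m 0 (fib_period m)" unfolding fib_period_def by (rule LeastI)
  then show "fib_period m > 0" "fib_pair_cong m 0 (fib_period m)" by auto
qed

text \<open>The difference d of the indices returns the sequence to its initial state, hence so does
  d mod T; minimality of the period T forces d mod T = 0.\<close>

lemma fib_pair_cong_imp_cong_period:
  assumes m: "m > 0" and ij: "fib_pair_cong m i j"
  shows "i mod fib_period m = j mod fib_period m"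
proof -
  define T where "T = fib_period m"
  have main: "i mod T = j mod T" if ij: "fib_pair_cong m i j" "i \<le> j" for i j
  proof -
    define d where "d = j - i"
    have d: "fib_pair_cong m 0 d" using ij fib_pair_cong_add_iff [of m i d] by (simp add: d_def)
    have mult: "fib_pair_cong m n (n + k * T)" for n k
    proof (induction k)
      case (Suc k)
      have "fib_pair_cong m (n + k * T) (n + k * T + T)"
        using fib_period(2) [OF m] by (simp add: fib_pair_cong_add_iff T_def)
      with Suc show ?case by (metis add.assoc add.commute fib_pair_cong_trans mult_Suc)
    qed (simp add: fib_pair_cong_def)
    have "fib_pair_cong m (d mod T) d" using mult [of "d mod T" "d div T"] by simp
    then have "fib_pair_cong m 0 (d mod T)" using d fib_pair_cong_sym fib_pair_cong_trans by blast
    moreover have "d mod T < T" using fib_period(1) [OF m] by (simp add: T_def)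
    moreover have "T \<le> d mod T" if "d mod T > 0"
    proof -
      have "(LEAST T. T > 0 \<and> fib_pair_cong m 0 T) \<le> d mod T"
        by (rule Least_le) (use that \<open>fib_pair_cong m 0 (d mod T)\<close> in blast)
      then show ?thesis by (simp only: T_def fib_period_def)
    qed
    ultimately have "d mod T = 0" by linarith
    then have "T dvd j - i" by (simp add: d_def dvd_eq_mod_eq_0)
    then have "j mod T = i mod T" using ij(2) by (simp add: mod_eq_dvd_iff_nat)
    then show ?thesis by simp
  qed
  show ?thesis
    using main [of i j] main [of j i] ij fib_pair_cong_sym [OF ij] unfolding T_def by (metis linear)
qed

lemma prime_dvd_fib_period:
  assumes "prime p"
  shows "p dvd fib (fib_period p)"
  using fib_period(2) [of p] assms by (auto simp: fib_pair_cong_def cong_def dvd_eq_mod_eq_0 prime_gt_0_nat)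

text \<open>If a is a root, subtracting the two congruences gives (y - a) (y + a - c) divisible by
  p, so any other root is c - a.\<close>

lemma card_quadratic_roots_le_2:
  fixes p :: nat and c d :: int
  assumes p: "prime p"
  shows "card {y\<in>{..<p}. int p dvd (int y)\<^sup>2 - c * int y - d} \<le> 2"
proof (cases "{y\<in>{..<p}. int p dvd (int y)\<^sup>2 - c * int y - d} = {}")
  case False
  define Y where "Y = {y\<in>{..<p}. int p dvd (int y)\<^sup>2 - c * int y - d}"
  from False obtain a where a: "a \<in> Y" by (auto simp: Y_def)
  define b where "b = nat ((c - int a) mod int p)"
  have p0: "int p > 0" using p by (simp add: prime_gt_0_nat)
  have "Y \<subseteq> {a, b}"
  proof
    fix y assume y: "y \<in> Y"
    have "int p dvd ((int y)\<^sup>2 - c * int y - d) - ((int a)\<^sup>2 - c * int a - d)"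
      by (rule dvd_diff) (use a y in \<open>simp_all add: Y_def\<close>)
    also have "\<dots> = (int y - int a) * (int y + int a - c)"
      by (simp add: algebra_simps power2_eq_square)
    finally have "int p dvd int y - int a \<or> int p dvd int y + int a - c"
      using p by (simp add: prime_dvd_mult_iff)
    then show "y \<in> {a, b}"
    proof
      assume "int p dvd int y - int a"
      then have "int y mod int p = int a mod int p" by (simp add: mod_eq_dvd_iff)
      then show ?thesis using a y by (simp add: Y_def)
    next
      assume "int p dvd int y + int a - c"
      then have "int y mod int p = (c - int a) mod int p" by (simp add: mod_eq_dvd_iff algebra_simps)
      then have "int y = (c - int a) mod int p" using y by (simp add: Y_def)
      then have "y = b" by (metis b_def nat_int)
      then show ?thesis by simp
    qed
  qed
  then have "card Y \<le> card {a, b}" by (intro card_mono) auto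
  also have "\<dots> \<le> 2" by (simp add: card_insert_if)
  finally show ?thesis by (simp add: Y_def)
next
  case True
  then show ?thesis by (simp only: card.empty)
qed

text \<open>
  By Cassini's identity, the residue of \<open>fib i\<close> modulo a prime leaves at most four
  possibilities for that of \<open>fib (i + 1)\<close>, and the two together determine \<open>i\<close> modulo the period.
\<close>

lemma card_fib_residue_le:
  fixes c :: int
  assumes p: "prime p" and A: "finite A" and B: "\<And>r. card {q\<in>A. q mod fib_period p = r} \<le> B"
  shows "card {q\<in>A. [int (fib q) = c] (mod int p)} \<le> 4 * B"
proof -
  \<comment> \<open>With the sign \<open>s = (- 1) ^ q\<close> of Cassini's identity, the residue of
    \<open>fib (Suc q)\<close> lies in \<open>Y s\<close>. Two signs with at most two roots each
    make the factor 4.\<close>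
  define Y where "Y s = {y\<in>{..<p}. int p dvd (int y)\<^sup>2 - c * int y - (c\<^sup>2 + s)}" for s :: int
  define S where "S y = {q\<in>A. [int (fib q) = c] (mod int p) \<and> fib (Suc q) mod p = y}" for y
  have p0: "p > 0" using p by (rule prime_gt_0_nat)
  have "{q\<in>A. [int (fib q) = c] (mod int p)} \<subseteq> (\<Union>y\<in>Y 1 \<union> Y (-1). S y)"
  proof
    fix q assume q: "q \<in> {q\<in>A. [int (fib q) = c] (mod int p)}"
    define y where "y = fib (Suc q) mod p"
    define s where "s = (-1::int) ^ q"
    have s: "s = 1 \<or> s = -1" unfolding s_def by (cases "even q") auto
    have yc: "[int y = int (fib (Suc q))] (mod int p)" by (simp add: y_def cong_def zmod_int)
    have "(int (fib (Suc q)))\<^sup>2 - int (fib q) * int (fib (Suc q)) - ((int (fib q))\<^sup>2 + s) = 0"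
      using fib_Cassini_int [of q] by (simp add: s_def power2_eq_square algebra_simps)
    moreover have "[(int y)\<^sup>2 - c * int y - (c\<^sup>2 + s) =
       (int (fib (Suc q)))\<^sup>2 - int (fib q) * int (fib (Suc q)) - ((int (fib q))\<^sup>2 + s)] (mod int p)"
      using yc q by (intro cong_diff cong_mult cong_pow cong_add cong_refl) (auto intro: cong_sym)
    ultimately have "int p dvd (int y)\<^sup>2 - c * int y - (c\<^sup>2 + s)" by (simp add: cong_0_iff)
    then have "y \<in> Y s" using p0 by (simp add: Y_def y_def)
    with s have "y \<in> Y 1 \<union> Y (-1)" by auto
    moreover have "q \<in> S y" using q by (simp add: S_def y_def)
    ultimately show "q \<in> (\<Union>y\<in>Y 1 \<union> Y (-1). S y)" by blast
  qed
  then have "card {q\<in>A. [int (fib q) = c] (mod int p)} \<le> card (\<Union>y\<in>Y 1 \<union> Y (-1). S y)"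
    using A by (intro card_mono) (auto simp: S_def Y_def)
  also have "\<dots> \<le> (\<Sum>y\<in>Y 1 \<union> Y (-1). card (S y))"
    by (rule card_UN_le) (simp add: Y_def)
  also have "\<dots> \<le> (\<Sum>y\<in>Y 1 \<union> Y (-1). B)"
  proof (rule sum_mono)
    fix y
    show "card (S y) \<le> B"
    proof (cases "S y = {}")
      case False
      then obtain a where a: "a \<in> S y" by blast
      have "S y \<subseteq> {q\<in>A. q mod fib_period p = a mod fib_period p}"
      proof
        fix q assume q: "q \<in> S y"
        have "[int (fib q) = int (fib a)] (mod int p)"
          using a q by (auto simp: S_def intro: cong_trans cong_sym)
        then have "fib_pair_cong p q a" using a q by (simp add: fib_pair_cong_def S_def cong_int_iff, simp add: cong_def)
        then show "q \<in> {q\<in>A. q mod fib_period p = a mod fib_period p}"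
          using q fib_pair_cong_imp_cong_period [OF p0] by (simp add: S_def)
      qed
      then have "card (S y) \<le> card {q\<in>A. q mod fib_period p = a mod fib_period p}"
        using A by (intro card_mono) auto
      also have "\<dots> \<le> B" by (rule B)
      finally show ?thesis .
    qed simp
  qed
  also have "\<dots> = card (Y 1 \<union> Y (-1)) * B" by simp
  also have "card (Y 1 \<union> Y (-1)) \<le> card (Y 1) + card (Y (-1))" by (rule card_Un_le)
  also have "\<dots> \<le> 2 + 2" unfolding Y_def by (intro add_mono card_quadratic_roots_le_2 p)
  finally show ?thesis by simp
qed

lemma card_prime_factors_le:
  fixes n a :: nat
  assumes "n > 0" "n \<le> 2 ^ a"
  shows "card (prime_factors n) \<le> a"
proof -
  have "(2::nat) ^ card (prime_factors n) = (\<Prod>p\<in>prime_factors n. 2)" by simp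
  also have "\<dots> \<le> \<Prod>(prime_factors n)"
    by (rule prod_mono) (auto intro: prime_ge_2_nat)
  also have "\<dots> \<le> n" using assms(1) by (intro dvd_imp_le prod_prime_factors_dvd)
  also note assms(2)
  finally show ?thesis by simp
qed

section \<open>Asymptotic forms of the sieve bounds\<close>

lemma card_residue_class_le: "card {q\<in>A. q \<le> L \<and> q mod T = r} \<le> L div T + 1" for T L :: nat
proof -
  have "card {q\<in>A. q \<le> L \<and> q mod T = r} \<le> card {..L div T}"
  proof (rule card_inj_on_le)
    show "inj_on (\<lambda>q. q div T) {q\<in>A. q \<le> L \<and> q mod T = r}"
    proof (rule inj_onI)
      fix x y assume "x \<in> {q\<in>A. q \<le> L \<and> q mod T = r}" "y \<in> {q\<in>A. q \<le> L \<and> q mod T = r}"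
        and "x div T = y div T"
      then have "x div T * T + x mod T = y div T * T + y mod T" by simp
      then show "x = y" by (simp only: div_mult_mod_eq)
    qed
    show "(\<lambda>q. q div T) ` {q\<in>A. q \<le> L \<and> q mod T = r} \<subseteq> {..L div T}"
      by (auto intro: div_le_mono)
  qed simp
  then show ?thesis by simp
qed

text \<open>For T up to sqrt L the sieve is applied with z near L^(1/16); the constant is 128 = 2 *
  2 * 32, from L / T + 1 <= 2 L / T, from \<open>euler_ratio_le_sqrt\<close> and from ln z >= (ln L)
  / 32. For larger T the trivial count is at most sqrt L + 1. The summand L^(-1/4) absorbs this
  count and the sieve errors, so the bound is uniform in T and r.\<close>

lemma card_primes_residue_class_bound:
  "\<forall>\<^sub>F L in sequentially. \<forall>T>0. \<forall>r. real (card {q. prime q \<and> q \<le> L \<and> q mod T = r})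
      \<le> 128 * (real L / ln (real L)) * (1 / sqrt (real T) + real L powr (-1/4))"
proof -
  have e1: "\<forall>\<^sub>F n::nat in sequentially. 2 \<le> real n powr (1/32)" by real_asymp
  have e2: "\<forall>\<^sub>F n::nat in sequentially. 2 * real n powr (1/4) \<le> real n / ln (real n) * real n powr (-1/4)"
    by real_asymp
  have e3: "\<forall>\<^sub>F n::nat in sequentially. sqrt (real n) + 1 \<le> real n / ln (real n) * real n powr (-1/4)"
    by real_asymp
  have e4: "\<forall>\<^sub>F n::nat in sequentially. 3 \<le> n" by (rule eventually_ge_at_top)
  show ?thesis using e1 e2 e3 e4
  proof (eventually_elim, intro allI impI)
    fix L T r :: nat
    assume 1: "2 \<le> real L powr (1/32)"
      and 2: "2 * real L powr (1/4) \<le> real L / ln (real L) * real L powr (-1/4)"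
      and 3: "sqrt (real L) + 1 \<le> real L / ln (real L) * real L powr (-1/4)"
      and L: "3 \<le> L" and T: "T > 0"
    define c where "c = card {q. prime q \<and> q \<le> L \<and> q mod T = r}"
    define W where "W = real L / ln (real L)"
    have lnL: "ln (real L) > 0" using L by simp
    have W: "W > 0" using L by (simp add: W_def)
    show "real c \<le> 128 * W * (1 / sqrt (real T) + real L powr (-1/4))"
    proof (cases "real T \<le> sqrt (real L)")
      case True
      \<comment> \<open>The integer \<open>z\<close> lies between v and v^2. The lower end gives ln
        z >= (ln L) / 32, the upper end gives z^4 <= v^8 = L^(1/4).\<close>
      define v where "v = real L powr (1/32)"
      define z where "z = nat \<lfloor>v\<^sup>2\<rfloor>"
      have v: "v \<ge> 2" using 1 by (simp add: v_def)
      have z_le: "real z \<le> v\<^sup>2" unfolding z_def by (rule of_nat_floor) simp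
      have "v\<^sup>2 < real z + 1" unfolding z_def by linarith
      moreover have "v + 1 \<le> v\<^sup>2"
      proof -
        have "2 * v \<le> v * v" using v by (intro mult_right_mono) auto
        then show ?thesis using v unfolding power2_eq_square by linarith
      qed
      ultimately have zv: "v \<le> real z" by simp
      then have z2: "2 \<le> z" using v by linarith
      have "ln v \<le> ln (real z)" using zv v z2 by (subst ln_le_cancel_iff) auto
      then have lnz: "ln (real L) / 32 \<le> ln (real z)" using L by (simp add: v_def ln_powr)
      have "real z ^ 4 \<le> (v\<^sup>2) ^ 4" using z_le by (intro power_mono) auto
      also have "\<dots> = v ^ 8" by (simp flip: power_mult)
      also have "\<dots> = real L powr (1/4)" using L by (simp add: v_def powr_power)
      finally have z4: "real z ^ 4 \<le> real L powr (1/4)" .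
      have "real z ^ 1 \<le> real z ^ 4" using z2 by (intro power_increasing) auto
      then have z1: "real z \<le> real L powr (1/4)" unfolding power_one_right using z4 by linarith
      have "1 \<le> sqrt (real L)" using L by simp
      then have "sqrt (real L) * 1 \<le> sqrt (real L) * sqrt (real L)" by (intro mult_left_mono) auto
      then have "real T \<le> real L" using True by simp
      then have LT: "real L / real T + 1 \<le> 2 * real L / real T" using T by (simp add: field_simps)
      have "real c \<le> real z + (real L / real T + 1) * euler_ratio T / ln (real z) + real z ^ 4"
        unfolding c_def by (rule card_primes_residue_class_sieve [OF T z2])
      also have "(real L / real T + 1) * euler_ratio T / ln (real z) \<le> (2 * real L / real T) * (2 * sqrt (real T)) / (ln (real L) / 32)"
        using LT euler_ratio_le_sqrt [OF T] lnz lnL T euler_ratio_pos [of T] by (intro frac_le mult_mono) auto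
      also have "\<dots> = 128 * W * (1 / sqrt (real T))"
      proof -
        define s where "s = sqrt (real T)"
        have s: "real T = s * s" "s > 0" using T by (simp_all add: s_def)
        show ?thesis unfolding s_def [symmetric] s(1) using s(2) by (simp add: W_def field_simps)
      qed
      also have "real z + 128 * W * (1 / sqrt (real T)) + real z ^ 4 \<le> 128 * W * (1 / sqrt (real T)) + W * real L powr (-1/4)"
        using z1 z4 2 unfolding W_def by linarith
      also have "\<dots> \<le> 128 * W * (1 / sqrt (real T)) + 128 * W * real L powr (-1/4)"
        using W by (intro add_left_mono mult_right_mono) auto
      finally show ?thesis by (simp add: distrib_left)
    next
      case False
      have "c \<le> L div T + 1"
        unfolding c_def using card_residue_class_le [of "{q. prime q}" L T r] by simp
      moreover have "real (L div T) \<le> sqrt (real L)"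
      proof -
        have "L div T * T \<le> L" by simp
        then have "real (L div T) * real T \<le> real L" by (simp only: of_nat_mult [symmetric] of_nat_le_iff)
        moreover have "real (L div T) * sqrt (real L) \<le> real (L div T) * real T"
          using False by (intro mult_left_mono) auto
        ultimately have "real (L div T) * sqrt (real L) \<le> sqrt (real L) * sqrt (real L)" by simp
        then show ?thesis by (rule mult_right_le_imp_le) (use L in auto)
      qed
      ultimately have "real c \<le> sqrt (real L) + 1" by linarith
      also have "\<dots> \<le> W * real L powr (-1/4)" using 3 by (simp add: W_def)
      also have "\<dots> \<le> 128 * W * (1 / sqrt (real T) + real L powr (-1/4))"
      proof -
        have "0 \<le> 128 * W * (1 / sqrt (real T))" "0 \<le> 127 * (W * real L powr (-1/4))" using W by auto
        then show ?thesis by (simp add: distrib_left)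
      qed
      finally show ?thesis .
    qed
  qed
qed

lemma card_primes_upper_bound:
  "\<forall>\<^sub>F L in sequentially. real (card {q. prime q \<and> q \<le> L}) \<le> 256 * (real L / ln (real L))"
proof -
  have e: "\<forall>\<^sub>F n::nat in sequentially. real n powr (-1/4) \<le> 1" by real_asymp
  have e4: "\<forall>\<^sub>F n::nat in sequentially. 3 \<le> n" by (rule eventually_ge_at_top)
  show ?thesis using card_primes_residue_class_bound e e4
  proof eventually_elim
    case (elim L)
    define W where "W = real L / ln (real L)"
    have W: "W > 0" using elim by (simp add: W_def)
    have "real (card {q. prime q \<and> q \<le> L}) \<le> 128 * W * (1 / sqrt (real 1) + real L powr (-1/4))"
      using elim(1) [rule_format, of 1 0] by (simp add: W_def)
    also have "\<dots> \<le> 128 * W * 2" using W elim(2) by (intro mult_left_mono) auto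
    finally show ?case by (simp add: W_def)
  qed
qed

text \<open>For a period T with p <= T^4 the saving T^(-1/2) is at most p^(-1/8), and p <= L bounds
  L^(-1/4) likewise. So each class has at most 256 W p^(-1/8) primes, and the four classes of
  \<open>card_fib_residue_le\<close> make 1024.\<close>

lemma card_primes_fib_residue_bound:
  "\<forall>\<^sub>F L in sequentially. \<forall>p. prime p \<longrightarrow> p \<le> L \<longrightarrow> p \<le> fib_period p ^ 4 \<longrightarrow>
     (\<forall>c. real (card {q. prime q \<and> q \<le> L \<and> [int (fib q) = c] (mod int p)})
        \<le> 1024 * (real L / ln (real L)) * real p powr (-1/8))"
proof -
  have e4: "\<forall>\<^sub>F n::nat in sequentially. 3 \<le> n" by (rule eventually_ge_at_top)
  show ?thesis using card_primes_residue_class_bound e4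
  proof (eventually_elim, intro allI impI)
    fix L p :: nat and c :: int
    assume BT: "\<forall>T>0. \<forall>r. real (card {q. prime q \<and> q \<le> L \<and> q mod T = r})
      \<le> 128 * (real L / ln (real L)) * (1 / sqrt (real T) + real L powr (-1/4))"
      and L: "3 \<le> L" and p: "prime p" "p \<le> L" "p \<le> fib_period p ^ 4"
    define A where "A = {q. prime q \<and> q \<le> L}"
    define T where "T = fib_period p"
    define W where "W = real L / ln (real L)"
    define B where "B = nat \<lfloor>256 * W * real p powr (-1/8)\<rfloor>"
    have W: "W > 0" using L by (simp add: W_def)
    have p0: "p > 0" using p(1) by (rule prime_gt_0_nat)
    have T: "T > 0" unfolding T_def by (rule fib_period(1) [OF p0])
    have finA: "finite A" using finite_primes_upto [of L] by (simp add: A_def)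
    have "card {q\<in>A. q mod T = r} \<le> B" for r
    proof -
      have eq: "{q\<in>A. q mod T = r} = {q. prime q \<and> q \<le> L \<and> q mod T = r}" by (auto simp: A_def)
      have "real (card {q\<in>A. q mod T = r}) \<le> 128 * W * (1 / sqrt (real T) + real L powr (-1/4))"
        unfolding eq W_def using BT T by blast
      also have "\<dots> \<le> 128 * W * (real p powr (-1/8) + real p powr (-1/8))"
      proof (intro mult_left_mono add_mono)
        have "real p \<le> real (T ^ 4)" using p(3) unfolding T_def by (simp only: of_nat_le_iff)
        then have "real p \<le> real T powr 4" using T by (simp add: powr_numeral)
        then have "real p powr (1/8) \<le> (real T powr 4) powr (1/8)" by (intro powr_mono2) auto
        also have "\<dots> = real T powr (1/2)" unfolding powr_powr by simp
        also have "\<dots> = sqrt (real T)" by (simp add: powr_half_sqrt)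
        finally have "1 / sqrt (real T) \<le> 1 / real p powr (1/8)" using p0 T by (intro divide_left_mono mult_pos_pos) auto
        then show "1 / sqrt (real T) \<le> real p powr (-1/8)" by (simp add: powr_minus_divide)
        have "real L powr (-1/4) \<le> real p powr (-1/4)" using p(2) p0 by (intro powr_mono2') auto
        also have "\<dots> \<le> real p powr (-1/8)" using p0 by (intro powr_mono) auto
        finally show "real L powr (-1/4) \<le> real p powr (-1/8)" .
      qed (use W in auto)
      finally show ?thesis unfolding B_def by (simp add: le_nat_floor)
    qed
    then have "card {q\<in>A. [int (fib q) = c] (mod int p)} \<le> 4 * B"
      unfolding T_def by (intro card_fib_residue_le p(1) finA)
    moreover have "{q\<in>A. [int (fib q) = c] (mod int p)} = {q. prime q \<and> q \<le> L \<and> [int (fib q) = c] (mod int p)}"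
      by (auto simp: A_def)
    ultimately have "card {q. prime q \<and> q \<le> L \<and> [int (fib q) = c] (mod int p)} \<le> 4 * B" by simp
    moreover have "real B \<le> 256 * W * real p powr (-1/8)"
      unfolding B_def using W by (intro of_nat_floor) auto
    ultimately show "real (card {q. prime q \<and> q \<le> L \<and> [int (fib q) = c] (mod int p)}) \<le> 1024 * (real L / ln (real L)) * real p powr (-1/8)"
      unfolding W_def by linarith
  qed
qed

section \<open>Sums and products over all primes up to y\<close>

lemma harm_le: "n \<ge> 1 \<Longrightarrow> harm n \<le> 1 + ln (real n)"
proof -
  assume "n \<ge> 1"
  then obtain m where m: "n = Suc m" by (cases n) auto
  have "harm (Suc m) - ln (real (Suc m)) \<le> harm (Suc 0) - ln (real (Suc 0))"
    using decseqD [OF decseq_harm_diff_ln, of 0 m] by simp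
  then show ?thesis unfolding m by (simp add: harm_expand)
qed

text \<open>
  Where \<open>\<pi>(p) \<le> \<epsilon> p\<close>, the sum of \<open>1/p\<close> is compared with \<open>\<epsilon>\<close> times the harmonic sum over the
  indices \<open>\<pi>(p)\<close>. This cheap substitute for Mertens' theorem is enough, because any small power
  of \<open>y\<close> is acceptable below.
\<close>

lemma sum_inverse_primes_le:
  fixes \<epsilon> :: real
  assumes "\<epsilon> > 0"
  obtains C where "\<And>y. y \<ge> 1 \<Longrightarrow> (\<Sum>p | prime p \<and> p \<le> y. 1 / real p) \<le> C + \<epsilon> * ln (real y)"
proof -
  define \<pi> where "\<pi> y = card {q::nat. prime q \<and> q \<le> y}" for y :: nat
  have fin: "finite {q::nat. prime q \<and> q \<le> y}" for y using finite_primes_upto [of y] by simp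
  have "\<forall>\<^sub>F L::nat in sequentially. 256 * (real L / ln (real L)) \<le> \<epsilon> * real L"
    using assms by real_asymp
  then have "\<forall>\<^sub>F L in sequentially. real (\<pi> L) \<le> \<epsilon> * real L"
    using card_primes_upper_bound unfolding \<pi>_def by eventually_elim linarith
  then obtain Y where Y: "\<And>L. L \<ge> Y \<Longrightarrow> real (\<pi> L) \<le> \<epsilon> * real L"
    by (auto simp: eventually_sequentially)
  \<comment> \<open>The primes below \<open>Y\<close> contribute at most 1 each; the additional
    \<epsilon> comes from bounding the harmonic sum by 1 + ln y.\<close>
  have "(\<Sum>p | prime p \<and> p \<le> y. 1 / real p) \<le> (real Y + \<epsilon>) + \<epsilon> * ln (real y)" if y: "y \<ge> 1" for y :: nat
  proof -
    define A where "A = {p::nat. prime p \<and> p \<le> y \<and> Y \<le> p}"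
    have finA: "finite A" unfolding A_def by (rule finite_primes_le)
    have mono: "\<pi> p < \<pi> q" if "p < q" "prime q" for p q
    proof -
      have "q \<in> {r. prime r \<and> r \<le> q}" "q \<notin> {r. prime r \<and> r \<le> p}" using that by auto
      moreover have "{r. prime r \<and> r \<le> p} \<subseteq> {r. prime r \<and> r \<le> q}" using that by auto
      ultimately show ?thesis unfolding \<pi>_def by (intro psubset_card_mono fin) blast
    qed
    have "inj_on \<pi> A"
    proof (rule inj_onI)
      fix p q assume "p \<in> A" "q \<in> A" "\<pi> p = \<pi> q"
      then show "p = q" using mono [of p q] mono [of q p] by (cases p q rule: linorder_cases) (auto simp: A_def)
    qed
    have \<pi>1: "\<pi> p \<ge> 1" if "prime p" for p
      using mono [of 0 p] that by (simp add: prime_gt_0_nat)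
    have \<pi>y: "\<pi> p \<le> y" if "p \<in> A" for p
    proof -
      have "\<pi> p \<le> card {1..p}" unfolding \<pi>_def
        by (rule card_mono) (auto simp: Suc_le_eq prime_gt_0_nat)
      then show ?thesis using that by (simp add: A_def)
    qed
    have "{p. prime p \<and> p \<le> y} \<subseteq> {p. prime p \<and> p < Y} \<union> A" by (auto simp: A_def)
    moreover have finY: "finite {p::nat. prime p \<and> p < Y}" by (rule finite_subset [of _ "{..<Y}"]) auto
    ultimately have "(\<Sum>p | prime p \<and> p \<le> y. 1 / real p) \<le> (\<Sum>p\<in>{p. prime p \<and> p < Y} \<union> A. 1 / real p)"
      using finA by (intro sum_mono2) auto
    also have "\<dots> = (\<Sum>p\<in>{p. prime p \<and> p < Y}. 1 / real p) + (\<Sum>p\<in>A. 1 / real p)"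
      using finY finA by (intro sum.union_disjoint) (auto simp: A_def)
    also have "(\<Sum>p\<in>{p. prime p \<and> p < Y}. 1 / real p) \<le> (\<Sum>p\<in>{..<Y}. 1)"
    proof (rule sum_le_included [where i = id])
      show "\<forall>p\<in>{p. prime p \<and> p < Y}. \<exists>q\<in>{..<Y}. id q = p \<and> 1 / real p \<le> 1"
        by (auto simp: prime_gt_0_nat Suc_le_eq)
    qed (use finY in auto)
    also have "(\<Sum>p\<in>A. 1 / real p) \<le> (\<Sum>p\<in>A. \<epsilon> * (1 / real (\<pi> p)))"
    proof (rule sum_mono)
      fix p assume p: "p \<in> A"
      then have "real (\<pi> p) \<le> \<epsilon> * real p" "\<pi> p \<ge> 1" "p > 0" using Y \<pi>1 by (auto simp: A_def prime_gt_0_nat)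
      then show "1 / real p \<le> \<epsilon> * (1 / real (\<pi> p))" by (simp add: field_simps)
    qed
    also have "\<dots> = \<epsilon> * (\<Sum>i\<in>\<pi> ` A. 1 / real i)"
      unfolding sum.reindex [OF \<open>inj_on \<pi> A\<close>] o_def sum_distrib_left ..
    also have "\<dots> \<le> \<epsilon> * (\<Sum>i\<in>{1..y}. 1 / real i)"
    proof (intro mult_left_mono sum_mono2)
      show "\<pi> ` A \<subseteq> {1..y}" using \<pi>1 \<pi>y by (auto simp: A_def)
    qed (use assms in auto)
    also have "(\<Sum>i\<in>{1..y}. 1 / real i) = harm y" by (simp add: harm_def inverse_eq_divide)
    also have "\<epsilon> * harm y \<le> \<epsilon> * (1 + ln (real y))" using assms harm_le [OF y] by (intro mult_left_mono) auto
    finally show ?thesis by (simp add: distrib_left)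
  qed
  then show thesis by (rule that)
qed

lemma Euler_factor_le:
  assumes "prime p"
  shows "(real p / (real p - 1))\<^sup>2 \<le> 1 + 8 / real p" "(real p / (real p - 1))\<^sup>2 \<ge> 1"
proof -
  have p2: "real p \<ge> 2" by (rule real_prime_ge_2 [OF assms])
  define x where "x = real p - 1"
  have x: "x \<ge> 1" using p2 by (simp add: x_def)
  have "(x + 1) ^ 3 \<le> (x + 9) * x\<^sup>2"
  proof -
    have "1 * 1 \<le> x * x" using x by (intro mult_mono) auto
    then have "0 \<le> 3 * x * (x - 1) + 3 * (x * x - 1) + 2"
      using x by (intro add_nonneg_nonneg mult_nonneg_nonneg) auto
    also have "\<dots> = (x + 9) * x\<^sup>2 - (x + 1) ^ 3"
      by (simp add: power2_eq_square power3_eq_cube algebra_simps)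
    finally show ?thesis by simp
  qed
  then have "((x + 1) / x)\<^sup>2 \<le> (x + 9) / (x + 1)"
    using x by (simp add: power_divide divide_simps power2_eq_square power3_eq_cube mult.assoc)
  also have "(x + 9) / (x + 1) = 1 + 8 / (x + 1)" using x by (simp add: field_simps)
  finally show "(real p / (real p - 1))\<^sup>2 \<le> 1 + 8 / real p" by (simp add: x_def)
  show "(real p / (real p - 1))\<^sup>2 \<ge> 1" using p2 by (intro one_le_power) simp
qed

text \<open>Each factor is at most exp (8 / p), so \<epsilon> = 1/128 in the sum of 1 / p gives the
  exponent 8/128 = 1/16. The true order is the square of log y, but an exponent below 1/8 is small
  enough for the later sum over primes.\<close>

lemma Euler_product_bound:
  obtains C where "C > 0" "\<And>y. y \<ge> 1 \<Longrightarrow> (\<Prod>p | prime p \<and> p \<le> y. (real p / (real p - 1))\<^sup>2) \<le> C * real y powr (1/16)"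
proof -
  obtain C where C: "\<And>y. y \<ge> 1 \<Longrightarrow> (\<Sum>p | prime p \<and> p \<le> y. 1 / real p) \<le> C + (1/128) * ln (real y)"
    using sum_inverse_primes_le [of "1/128"] by auto
  show thesis
  proof (rule that)
    show "exp (8 * C) > 0" by simp
    fix y :: nat assume y: "y \<ge> 1"
    have "(\<Prod>p | prime p \<and> p \<le> y. (real p / (real p - 1))\<^sup>2) \<le> (\<Prod>p | prime p \<and> p \<le> y. exp (8 * (1 / real p)))"
    proof (rule prod_mono, rule conjI)
      fix p assume "p \<in> {p. prime p \<and> p \<le> y}"
      then have "(real p / (real p - 1))\<^sup>2 \<le> 1 + 8 / real p" using Euler_factor_le(1) by simp
      also have "\<dots> \<le> exp (8 * (1 / real p))" using exp_ge_add_one_self [of "8 * (1 / real p)"] by simp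
      finally show "(real p / (real p - 1))\<^sup>2 \<le> exp (8 * (1 / real p))" .
    qed simp
    also have "\<dots> = exp (8 * (\<Sum>p | prime p \<and> p \<le> y. 1 / real p))"
      using finite_primes_upto [of y] by (simp add: exp_sum sum_distrib_left)
    also have "\<dots> \<le> exp (8 * (C + (1/128) * ln (real y)))" using C [OF y] by simp
    also have "\<dots> = exp (8 * C) * real y powr (1/16)" using y by (simp add: powr_def exp_add distrib_left)
    finally show "(\<Prod>p | prime p \<and> p \<le> y. (real p / (real p - 1))\<^sup>2) \<le> exp (8 * C) * real y powr (1/16)" .
  qed
qed

lemma euler_ratio_ge_1: "euler_ratio m \<ge> 1"
  unfolding euler_ratio_def
proof (rule prod_ge_1)
  fix p assume "p \<in> prime_factors m"
  then have "real p \<ge> 2" using real_prime_ge_2 by blast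
  then show "1 \<le> real p / (real p - 1)" by simp
qed

text \<open>With z = 2^(L div 16) the error terms are at most 2^(L/2) each. Rounding and ln 2 >= 1/2
  give ln z >= L / 64, whence 8192 = 2 * 64^2; the two errors together cost one more unit.\<close>

lemma card_prime_pairs_bound:
  "\<forall>\<^sub>F L in sequentially. \<forall>h>0. real (card {n. n \<le> 2 ^ L \<and> prime n \<and> prime (n + h)})
      \<le> 8193 * (2 ^ L / real L ^ 2) * (euler_ratio (2 * h))\<^sup>2"
proof -
  have e1: "\<forall>\<^sub>F L::nat in sequentially. 2 * 2 powr (real L / 2) \<le> 2 powr real L / real L ^ 2" by real_asymp
  have e2: "\<forall>\<^sub>F n::nat in sequentially. 16 \<le> n" by (rule eventually_ge_at_top)
  show ?thesis using e1 e2
  proof (eventually_elim, intro allI impI)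
    fix L h :: nat
    assume 1: "2 * 2 powr (real L / 2) \<le> 2 powr real L / real L ^ 2" and L: "16 \<le> L" and h: "h > 0"
    define m where "m = L div 16"
    define z where "z = (2::nat) ^ m"
    define E where "E = euler_ratio (2 * h)"
    define Y where "Y = 2 ^ L / real L ^ 2"
    have m: "m \<ge> 1" "16 * m \<le> L" "L \<le> 32 * m" using L unfolding m_def by presburger+
    have E: "E \<ge> 1" by (simp add: E_def euler_ratio_ge_1)
    have "(2::nat) ^ 1 \<le> 2 ^ m" using m(1) by (intro power_increasing) auto
    then have z: "z \<ge> 2" by (simp add: z_def)
    have z8: "real z ^ 8 \<le> 2 powr (real L / 2)"
    proof -
      have "real z ^ 8 = 2 ^ (m * 8)" by (simp add: z_def power_mult)
      also have "\<dots> = 2 powr real (m * 8)" by (subst powr_realpow) auto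
      also have "\<dots> \<le> 2 powr (real L / 2)" using m(2) by (intro powr_mono) auto
      finally show ?thesis .
    qed
    have "real z ^ 2 \<le> real z ^ 8" using z by (intro power_increasing) auto
    then have z2: "real z ^ 2 \<le> 2 powr (real L / 2)" using z8 by linarith
    have "ln (real z) = real m * ln 2" by (simp add: z_def ln_realpow)
    moreover have "real m * (1/2) \<le> real m * ln 2"
      using ln_2_less_1 ln2_ge_two_thirds by (intro mult_left_mono) auto
    moreover have "real L / 32 \<le> real m" using m(3) by linarith
    ultimately have lnz: "real L / 64 \<le> ln (real z)" by linarith
    have pL: "2 powr real L = 2 ^ L" by (simp add: powr_realpow)
    have "real (card {n. n \<le> 2 ^ L \<and> prime n \<and> prime (n + h)})
       \<le> real z ^ 2 + (real (2 ^ L) + 1) * (E / ln (real z))\<^sup>2 + real z ^ 8"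
      unfolding E_def by (rule card_prime_pairs_sieve [OF h z])
    also have "(real (2 ^ L) + 1) * (E / ln (real z))\<^sup>2 \<le> (2 * 2 ^ L) * (E / (real L / 64))\<^sup>2"
    proof (intro mult_mono power_mono divide_left_mono)
      show "0 < ln (real z) * (real L / 64)" using L z by simp
    qed (use lnz L E z in auto)
    also have "\<dots> = 8192 * (2 ^ L / real L ^ 2) * E\<^sup>2" using L by (simp add: power_divide)
    also have "real z ^ 2 + 8192 * (2 ^ L / real L ^ 2) * E\<^sup>2 + real z ^ 8 \<le> 8192 * Y * E\<^sup>2 + Y"
      using z2 z8 1 unfolding pL Y_def by linarith
    finally have "real (card {n. n \<le> 2 ^ L \<and> prime n \<and> prime (n + h)}) \<le> 8192 * Y * E\<^sup>2 + Y" by simp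
    moreover have "Y * 1 \<le> Y * E\<^sup>2"
      using one_le_power [OF E, of 2] by (intro mult_left_mono) (auto simp: Y_def)
    ultimately show "real (card {n. n \<le> 2 ^ L \<and> prime n \<and> prime (n + h)}) \<le> 8193 * (2 ^ L / real L ^ 2) * (euler_ratio (2 * h))\<^sup>2"
      unfolding E_def [symmetric] Y_def [symmetric] by linarith
  qed
qed

text \<open>
  At most \<open>L + 1\<close> primes divide \<open>h\<close>, so those exceeding \<open>L\<close> contribute a bounded factor.
\<close>

lemma euler_ratio_double_square_le:
  assumes L: "L \<ge> 1" and h: "0 < h" "h \<le> 2 ^ (L + 1)"
  shows "(euler_ratio (2 * h))\<^sup>2 \<le> 4 * exp 4 * (\<Prod>p | prime p \<and> p \<le> L \<and> p dvd h. (real p / (real p - 1))\<^sup>2)"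
proof -
  define w where "w p = (real p / (real p - 1))\<^sup>2" for p :: nat
  define F where "F = prime_factors h"
  define F1 where "F1 = {p. prime p \<and> p \<le> L \<and> p dvd h}"
  define F2 where "F2 = F - F1"
  have w1: "w p \<ge> 1" if "prime p" for p unfolding w_def by (rule Euler_factor_le(2) [OF that])
  have F1: "F1 \<subseteq> F" using h by (auto simp: F1_def F_def in_prime_factors_iff)
  have finF: "finite F" by (simp add: F_def)
  have prF: "prime p" if "p \<in> F" for p using that by (auto simp: F_def)
  have "prime_factors (2 * h) = insert 2 F"
    using h by (simp add: prime_factors_product prime_prime_factors F_def)
  then have "(euler_ratio (2 * h))\<^sup>2 = prod w (insert 2 F)"
    by (simp add: euler_ratio_def w_def prod_power_distrib)
  \<comment> \<open>The Euler factor of 2 is \<open>w 2 = 4\<close>; it is new only if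
    \<open>h\<close> is odd.\<close>
  also have "\<dots> \<le> 4 * prod w F"
  proof (cases "2 \<in> F")
    case True
    have "prod w F \<ge> 0" by (rule prod_nonneg) (simp add: w_def)
    then show ?thesis using True by (simp add: insert_absorb)
  next
    case False
    then show ?thesis using finF by (simp add: w_def)
  qed
  also have "prod w F = prod w F2 * prod w F1"
    unfolding F2_def using finF F1 by (simp add: prod.subset_diff)
  \<comment> \<open>Each factor is at most exp (2 / L), and there are at most L + 1 <= 2 L of
    them.\<close>
  also have "prod w F2 \<le> exp 4"
  proof -
    have "prod w F2 \<le> (\<Prod>p\<in>F2. exp (2 / real L))"
    proof (rule prod_mono, rule conjI)
      fix p assume p: "p \<in> F2"
      then have pp: "prime p" "p dvd h" "\<not> p \<le> L" by (auto simp: F2_def F1_def F_def)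
      have p2: "real p \<ge> 2" by (rule real_prime_ge_2 [OF pp(1)])
      have "real p / (real p - 1) = 1 + 1 / (real p - 1)" using p2 by (simp add: field_simps)
      also have "\<dots> \<le> 1 + 1 / real L" using pp(3) L by (intro add_left_mono divide_left_mono) auto
      also have "\<dots> \<le> exp (1 / real L)" by (rule exp_ge_add_one_self)
      finally have "w p \<le> (exp (1 / real L))\<^sup>2" unfolding w_def using p2 by (intro power_mono) auto
      also have "\<dots> = exp (2 / real L)" by (simp flip: exp_of_nat_mult)
      finally show "w p \<le> exp (2 / real L)" .
    qed (simp add: w_def)
    also have "\<dots> = exp (real (card F2) * (2 / real L))" by (simp only: prod_constant exp_of_nat_mult)
    also have "\<dots> \<le> exp 4"
    proof -
      have "card F2 \<le> card F" unfolding F2_def using finF by (intro card_mono) auto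
      also have "\<dots> \<le> L + 1" unfolding F_def by (rule card_prime_factors_le) (use h in auto)
      finally have "real (card F2) \<le> 2 * real L" using L by linarith
      then have "real (card F2) * (2 / real L) \<le> 2 * real L * (2 / real L)" by (intro mult_right_mono) auto
      then show ?thesis using L by simp
    qed
    finally show ?thesis .
  qed
  finally have "(euler_ratio (2 * h))\<^sup>2 \<le> 4 * (exp 4 * prod w F1)"
    by (simp add: mult_right_mono prod_nonneg w_def)
  then show ?thesis by (simp add: F1_def w_def)
qed

section \<open>The average over differences of Fibonacci sums\<close>

lemma power_exponents_eq:
  fixes L :: nat
  assumes "L \<ge> 1"
  obtains n where "{k::nat. 1 \<le> k \<and> 2 ^ k \<le> L} = {1..n}" "2 ^ n \<le> L" "L < 2 ^ (n + 1)"
proof -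
  obtain n where n: "2 ^ n \<le> L" "L < 2 ^ (n + 1)" using ex_power_ivl1 [of 2 L] assms by auto
  have "k \<le> n \<longleftrightarrow> 2 ^ k \<le> L" for k :: nat
  proof
    assume "k \<le> n"
    then have "(2::nat) ^ k \<le> 2 ^ n" by (intro power_increasing) auto
    then show "2 ^ k \<le> L" using n(1) by (rule order_trans)
  next
    assume "2 ^ k \<le> L"
    then have "(2::nat) ^ k < 2 ^ (n + 1)" using n by linarith
    then show "k \<le> n" by (simp only: power_strict_increasing_iff)
  qed
  then have "{k. 1 \<le> k \<and> 2 ^ k \<le> L} = {1..n}"
    unfolding set_eq_iff mem_Collect_eq atLeastAtMost_iff by blast
  with n that show thesis by blast
qed

lemma card_power_exponents:
  fixes L :: nat
  assumes "L \<ge> 1"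
  shows "finite {k::nat. 1 \<le> k \<and> 2 ^ k \<le> L}"
    and "real (card {k::nat. 1 \<le> k \<and> 2 ^ k \<le> L}) \<le> 2 * ln (real L)"
    and "ln (real L) - 1 \<le> real (card {k::nat. 1 \<le> k \<and> 2 ^ k \<le> L})"
proof -
  obtain n where n: "{k::nat. 1 \<le> k \<and> 2 ^ k \<le> L} = {1..n}" "2 ^ n \<le> L" "L < 2 ^ (n + 1)"
    by (rule power_exponents_eq [OF assms])
  show "finite {k::nat. 1 \<le> k \<and> 2 ^ k \<le> L}" by (simp only: n) simp
  have card: "card {k::nat. 1 \<le> k \<and> 2 ^ k \<le> L} = n" unfolding n(1) by simp
  have "real (2 ^ n) \<le> real L" "real L \<le> real (2 ^ (n + 1))" using n(2,3) by (simp_all only: of_nat_le_iff less_imp_le)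
  then have "ln (2 ^ n) \<le> ln (real L)" "ln (real L) \<le> ln (2 ^ (n + 1))" using assms by simp_all
  then have 1: "real n * ln 2 \<le> ln (real L)" "ln (real L) \<le> real (n + 1) * ln 2"
    by (simp_all only: ln_realpow zero_less_numeral)
  have ln2: "1/2 \<le> ln (2::real)" "ln (2::real) \<le> 1" using ln2_ge_two_thirds ln_2_less_1 by auto
  have "real n * (1/2) \<le> real n * ln 2" using ln2 by (intro mult_left_mono) auto
  with 1 show "real (card {k::nat. 1 \<le> k \<and> 2 ^ k \<le> L}) \<le> 2 * ln (real L)" unfolding card by linarith
  have "real (n + 1) * ln 2 \<le> real (n + 1) * 1" using ln2 by (intro mult_left_mono) auto
  also have "real (n + 1) * 1 = real n + 1" by simp
  finally have "real (n + 1) * ln 2 \<le> real n + 1" .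
  with 1 show "ln (real L) - 1 \<le> real (card {k::nat. 1 \<le> k \<and> 2 ^ k \<le> L})" unfolding card by linarith
qed

text \<open>The nonempty subsets in the expanded product are sorted by their largest element p; the
  rest of such a subset is an arbitrary set of elements below p.\<close>

lemma prod_one_plus_eq_sum:
  fixes x :: "'a::linorder \<Rightarrow> 'b::comm_semiring_1"
  assumes "finite A"
  shows "(\<Prod>p\<in>A. 1 + x p) = 1 + (\<Sum>p\<in>A. x p * (\<Prod>q\<in>{q\<in>A. q < p}. 1 + x q))"
  using assms
proof (induction A rule: finite_linorder_max_induct)
  case (insert b A)
  have "{q\<in>insert b A. q < b} = A" using insert by auto
  moreover have "{q\<in>insert b A. q < p} = {q\<in>A. q < p}" if "p \<in> A" for p using insert that by auto
  moreover have "b \<notin> A" using insert by auto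
  ultimately have "(\<Sum>p\<in>insert b A. x p * (\<Prod>q\<in>{q\<in>insert b A. q < p}. 1 + x q))
      = x b * (\<Prod>q\<in>A. 1 + x q) + (\<Sum>p\<in>A. x p * (\<Prod>q\<in>{q\<in>A. q < p}. 1 + x q))"
    using insert.hyps(1) by simp
  moreover have "(\<Prod>p\<in>insert b A. 1 + x p) = x b * (\<Prod>q\<in>A. 1 + x q) + (\<Prod>q\<in>A. 1 + x q)"
    using insert.hyps(1) \<open>b \<notin> A\<close> by (simp add: distrib_right add.commute)
  ultimately show ?case using insert.IH by (simp add: add.left_commute)
qed simp

text \<open>
  A prime with period \<open>t\<close> divides \<open>fib t\<close>, so at most \<open>t\<close> primes have period \<open>t\<close>.
\<close>

lemma sum_short_fib_period_primes_le:
  "(\<Sum>p | prime p \<and> p \<le> L \<and> fib_period p ^ 4 < p. real p powr (-15/16)) \<le> (\<Sum>t. real t powr (-11/4))"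
proof -
  define B where "B = {p. prime p \<and> p \<le> L \<and> fib_period p ^ 4 < p}"
  have finB: "finite B" unfolding B_def by (rule finite_primes_le)
  have per: "fib_period p > 0" if "prime p" for p
    using that by (intro fib_period(1) prime_gt_0_nat)
  have "(\<Sum>p\<in>B. real p powr (-15/16)) = (\<Sum>t\<in>{1..L}. \<Sum>p\<in>{p\<in>B. fib_period p = t}. real p powr (-15/16))"
  proof (rule sum.group [symmetric, OF finB])
    show "fib_period ` B \<subseteq> {1..L}"
    proof
      fix t assume "t \<in> fib_period ` B"
      then obtain p where p: "prime p" "p \<le> L" "t ^ 4 < p" "t = fib_period p" by (auto simp: B_def)
      have t: "t > 0" using per p by simp
      then have "t ^ 1 \<le> t ^ 4" by (intro power_increasing) auto
      then have "t \<le> L" using p by simp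
      with t show "t \<in> {1..L}" by simp
    qed
  qed simp
  also have "\<dots> \<le> (\<Sum>t\<in>{1..L}. real t powr (-11/4))"
  proof (rule sum_mono)
    fix t assume "t \<in> {1..L}"
    then have t: "t > 0" by simp
    have "{p\<in>B. fib_period p = t} \<subseteq> prime_factors (fib t)"
    proof
      fix p assume p: "p \<in> {p\<in>B. fib_period p = t}"
      then have "prime p" "fib_period p = t" by (auto simp: B_def)
      then have "p dvd fib t" using prime_dvd_fib_period [of p] by simp
      then show "p \<in> prime_factors (fib t)"
        using fib_neq_0_nat [OF t] \<open>prime p\<close> by (simp add: in_prime_factors_iff)
    qed
    then have "card {p\<in>B. fib_period p = t} \<le> card (prime_factors (fib t))" by (intro card_mono) auto
    also have "\<dots> \<le> t" 
      using fib_neq_0_nat [OF t] fib_less_power2 [of t] by (intro card_prime_factors_le) auto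
    finally have c: "card {p\<in>B. fib_period p = t} \<le> t" .
    \<comment> \<open>From p > t^4 each term is at most t^(4 * (-15/16)) = t^(-15/4). With at most t
      terms the contribution of t is t^(-11/4), which is summable.\<close>
    have "(\<Sum>p\<in>{p\<in>B. fib_period p = t}. real p powr (-15/16)) \<le> (\<Sum>p\<in>{p\<in>B. fib_period p = t}. real t powr (-15/4))"
    proof (rule sum_mono)
      fix p assume "p \<in> {p\<in>B. fib_period p = t}"
      then have "t ^ 4 \<le> p" by (auto simp: B_def)
      then have "real (t ^ 4) \<le> real p" by (simp only: of_nat_le_iff)
      then have "real t powr 4 \<le> real p" using t by (simp add: powr_numeral)
      then have "real p powr (-15/16) \<le> (real t powr 4) powr (-15/16)" using t by (intro powr_mono2') auto
      also have "\<dots> = real t powr (-15/4)" unfolding powr_powr by simp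
      finally show "real p powr (-15/16) \<le> real t powr (-15/4)" .
    qed
    also have "\<dots> = real (card {p\<in>B. fib_period p = t}) * real t powr (-15/4)" by simp
    also have "\<dots> \<le> real t * real t powr (-15/4)" using c by (intro mult_right_mono) auto
    also have "\<dots> = real t powr 1 * real t powr (-15/4)" using t by simp
    also have "\<dots> = real t powr (-11/4)" unfolding powr_add [symmetric] by simp
    finally show "(\<Sum>p\<in>{p\<in>B. fib_period p = t}. real p powr (-15/16)) \<le> real t powr (-11/4)" .
  qed
  also have "\<dots> \<le> (\<Sum>t. real t powr (-11/4))"
    by (rule sum_le_suminf) (auto simp: summable_real_powr_iff)
  finally show ?thesis by (simp add: B_def)
qed

section \<open>The pairs (k, q) and the average of the local weight\<close>

text \<open>The bound is on 2^k, the Fibonacci index, which keeps \<open>fib (2 ^ k)\<close> below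
  2^L. The value k = 0 is excluded because fib 1 = fib 2; all indices are then at least 2, where
  \<open>fib\<close> is injective. For a lower density bound a part of the representations is
  enough.\<close>

definition fib_exponents :: "nat \<Rightarrow> (nat \<times> nat) set" where
  "fib_exponents L = {k. 1 \<le> k \<and> 2 ^ k \<le> L} \<times> {q. prime q \<and> q \<le> L}"

definition fib_value :: "nat \<times> nat \<Rightarrow> nat" where
  "fib_value u = fib (2 ^ fst u) + fib (snd u)"

lemma finite_fib_exponents: "L \<ge> 1 \<Longrightarrow> finite (fib_exponents L)"
  unfolding fib_exponents_def by (intro finite_cartesian_product card_power_exponents(1) finite_primes_upto)

lemma card_fib_exponents_bound:
  "\<forall>\<^sub>F L in sequentially. real (card (fib_exponents L)) \<le> 512 * real L"
proof -
  have e: "\<forall>\<^sub>F n::nat in sequentially. 3 \<le> n" by (rule eventually_ge_at_top)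
  show ?thesis using card_primes_upper_bound e
  proof eventually_elim
    case (elim L)
    have lnL: "ln (real L) > 0" using elim by simp
    have "real (card (fib_exponents L)) = real (card {k::nat. 1 \<le> k \<and> 2 ^ k \<le> L}) * real (card {q. prime q \<and> q \<le> L})"
      by (simp add: fib_exponents_def card_cartesian_product)
    also have "\<dots> \<le> (2 * ln (real L)) * (256 * (real L / ln (real L)))"
      using elim lnL by (intro mult_mono card_power_exponents(2)) auto
    also have "\<dots> = 512 * real L" using lnL by simp
    finally show ?case .
  qed
qed

text \<open>The contribution of the primes up to \<open>L\<close> to the squared ratio of h to its
  totient. An integer argument allows differences of either sign; for h = 0 it is the product over
  all primes up to \<open>L\<close>, and the average below includes these terms.\<close>

definition local_weight :: "nat \<Rightarrow> int \<Rightarrow> real" where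
  "local_weight L h = (\<Prod>p | prime p \<and> p \<le> L \<and> int p dvd h. (real p / (real p - 1))\<^sup>2)"

lemma local_weight_nonneg: "local_weight L h \<ge> 0"
  unfolding local_weight_def by (rule prod_nonneg) simp

text \<open>
  Expanding the product along its largest prime leaves only the condition that this single prime
  divides \<open>h\<close>; the smaller primes are estimated by the full Euler product.
\<close>

lemma local_weight_bound:
  obtains C where "C > 0" "\<And>L h. local_weight L h
      \<le> 1 + C * (\<Sum>p | prime p \<and> p \<le> L. real p powr (-15/16) * of_bool (int p dvd h))"
proof -
  obtain C where C: "C > 0" "\<And>y. y \<ge> 1 \<Longrightarrow>
      (\<Prod>p | prime p \<and> p \<le> y. (real p / (real p - 1))\<^sup>2) \<le> C * real y powr (1/16)"
    by (rule Euler_product_bound) blast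
  show thesis
  proof (rule that)
    show "8 * C > 0" using C by simp
    fix L h
    define x where "x p = (real p / (real p - 1))\<^sup>2 - 1" for p :: nat
    define A where "A = {p. prime p \<and> p \<le> L \<and> int p dvd h}"
    have finA: "finite A" unfolding A_def by (rule finite_primes_le)
    have "local_weight L h = (\<Prod>p\<in>A. 1 + x p)" by (simp add: local_weight_def A_def x_def)
    also have "\<dots> = 1 + (\<Sum>p\<in>A. x p * (\<Prod>q\<in>{q\<in>A. q < p}. 1 + x q))" by (rule prod_one_plus_eq_sum [OF finA])
    also have "\<dots> \<le> 1 + (\<Sum>p\<in>A. 8 * C * real p powr (-15/16))"
    proof (intro add_left_mono sum_mono)
      fix p assume "p \<in> A"
      then have p: "prime p" by (simp add: A_def)
      then have p0: "p > 0" by (rule prime_gt_0_nat)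
      have xp: "x p \<ge> 0" "x p \<le> 8 / real p" using Euler_factor_le [OF p] by (simp_all add: x_def)
      have "(\<Prod>q\<in>{q\<in>A. q < p}. 1 + x q) = (\<Prod>q\<in>{q\<in>A. q < p}. (real q / (real q - 1))\<^sup>2)" by (simp add: x_def)
      also have "\<dots> \<le> (\<Prod>q\<in>{q. prime q \<and> q \<le> p}. (real q / (real q - 1))\<^sup>2)"
        by (rule prod_mono2 [OF finite_primes_upto]) (auto simp: A_def Euler_factor_le(2))
      also have "\<dots> \<le> C * real p powr (1/16)" using p0 by (intro C(2)) simp
      finally have pr: "(\<Prod>q\<in>{q\<in>A. q < p}. 1 + x q) \<le> C * real p powr (1/16)" .
      have "x p * (\<Prod>q\<in>{q\<in>A. q < p}. 1 + x q) \<le> (8 / real p) * (C * real p powr (1/16))"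
        using xp pr C(1) by (intro mult_mono prod_nonneg) (auto simp: x_def)
      also have "\<dots> = 8 * C * (real p powr (-1) * real p powr (1/16))" using p0 by (simp add: powr_minus_divide)
      also have "\<dots> = 8 * C * real p powr (-15/16)" unfolding powr_add [symmetric] by simp
      finally show "x p * (\<Prod>q\<in>{q\<in>A. q < p}. 1 + x q) \<le> 8 * C * real p powr (-15/16)" .
    qed
    also have "(\<Sum>p\<in>A. 8 * C * real p powr (-15/16)) = 8 * C * (\<Sum>p\<in>A. real p powr (-15/16))"
      by (simp add: sum_distrib_left)
    also have "(\<Sum>p\<in>A. real p powr (-15/16)) = (\<Sum>p | prime p \<and> p \<le> L. real p powr (-15/16) * of_bool (int p dvd h))"
      by (rule sum.mono_neutral_cong_left [OF finite_primes_upto]) (auto simp: A_def)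
    finally show "local_weight L h \<le> 1 + 8 * C * (\<Sum>p | prime p \<and> p \<le> L. real p powr (-15/16) * of_bool (int p dvd h))" .
  qed
qed

text \<open>After exchanging sums, p^(-15/16) is multiplied by the number \<open>N p\<close> of
  pairs (u, v) whose difference p divides. If the period is long, fixing u and the k of v leaves
  O((L / ln L) p^(-1/8)) choices of q; the O(ln L) values of k cancel the logarithm, so
  \<open>N p\<close> is O(L^2 p^(-1/8)). For short periods \<open>N p\<close> is bounded by the
  number of all pairs.\<close>

lemma local_weight_average:
  obtains C where "C > 0" "\<forall>\<^sub>F L in sequentially.
    (\<Sum>u\<in>fib_exponents L. \<Sum>v\<in>fib_exponents L. local_weight L (int (fib_value u) - int (fib_value v))) \<le> C * real L ^ 2"
proof -
  obtain C where C: "C > 0" "\<And>L h. local_weight L h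
      \<le> 1 + C * (\<Sum>p | prime p \<and> p \<le> L. real p powr (-15/16) * of_bool (int p dvd h))"
    by (rule local_weight_bound) blast
  define Z1 where "Z1 = (\<Sum>n. real n powr (-17/16))"
  define Z2 where "Z2 = (\<Sum>t. real t powr (-11/4))"
  \<comment> \<open>262144 = 512^2 bounds the number of pairs relative to L^2, and 1048576 = 512 * 2
    * 1024 combines the bounds for u, k and q.\<close>
  define c where "c = 262144 + C * (1048576 * Z1 + 262144 * Z2)"
  have Z1: "Z1 \<ge> 0" and Z2: "Z2 \<ge> 0" unfolding Z1_def Z2_def
    by (rule suminf_nonneg; simp add: summable_real_powr_iff)+
  have e: "\<forall>\<^sub>F n::nat in sequentially. 3 \<le> n" by (rule eventually_ge_at_top)
  show thesis
  proof (rule that)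
    show "c > 0" using C(1) Z1 Z2 by (simp add: c_def add_pos_nonneg)
    show "\<forall>\<^sub>F L in sequentially. (\<Sum>u\<in>fib_exponents L. \<Sum>v\<in>fib_exponents L.
        local_weight L (int (fib_value u) - int (fib_value v))) \<le> c * real L ^ 2"
      using card_primes_fib_residue_bound card_fib_exponents_bound e
    proof eventually_elim
      case (elim L)
      define S where "S = fib_exponents L"
      define K where "K = {k::nat. 1 \<le> k \<and> 2 ^ k \<le> L}"
      define Q where "Q = {q. prime q \<and> q \<le> L}"
      define W where "W = real L / ln (real L)"
      define N where "N p = (\<Sum>u\<in>S. \<Sum>v\<in>S. of_bool (int p dvd int (fib_value u) - int (fib_value v)) :: real)" for p :: nat
      have lnL: "ln (real L) > 0" using elim(3) by simp
      have W: "W > 0" using lnL elim(3) by (simp add: W_def)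
      have cS: "real (card S) \<le> 512 * real L" using elim(2) by (simp add: S_def)
      have cK: "real (card K) \<le> 2 * ln (real L)" unfolding K_def using elim(3) by (intro card_power_exponents(2)) simp
      have finQ: "finite Q" unfolding Q_def by (rule finite_primes_upto)
      have S: "S = K \<times> Q" by (simp add: S_def K_def Q_def fib_exponents_def)
      have SS: "real (card S) * real (card S) \<le> 262144 * real L ^ 2"
        using mult_mono [OF cS cS] by (simp add: power2_eq_square)
      have N_triv: "N p \<le> 262144 * real L ^ 2" for p
      proof -
        have "N p \<le> (\<Sum>u\<in>S. \<Sum>v\<in>S. 1)" unfolding N_def by (intro sum_mono) simp
        then show ?thesis using SS by simp
      qed
      have N_good: "N p \<le> 1048576 * real L ^ 2 * real p powr (-1/8)" if p: "prime p" "p \<le> L" "p \<le> fib_period p ^ 4" for p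
      proof -
        have "N p = (\<Sum>u\<in>S. \<Sum>k\<in>K. \<Sum>q\<in>Q. of_bool (int p dvd int (fib_value u) - int (fib_value (k, q))))"
          unfolding N_def S by (simp add: sum.cartesian_product)
        also have "\<dots> \<le> (\<Sum>u\<in>S. \<Sum>k\<in>K. 1024 * W * real p powr (-1/8))"
        proof (intro sum_mono)
          fix u k
          \<comment> \<open>With u and k fixed, the divisibility prescribes the residue
            \<open>a\<close> of \<open>fib q\<close> modulo p.\<close>
          define a where "a = int (fib_value u) - int (fib (2 ^ k))"
          have "(\<Sum>q\<in>Q. of_bool (int p dvd int (fib_value u) - int (fib_value (k, q))) :: real)
              = real (card {q\<in>Q. int p dvd int (fib_value u) - int (fib_value (k, q))})"
            using finQ by (simp add: Int_def flip: sum.inter_filter)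
          also have "{q\<in>Q. int p dvd int (fib_value u) - int (fib_value (k, q))} = {q. prime q \<and> q \<le> L \<and> [int (fib q) = a] (mod int p)}"
          proof -
            have "int (fib_value u) - int (fib_value (k, q)) = a - int (fib q)" for q
              by (simp add: a_def fib_value_def)
            then show ?thesis by (auto simp: Q_def cong_iff_dvd_diff dvd_diff_commute)
          qed
          also have "real (card \<dots>) \<le> 1024 * W * real p powr (-1/8)"
            unfolding W_def using elim(1) p by blast
          finally show "(\<Sum>q\<in>Q. of_bool (int p dvd int (fib_value u) - int (fib_value (k, q)))) \<le> 1024 * W * real p powr (-1/8)" .
        qed
        also have "\<dots> = real (card S) * real (card K) * (1024 * W * real p powr (-1/8))" by simp
        also have "\<dots> \<le> (512 * real L) * (2 * ln (real L)) * (1024 * W * real p powr (-1/8))"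
          using cS cK W by (intro mult_right_mono mult_mono) auto
        also have "\<dots> = 1048576 * real L ^ 2 * real p powr (-1/8)"
          using lnL by (simp add: W_def power2_eq_square)
        finally show ?thesis .
      qed
      have "(\<Sum>u\<in>S. \<Sum>v\<in>S. local_weight L (int (fib_value u) - int (fib_value v)))
         \<le> (\<Sum>u\<in>S. \<Sum>v\<in>S. 1 + C * (\<Sum>p\<in>Q. real p powr (-15/16) * of_bool (int p dvd int (fib_value u) - int (fib_value v))))"
        unfolding Q_def by (intro sum_mono C(2))
      also have "\<dots> = real (card S) * real (card S) + C * (\<Sum>u\<in>S. \<Sum>v\<in>S. \<Sum>p\<in>Q. real p powr (-15/16) * of_bool (int p dvd int (fib_value u) - int (fib_value v)))"
        by (simp add: sum.distrib sum_distrib_left)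
      also have "(\<Sum>u\<in>S. \<Sum>v\<in>S. \<Sum>p\<in>Q. real p powr (-15/16) * of_bool (int p dvd int (fib_value u) - int (fib_value v)))
         = (\<Sum>u\<in>S. \<Sum>p\<in>Q. \<Sum>v\<in>S. real p powr (-15/16) * of_bool (int p dvd int (fib_value u) - int (fib_value v)))"
        by (rule sum.cong [OF refl], rule sum.swap)
      also have "\<dots> = (\<Sum>p\<in>Q. \<Sum>u\<in>S. \<Sum>v\<in>S. real p powr (-15/16) * of_bool (int p dvd int (fib_value u) - int (fib_value v)))"
        by (rule sum.swap)
      also have "\<dots> = (\<Sum>p\<in>Q. real p powr (-15/16) * N p)"
        unfolding N_def sum_distrib_left ..
      also have "\<dots> \<le> (\<Sum>p\<in>Q. real p powr (-17/16) * (1048576 * real L ^ 2)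
          + (if fib_period p ^ 4 < p then real p powr (-15/16) * (262144 * real L ^ 2) else 0))"
      proof (rule sum_mono)
        fix p assume "p \<in> Q"
        then have p: "prime p" "p \<le> L" by (auto simp: Q_def)
        show "real p powr (-15/16) * N p \<le> real p powr (-17/16) * (1048576 * real L ^ 2)
          + (if fib_period p ^ 4 < p then real p powr (-15/16) * (262144 * real L ^ 2) else 0)"
        proof (cases "fib_period p ^ 4 < p")
          case True
          have "real p powr (-15/16) * N p \<le> real p powr (-15/16) * (262144 * real L ^ 2)"
            using N_triv by (intro mult_left_mono) auto
          then show ?thesis using True by (simp add: add_increasing)
        next
          case False
          then have "real p powr (-15/16) * N p \<le> real p powr (-15/16) * (1048576 * real L ^ 2 * real p powr (-1/8))"
            using N_good p by (intro mult_left_mono) auto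
          also have "\<dots> = (real p powr (-15/16) * real p powr (-1/8)) * (1048576 * real L ^ 2)" by simp
          also have "real p powr (-15/16) * real p powr (-1/8) = real p powr (-17/16)"
            unfolding powr_add [symmetric] by simp
          finally show ?thesis using False by simp
        qed
      qed
      also have "\<dots> = (\<Sum>p\<in>Q. real p powr (-17/16)) * (1048576 * real L ^ 2)
          + (\<Sum>p | prime p \<and> p \<le> L \<and> fib_period p ^ 4 < p. real p powr (-15/16)) * (262144 * real L ^ 2)"
      proof -
        have "{p\<in>Q. fib_period p ^ 4 < p} = {p. prime p \<and> p \<le> L \<and> fib_period p ^ 4 < p}" by (auto simp: Q_def)
        then show ?thesis unfolding sum.distrib sum_distrib_right sum.inter_filter [OF finQ, symmetric] by simp
      qed
      also have "\<dots> \<le> Z1 * (1048576 * real L ^ 2) + Z2 * (262144 * real L ^ 2)"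
      proof (intro add_mono mult_right_mono)
        show "(\<Sum>p\<in>Q. real p powr (-17/16)) \<le> Z1"
          unfolding Z1_def using finQ by (intro sum_le_suminf) (auto simp: summable_real_powr_iff)
        show "(\<Sum>p | prime p \<and> p \<le> L \<and> fib_period p ^ 4 < p. real p powr (-15/16)) \<le> Z2"
          unfolding Z2_def by (rule sum_short_fib_period_primes_le)
      qed auto
      finally have "(\<Sum>u\<in>S. \<Sum>v\<in>S. local_weight L (int (fib_value u) - int (fib_value v)))
         \<le> real (card S) * real (card S) + C * (Z1 * (1048576 * real L ^ 2) + Z2 * (262144 * real L ^ 2))"
        using C(1) by (simp add: mult_left_mono)
      also have "\<dots> \<le> 262144 * real L ^ 2 + C * (Z1 * (1048576 * real L ^ 2) + Z2 * (262144 * real L ^ 2))"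
        using SS by simp
      also have "\<dots> = c * real L ^ 2" by (simp add: c_def algebra_simps)
      finally show ?case by (simp add: S_def)
    qed
  qed
qed

section \<open>Romanoff's argument\<close>

text \<open>The multiplicities \<open>r n\<close> of the values of \<open>g\<close> add up to
  \<open>card A\<close>, and their squares add up to the number of colliding pairs.\<close>

lemma card_square_le_collisions:
  assumes "finite A"
  shows "(card A)\<^sup>2 \<le> card (g ` A) * card {(x, y) \<in> A \<times> A. g x = g y}"
proof -
  define r where "r n = card {x\<in>A. g x = n}" for n
  have fin: "finite (g ` A)" using assms by simp
  have A: "card A = (\<Sum>n\<in>g ` A. r n)"
  proof -
    have "card A = (\<Sum>x\<in>A. 1)" by simp
    also have "\<dots> = (\<Sum>n\<in>g ` A. \<Sum>x\<in>{x\<in>A. g x = n}. 1)" by (rule sum.group [symmetric]) (use assms in auto)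
    finally show ?thesis by (simp add: r_def)
  qed
  have "{(x, y) \<in> A \<times> A. g x = g y} = (\<Union>n\<in>g ` A. {x\<in>A. g x = n} \<times> {x\<in>A. g x = n})" by auto
  also have "card \<dots> = (\<Sum>n\<in>g ` A. card ({x\<in>A. g x = n} \<times> {x\<in>A. g x = n}))"
    using assms fin by (intro card_UN_disjoint) auto
  also have "\<dots> = (\<Sum>n\<in>g ` A. (r n)\<^sup>2)" by (simp add: r_def card_cartesian_product power2_eq_square)
  finally have P: "card {(x, y) \<in> A \<times> A. g x = g y} = (\<Sum>n\<in>g ` A. (r n)\<^sup>2)" .
  have "(\<Sum>n\<in>g ` A. 1 * real (r n))\<^sup>2 \<le> (\<Sum>n\<in>g ` A. 1\<^sup>2) * (\<Sum>n\<in>g ` A. (real (r n))\<^sup>2)"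
    by (rule Cauchy_Schwarz_ineq_sum)
  then have "real ((card A)\<^sup>2) \<le> real (card (g ` A) * card {(x, y) \<in> A \<times> A. g x = g y})"
    unfolding A P by simp
  then show ?thesis by (simp only: of_nat_le_iff)
qed

lemma fib_value_le:
  assumes "u \<in> fib_exponents L"
  shows "fib_value u \<le> 2 ^ (L + 1)"
proof -
  obtain k q where u: "u = (k, q)" by (cases u)
  have k: "2 ^ k \<le> L" "q \<le> L" using assms by (auto simp: u fib_exponents_def)
  have "fib (2 ^ k) < 2 ^ 2 ^ k" "fib q < 2 ^ q" by (rule fib_less_power2)+
  moreover have "(2::nat) ^ 2 ^ k \<le> 2 ^ L" "(2::nat) ^ q \<le> 2 ^ L" using k by (intro power_increasing; simp)+
  ultimately have "fib (2 ^ k) + fib q \<le> 2 ^ L + 2 ^ L" by linarith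
  then show ?thesis by (simp add: u fib_value_def)
qed

text \<open>Sending (k, q) to the index pair (2^k, q) is injective and makes both indices at least
  2, so \<open>card_fib_sum_representations\<close> applies.\<close>

lemma card_fib_value_collisions:
  assumes "L \<ge> 1"
  shows "card {v\<in>fib_exponents L. fib_value v = n} \<le> 4"
proof -
  define R where "R = {(a, b). 2 \<le> a \<and> 2 \<le> b \<and> fib a + fib b = n}"
  have R: "finite R" "card R \<le> 4" using card_fib_sum_representations [of n] by (simp_all add: R_def)
  have "card {v\<in>fib_exponents L. fib_value v = n} \<le> card R"
  proof (rule card_inj_on_le [OF _ _ R(1)])
    show "inj_on (\<lambda>(k, q). ((2::nat) ^ k, q)) {v\<in>fib_exponents L. fib_value v = n}"
      by (auto simp: inj_on_def)
    show "(\<lambda>(k, q). ((2::nat) ^ k, q)) ` {v\<in>fib_exponents L. fib_value v = n} \<subseteq> R"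
    proof
      fix x assume "x \<in> (\<lambda>(k, q). ((2::nat) ^ k, q)) ` {v\<in>fib_exponents L. fib_value v = n}"
      then obtain k q where kq: "(k, q) \<in> fib_exponents L" "fib_value (k, q) = n" "x = (2 ^ k, q)" by auto
      have "k \<ge> 1" "prime q" using kq(1) by (auto simp: fib_exponents_def)
      have "(2::nat) ^ 1 \<le> 2 ^ k" using \<open>k \<ge> 1\<close> by (intro power_increasing) auto
      then show "x \<in> R" using kq prime_ge_2_nat [OF \<open>prime q\<close>] by (simp add: R_def fib_value_def)
    qed
  qed
  with R show ?thesis by simp
qed

section \<open>Counting the collisions of triples\<close>

lemma card_equal_prime_sums_le:
  fixes N a b :: nat
  assumes "a < b"
  shows "card {(p, q). prime p \<and> p \<le> N \<and> prime q \<and> q \<le> N \<and> p + a = q + b}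
    \<le> card {n. n \<le> N \<and> prime n \<and> prime (n + (b - a))}"
proof (rule card_inj_on_le)
  show "inj_on snd {(p, q). prime p \<and> p \<le> N \<and> prime q \<and> q \<le> N \<and> p + a = q + b}"
    by (auto simp: inj_on_def)
  show "finite {n. n \<le> N \<and> prime n \<and> prime (n + (b - a))}" by (rule finite_subset [of _ "{..N}"]) auto
  show "snd ` {(p, q). prime p \<and> p \<le> N \<and> prime q \<and> q \<le> N \<and> p + a = q + b}
      \<subseteq> {n. n \<le> N \<and> prime n \<and> prime (n + (b - a))}"
  proof
    fix q assume "q \<in> snd ` {(p, q). prime p \<and> p \<le> N \<and> prime q \<and> q \<le> N \<and> p + a = q + b}"
    then obtain p where p: "prime p" "prime q" "q \<le> N" "p + a = q + b" by auto
    then have "p = q + (b - a)" using assms by linarith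
    with p show "q \<in> {n. n \<le> N \<and> prime n \<and> prime (n + (b - a))}" by simp
  qed
qed

lemma card_equal_prime_sums_sym:
  "card {(p, q). prime p \<and> p \<le> N \<and> prime q \<and> q \<le> N \<and> p + a = q + b}
    = card {(p, q). prime p \<and> p \<le> N \<and> prime q \<and> q \<le> N \<and> p + b = q + (a::nat)}"
  by (rule bij_betw_same_card [of prod.swap]) (auto simp: bij_betw_def inj_on_def image_def)

lemma card_equal_prime_sums_eq:
  fixes N a :: nat
  shows "card {(p, q). prime p \<and> p \<le> N \<and> prime q \<and> q \<le> N \<and> p + a = q + a} = card {p. prime p \<and> p \<le> N}"
  by (rule bij_betw_same_card [of fst]) (auto simp: bij_betw_def inj_on_def image_def)

definition triples :: "nat \<Rightarrow> (nat \<times> nat \<times> nat) set" where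
  "triples L = {p. prime p \<and> p \<le> 2 ^ L} \<times> fib_exponents L"

definition triple_sum :: "nat \<times> nat \<times> nat \<Rightarrow> nat" where
  "triple_sum x = fst x + fib_value (snd x)"

lemma finite_triples: "L \<ge> 1 \<Longrightarrow> finite (triples L)"
  unfolding triples_def by (intro finite_cartesian_product finite_fib_exponents finite_primes_upto)

lemma card_triple_collisions:
  assumes "L \<ge> 1"
  shows "card {(x, y) \<in> triples L \<times> triples L. triple_sum x = triple_sum y}
    = (\<Sum>u\<in>fib_exponents L. \<Sum>v\<in>fib_exponents L.
        card {(p, q). prime p \<and> p \<le> 2 ^ L \<and> prime q \<and> q \<le> 2 ^ L \<and> p + fib_value u = q + fib_value v})"
proof -
  define S where "S = fib_exponents L"
  define M where "M u v = {(p, q). prime p \<and> p \<le> 2 ^ L \<and> prime q \<and> q \<le> 2 ^ L \<and> p + fib_value u = q + fib_value v}" for u v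
  have finS: "finite S" unfolding S_def using assms by (rule finite_fib_exponents)
  have finM: "finite (M u v)" for u v
    by (rule finite_subset [of _ "{..2 ^ L} \<times> {..2 ^ L}"]) (auto simp: M_def)
  have "card {(x, y) \<in> triples L \<times> triples L. triple_sum x = triple_sum y} = card (Sigma (S \<times> S) (\<lambda>(u, v). M u v))"
  proof (rule bij_betw_same_card)
    show "bij_betw (\<lambda>((p, u), (q, v)). ((u, v), (p, q))) {(x, y) \<in> triples L \<times> triples L. triple_sum x = triple_sum y} (Sigma (S \<times> S) (\<lambda>(u, v). M u v))"
      by (rule bij_betw_byWitness [where f' = "\<lambda>((u, v), (p, q)). ((p, u), (q, v))"])
        (auto simp: triples_def triple_sum_def M_def S_def)
  qed
  also have "\<dots> = (\<Sum>x\<in>S \<times> S. card (case x of (u, v) \<Rightarrow> M u v))"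
    by (rule card_SigmaI) (use finS finM in auto)
  also have "\<dots> = (\<Sum>u\<in>S. \<Sum>v\<in>S. card (M u v))"
    by (simp add: sum.cartesian_product split_def)
  finally show ?thesis by (simp add: M_def S_def)
qed

lemma filterlim_power2_sequentially: "filterlim (\<lambda>L::nat. (2::nat) ^ L) sequentially sequentially"
  by (rule filterlim_at_top_mono [OF filterlim_ident]) (auto intro: always_eventually less_imp_le less_exp)

lemma card_primes_power2_bound:
  "\<forall>\<^sub>F L in sequentially. real (card {q. prime q \<and> q \<le> (2::nat) ^ L}) \<le> 512 * (2 ^ L / real L)"
proof -
  have e: "\<forall>\<^sub>F n::nat in sequentially. 1 \<le> n" by (rule eventually_ge_at_top)
  have "\<forall>\<^sub>F L in sequentially. real (card {q. prime q \<and> q \<le> (2::nat) ^ L}) \<le> 256 * (real (2 ^ L) / ln (real (2 ^ L)))"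
    by (rule eventually_compose_filterlim [OF card_primes_upper_bound filterlim_power2_sequentially])
  with e show ?thesis
  proof eventually_elim
    case (elim L)
    have ln2: "1/2 \<le> ln (2::real)" using ln2_ge_two_thirds by auto
    have "real (2 ^ L) / ln (real (2 ^ L)) = 2 ^ L / (real L * ln 2)" by (simp add: ln_realpow)
    also have "\<dots> \<le> 2 ^ L / (real L * (1/2))"
      using elim(1) ln2 by (intro divide_left_mono mult_left_mono mult_pos_pos) auto
    finally show ?case using elim(2) by simp
  qed
qed

text \<open>Pairs (u, v) with equal values force equal primes: at most 4 values of v for each of
  O(L) values of u, each with O(2^L / L) primes. Unequal values are prime pair problems costing 2^L
  / L^2 times a local weight, and these weights sum to O(L^2). Both parts are O(2^L).\<close>

lemma card_triple_collisions_bound: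
  obtains C where "C > 0" "\<forall>\<^sub>F L in sequentially.
    real (card {(x, y) \<in> triples L \<times> triples L. triple_sum x = triple_sum y}) \<le> C * 2 ^ L"
proof -
  obtain c where c: "c > 0" "\<forall>\<^sub>F L in sequentially.
    (\<Sum>u\<in>fib_exponents L. \<Sum>v\<in>fib_exponents L. local_weight L (int (fib_value u) - int (fib_value v))) \<le> c * real L ^ 2"
    by (rule local_weight_average) blast
  define D :: real where "D = 8193 * (4 * exp 4)"
  define C where "C = 1048576 + D * c"
  have e: "\<forall>\<^sub>F n::nat in sequentially. 1 \<le> n" by (rule eventually_ge_at_top)
  show thesis
  proof (rule that)
    show "C > 0" using c(1) by (simp add: C_def D_def add_pos_pos)
    show "\<forall>\<^sub>F L in sequentially. real (card {(x, y) \<in> triples L \<times> triples L. triple_sum x = triple_sum y}) \<le> C * 2 ^ L"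
      using c(2) card_prime_pairs_bound card_primes_power2_bound card_fib_exponents_bound e
    proof eventually_elim
      case (elim L)
      define S where "S = fib_exponents L"
      define M where "M u v = card {(p, q). prime p \<and> p \<le> 2 ^ L \<and> prime q \<and> q \<le> 2 ^ L \<and> p + fib_value u = q + fib_value v}" for u v
      define \<pi> where "\<pi> = real (card {q. prime q \<and> q \<le> (2::nat) ^ L})"
      define Y :: real where "Y = 2 ^ L / real L ^ 2"
      have finS: "finite S" unfolding S_def using elim(5) by (rule finite_fib_exponents)
      have Y: "Y \<ge> 0" by (simp add: Y_def)
      have pairs: "real (card {n. n \<le> 2 ^ L \<and> prime n \<and> prime (n + (b - a))}) \<le> D * Y * local_weight L (int a - int b)"
        if ab: "a < b" "b \<le> 2 ^ (L + 1)" for a b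
      proof -
        define h where "h = b - a"
        have h: "h > 0" "h \<le> 2 ^ (L + 1)" using ab by (auto simp: h_def)
        have "int p dvd int a - int b \<longleftrightarrow> p dvd h" for p
        proof -
          have "int a - int b = - int h" using ab by (simp add: h_def of_nat_diff)
          then show ?thesis by simp
        qed
        then have lw: "local_weight L (int a - int b) = (\<Prod>p | prime p \<and> p \<le> L \<and> p dvd h. (real p / (real p - 1))\<^sup>2)"
          unfolding local_weight_def by simp
        have "real (card {n. n \<le> 2 ^ L \<and> prime n \<and> prime (n + h)}) \<le> 8193 * Y * (euler_ratio (2 * h))\<^sup>2"
          unfolding Y_def using elim(2) h(1) by blast
        also have "\<dots> \<le> 8193 * Y * (4 * exp 4 * local_weight L (int a - int b))"
          unfolding lw using Y by (intro mult_left_mono euler_ratio_double_square_le elim(5) h) auto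
        finally show ?thesis by (simp add: D_def h_def mult.assoc mult.left_commute)
      qed
      have M: "real (M u v) \<le> (if fib_value v = fib_value u then \<pi> else 0) + D * Y * local_weight L (int (fib_value u) - int (fib_value v))"
        if "u \<in> S" "v \<in> S" for u v
      proof -
        have le: "fib_value u \<le> 2 ^ (L + 1)" "fib_value v \<le> 2 ^ (L + 1)"
          using that fib_value_le unfolding S_def by blast+
        \<comment> \<open>On the diagonal the weight term is a nonnegative surplus; keeping it there
          allows the average over all pairs to be used as it stands.\<close>
        have nn: "0 \<le> D * Y * local_weight L h" for h using Y local_weight_nonneg by (simp add: D_def)
        consider "fib_value v = fib_value u" | "fib_value u < fib_value v" | "fib_value v < fib_value u" by linarith
        then show ?thesis
        proof cases
          case 1
          then have "M u v = card {q. prime q \<and> q \<le> (2::nat) ^ L}"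
            unfolding M_def using card_equal_prime_sums_eq [of "2 ^ L" "fib_value u"] by simp
          then show ?thesis using 1 nn [of 0] by (simp add: \<pi>_def)
        next
          case 2
          have "real (M u v) \<le> real (card {n. n \<le> 2 ^ L \<and> prime n \<and> prime (n + (fib_value v - fib_value u))})"
            unfolding M_def using card_equal_prime_sums_le [OF 2] by (simp only: of_nat_le_iff)
          also have "\<dots> \<le> D * Y * local_weight L (int (fib_value u) - int (fib_value v))"
            by (rule pairs [OF 2 le(2)])
          finally show ?thesis using 2 by simp
        next
          case 3
          have "real (M u v) \<le> real (card {n. n \<le> 2 ^ L \<and> prime n \<and> prime (n + (fib_value u - fib_value v))})"
            unfolding M_def card_equal_prime_sums_sym [of _ "fib_value u"]
            using card_equal_prime_sums_le [OF 3] by (simp only: of_nat_le_iff)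
          also have "\<dots> \<le> D * Y * local_weight L (int (fib_value v) - int (fib_value u))"
            by (rule pairs [OF 3 le(1)])
          also have "local_weight L (int (fib_value v) - int (fib_value u)) = local_weight L (int (fib_value u) - int (fib_value v))"
            unfolding local_weight_def by (simp only: dvd_diff_commute)
          finally show ?thesis using 3 by simp
        qed
      qed
      have "real (card {(x, y) \<in> triples L \<times> triples L. triple_sum x = triple_sum y}) = (\<Sum>u\<in>S. \<Sum>v\<in>S. real (M u v))"
        unfolding card_triple_collisions [OF elim(5)] S_def M_def by simp
      also have "\<dots> \<le> (\<Sum>u\<in>S. \<Sum>v\<in>S. (if fib_value v = fib_value u then \<pi> else 0) + D * Y * local_weight L (int (fib_value u) - int (fib_value v)))"
        by (intro sum_mono M)
      also have "\<dots> = (\<Sum>u\<in>S. \<Sum>v\<in>S. if fib_value v = fib_value u then \<pi> else 0)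
          + D * Y * (\<Sum>u\<in>S. \<Sum>v\<in>S. local_weight L (int (fib_value u) - int (fib_value v)))"
        by (simp add: sum.distrib sum_distrib_left)
      also have "\<dots> \<le> (\<Sum>u\<in>S. 4 * \<pi>) + D * Y * (c * real L ^ 2)"
      proof (intro add_mono sum_mono mult_left_mono)
        fix u assume "u \<in> S"
        have "(\<Sum>v\<in>S. if fib_value v = fib_value u then \<pi> else 0) = real (card {v\<in>S. fib_value v = fib_value u}) * \<pi>"
          unfolding sum.inter_filter [OF finS, symmetric] by simp
        also have "\<dots> \<le> 4 * \<pi>"
          using card_fib_value_collisions [OF elim(5), of "fib_value u"] by (intro mult_right_mono) (auto simp: S_def \<pi>_def)
        finally show "(\<Sum>v\<in>S. if fib_value v = fib_value u then \<pi> else 0) \<le> 4 * \<pi>" .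
      qed (use elim(1) Y in \<open>auto simp: S_def D_def\<close>)
      also have "\<dots> = real (card S) * (4 * \<pi>) + D * c * 2 ^ L"
        using elim(5) by (simp add: Y_def)
      also have "\<dots> \<le> (512 * real L) * (4 * (512 * (2 ^ L / real L))) + D * c * 2 ^ L"
        using elim(3,4) by (intro add_right_mono mult_mono) (auto simp: S_def \<pi>_def)
      also have "\<dots> = C * 2 ^ L" using elim(5) by (simp add: C_def distrib_right)
      finally show ?case .
    qed
  qed
qed

lemma card_triples_lower_bound:
  "\<forall>\<^sub>F L in sequentially. 2 ^ L / 16 \<le> real (card (triples L))"
proof -
  have e1: "\<forall>\<^sub>F L::nat in sequentially. 2 \<le> ln (real L)" by real_asymp
  have e2: "\<forall>\<^sub>F n::nat in sequentially. 4 \<le> n" by (rule eventually_ge_at_top)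
  show ?thesis using e1 e2
  proof eventually_elim
    case (elim L)
    define c1 where "c1 = real (card {p. prime p \<and> p \<le> (2::nat) ^ L})"
    define c2 where "c2 = real (card {k::nat. 1 \<le> k \<and> 2 ^ k \<le> L})"
    define c3 where "c3 = real (card {q. prime q \<and> q \<le> L})"
    have lnL: "ln (real L) > 0" using elim by simp
    have ln2: "1/2 \<le> ln (2::real)" using ln2_ge_two_thirds by auto
    have P: "(4::real) \<le> 2 ^ L" using power_increasing [of 2 L "2::real"] elim by simp
    have 1: "2 ^ L / (2 * real L) \<le> c1"
    proof -
      have "(2::nat) ^ 1 \<le> 2 ^ L" using elim by (intro power_increasing) auto
      then have "(real (2 ^ L) - 2) * ln 2 \<le> c1 * ln (real (2 ^ L))"
        unfolding c1_def by (intro card_primes_lower_bound) simp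
      also have "c1 * ln (real (2 ^ L)) = (c1 * real L) * ln 2" by (simp add: ln_realpow)
      finally have "2 ^ L - 2 \<le> c1 * real L" using ln2 by simp
      then have "2 ^ L / 2 \<le> c1 * real L" using P by linarith
      then show ?thesis using elim(2) by (simp add: field_simps)
    qed
    have 2: "ln (real L) / 2 \<le> c2"
      using card_power_exponents(3) [of L] elim unfolding c2_def by linarith
    have 3: "real L / (4 * ln (real L)) \<le> c3"
    proof -
      have "(real L - 2) * (1/2) \<le> (real L - 2) * ln 2" using elim(2) ln2 by (intro mult_left_mono) auto
      also have "\<dots> \<le> c3 * ln (real L)" unfolding c3_def using elim(2) by (intro card_primes_lower_bound) simp
      finally have "real L / 2 - 1 \<le> c3 * ln (real L)" by (simp add: left_diff_distrib)
      moreover have "1 \<le> real L / 4" using elim(2) by simp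
      ultimately have "real L / 4 \<le> c3 * ln (real L)" by linarith
      then show ?thesis using lnL by (simp add: field_simps)
    qed
    \<comment> \<open>Chebyshev's bound for p and for q and the count of the exponents k multiply to
      this; the factors L and ln L cancel.\<close>
    have "2 ^ L / 16 = (2 ^ L / (2 * real L)) * ((ln (real L) / 2) * (real L / (4 * ln (real L))))"
      using lnL elim(2) by simp
    also have "\<dots> \<le> c1 * (c2 * c3)"
      using 1 2 3 lnL by (intro mult_mono) (auto simp: c1_def c2_def c3_def)
    also have "\<dots> = real (card (triples L))"
      by (simp add: triples_def fib_exponents_def card_cartesian_product c1_def c2_def c3_def)
    finally show ?case .
  qed
qed

lemma card_triple_sums_lower_bound:
  obtains c where "c > 0" "\<forall>\<^sub>F L in sequentially. c * 2 ^ L \<le> real (card (triple_sum ` triples L))"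
proof -
  obtain C where C: "C > 0" "\<forall>\<^sub>F L in sequentially.
    real (card {(x, y) \<in> triples L \<times> triples L. triple_sum x = triple_sum y}) \<le> C * 2 ^ L"
    by (rule card_triple_collisions_bound) blast
  have e: "\<forall>\<^sub>F n::nat in sequentially. 1 \<le> n" by (rule eventually_ge_at_top)
  show thesis
  proof (rule that)
    \<comment> \<open>256 = 16^2: the square of 2^L / 16 is at most the number of sums times C *
      2^L.\<close>
    show "1 / (256 * C) > 0" using C(1) by simp
    show "\<forall>\<^sub>F L in sequentially. 1 / (256 * C) * 2 ^ L \<le> real (card (triple_sum ` triples L))"
      using C(2) card_triples_lower_bound e
    proof eventually_elim
      case (elim L)
      define R where "R = real (card (triple_sum ` triples L))"
      have "(2 ^ L / 16)\<^sup>2 \<le> (real (card (triples L)))\<^sup>2" using elim(2) by (intro power_mono) auto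
      also have "\<dots> \<le> R * real (card {(x, y) \<in> triples L \<times> triples L. triple_sum x = triple_sum y})"
        using card_square_le_collisions [OF finite_triples [OF elim(3)], of triple_sum]
        unfolding R_def by (simp only: of_nat_mult [symmetric] of_nat_power [symmetric] of_nat_le_iff)
      also have "\<dots> \<le> R * (C * 2 ^ L)" using elim(1) by (intro mult_left_mono) (auto simp: R_def)
      finally have "2 ^ L * (2 ^ L / 256) \<le> 2 ^ L * (R * C)" by (simp add: power2_eq_square mult_ac)
      then have "2 ^ L / 256 \<le> R * C" by simp
      then show ?case using C(1) by (simp add: R_def field_simps)
    qed
  qed
qed

section \<open>From powers of two to all real x\<close>

lemma lower_density_pos_of_dyadic:
  assumes c: "c > 0" and ev: "\<forall>\<^sub>F L in sequentially. c * 2 ^ L \<le> real (card {n\<in>A. 0 < n \<and> n \<le> 2 ^ (L + 2)})"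
  shows "lower_density A > 0"
proof -
  obtain L0 where L0: "\<And>L. L \<ge> L0 \<Longrightarrow> c * 2 ^ L \<le> real (card {n\<in>A. 0 < n \<and> n \<le> 2 ^ (L + 2)})"
    using ev by (auto simp: eventually_sequentially)
  have "\<forall>\<^sub>F x::real in at_top. ereal (c / 8) \<le> ereal (real (card {n \<in> A. 0 < n \<and> real n \<le> x}) / x)"
    using eventually_ge_at_top [of "2 ^ (L0 + 3)"]
  proof eventually_elim
    case (elim x)
    have x8: "(2::real) ^ 3 \<le> 2 ^ (L0 + 3)" by (intro power_increasing) auto
    then have "8 \<le> x" using elim by simp
    then have xpos: "x > 0" by simp
    define n where "n = nat \<lfloor>x\<rfloor>"
    have nx: "real n \<le> x" "x < real n + 1" using xpos by (auto simp: n_def)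
    have "1 \<le> n" using \<open>8 \<le> x\<close> nx by linarith
    then obtain m where m: "2 ^ m \<le> n" "n < 2 ^ (m + 1)" using ex_power_ivl1 [of 2 n] by auto
    have "n + 1 \<le> 2 ^ (m + 1)" using m(2) by simp
    then have "real (2 ^ m) \<le> real n" "real (n + 1) \<le> real (2 ^ (m + 1))"
      using m(1) by (simp_all only: of_nat_le_iff)
    then have "real (2 ^ m) \<le> x" "x < real (2 ^ (m + 1))" using nx unfolding of_nat_add of_nat_1 by linarith+
    then have mx: "2 ^ m \<le> x" "x < 2 ^ (m + 1)" by simp_all
    have "(2::real) ^ (L0 + 3) < 2 ^ (m + 1)" using elim mx by linarith
    then have "L0 + 3 < m + 1" by (rule power_less_imp_less_exp [rotated]) simp
    \<comment> \<open>Then 2^(L + 2) = 2^m <= x < 2^(m + 1) = 8 * 2^L, so the count up to x is at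
      least c * 2^L > (c / 8) * x. The shift by 2 leaves room for sums of size up to 2^L + 2^(L +
      1).\<close>
    define L where "L = m - 2"
    have L: "L \<ge> L0" "m = L + 2" using \<open>L0 + 3 < m + 1\<close> by (auto simp: L_def)
    have "c / 8 * x \<le> c / 8 * 2 ^ (m + 1)" using mx c by (intro mult_left_mono) auto
    also have "\<dots> = c * 2 ^ L" by (simp add: L(2) power_add)
    also have "\<dots> \<le> real (card {n\<in>A. 0 < n \<and> n \<le> 2 ^ (L + 2)})" by (rule L0 [OF L(1)])
    also have "\<dots> \<le> real (card {n \<in> A. 0 < n \<and> real n \<le> x})"
    proof -
      have "finite {n \<in> A. 0 < n \<and> real n \<le> x}"
      proof (rule finite_subset)
        show "{n \<in> A. 0 < n \<and> real n \<le> x} \<subseteq> {..n}" by (auto simp: n_def le_nat_floor)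
      qed simp
      moreover have "{n\<in>A. 0 < n \<and> n \<le> 2 ^ (L + 2)} \<subseteq> {n \<in> A. 0 < n \<and> real n \<le> x}"
      proof
        fix k assume k: "k \<in> {n\<in>A. 0 < n \<and> n \<le> 2 ^ (L + 2)}"
        then have "real k \<le> real (2 ^ m)" unfolding L(2) of_nat_le_iff by simp
        also have "\<dots> \<le> x" using mx(1) by simp
        finally show "k \<in> {n \<in> A. 0 < n \<and> real n \<le> x}" using k by simp
      qed
      ultimately show ?thesis by (simp add: card_mono)
    qed
    finally show ?case using xpos by (simp add: le_divide_eq)
  qed
  then have "ereal (c / 8) \<le> lower_density A" unfolding lower_density_def by (rule Liminf_bounded)
  moreover have "0 < ereal (c / 8)" using c by simp
  ultimately show ?thesis by (rule less_le_trans [rotated])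
qed

theorem theorem1p2:
  shows "lower_density {n::nat. n > 0 \<and> (\<exists>p q k. prime p \<and> prime q \<and> n = p + fib (2 ^ k) + fib q)} > 0"
proof -
  define A where "A = {n::nat. n > 0 \<and> (\<exists>p q k. prime p \<and> prime q \<and> n = p + fib (2 ^ k) + fib q)}"
  obtain c where c: "c > 0" "\<forall>\<^sub>F L in sequentially. c * 2 ^ L \<le> real (card (triple_sum ` triples L))"
    by (rule card_triple_sums_lower_bound) blast
  have "triple_sum ` triples L \<subseteq> {n\<in>A. 0 < n \<and> n \<le> 2 ^ (L + 2)}" for L
  proof
    fix n assume "n \<in> triple_sum ` triples L"
    then obtain p u where pu: "prime p" "p \<le> 2 ^ L" "u \<in> fib_exponents L" "n = p + fib_value u"
      by (auto simp: triples_def triple_sum_def)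
    have "prime (snd u)" using pu(3) by (auto simp: fib_exponents_def)
    moreover have "n = p + fib (2 ^ fst u) + fib (snd u)" using pu(4) by (simp add: fib_value_def)
    moreover have "n > 0" using pu(1,4) by (simp add: prime_gt_0_nat)
    ultimately have "n \<in> A" using pu(1) unfolding A_def by blast
    moreover have "n \<le> 2 ^ (L + 2)" using pu(2,4) fib_value_le [OF pu(3)] by simp
    ultimately show "n \<in> {n\<in>A. 0 < n \<and> n \<le> 2 ^ (L + 2)}" using \<open>n > 0\<close> by simp
  qed
  then have "card (triple_sum ` triples L) \<le> card {n\<in>A. 0 < n \<and> n \<le> 2 ^ (L + 2)}" for L
    by (intro card_mono) auto
  then have "\<forall>\<^sub>F L in sequentially. c * 2 ^ L \<le> real (card {n\<in>A. 0 < n \<and> n \<le> 2 ^ (L + 2)})"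
    using c(2) by (auto elim!: eventually_mono intro: order_trans)
  with c(1) show ?thesis unfolding A_def [symmetric] by (rule lower_density_pos_of_dyadic)
qed

end
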